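(* Let $A$ be generated from the heterogeneous Stochastic Block Model: $\{A_{ij}:i\le j\}$ are independent with $A_{ij}\sim\mathrm{Ber}(p_{ij})$ if $\sigma_i^*\sigma_j^*=1$ and $A_{ij}\sim\mathrm{Ber}(q_{ij})$ if $\sigma_i^*\sigma_j^*=-1$, where $0\le q_{ij}\le q<p\le p_{ij}\le1$. (i) For any constants $c_0,c_1\in(0,1)$ there exist constants $C_I,C_e,C_e'>0$ such that, if $0<c_0p\le q<p\le1-c_1$ and $nI^*\ge C_I$, then with probability at least $1-10\exp(-\sqrt{\log n})$ every $\widehat Y\in\mathcal{Y}(A)$ satisfies $$\frac1n\|\widehat Y-Y^*\|_1\le\left\lfloor n\exp\left[-\Big(1-C_e\sqrt{\tfrac1{nI^*}}\Big)\tfrac n2I^*\right]\right\rfloor,\qquad \mathrm{err}(\widehat\sigma^{\mathrm{sdp}},\sigma^* )\le\exp\left[-\Big(1-C_e'\sqrt{\tfrac1{nI^*}}\Big)\tfrac n2I^*\right].$$ (ii) For any constants $c_0,c_1\in(0,1)$, if $0<c_0p\le q<p\le1-c_1$ and $nI^*\to\infty$ as $n\to\infty$, then with probability $1-o(1)$ every $\widehat Y\in\mathcal{Y}(A)$ satisfies $$\frac1n\|\widehat Y-Y^*\|_1\le\left\lfloor n\exp\left[-(1-o(1))\tfrac n2I^*\right]\right\rfloor,\qquad \mathrm{err}(\widehat\sigma^{\mathrm{sdp}},\sigma^* )\le\exp\left[-(1-o(1))\tfrac n2I^*\right].$$ Here $\widehat\sigma^{\mathrm{sdp}}\in\{\pm1\}^n$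 is the vector of entrywise signs of a top eigenvector of $\widehat Y$.
   Context: $\sigma^*\in\{\pm1\}^n$ is a deterministic ground-truth vector with $\sum_i\sigma_i^*=0$; $Y^*=\sigma^*(\sigma^* )^\top$; $A\in\{0,1\}^{n\times n}$ is symmetric. The parameters $p,q$ and $p_{ij},q_{ij}$ may depend on $n$. $I^*=-2\log[\sqrt{pq}+\sqrt{(1-p)(1-q)}]$ (in terms of the uniform bounds $p,q$). $\mathcal{Y}(A)$ is the set of $Y\in\mathbb{R}^{n\times n}$ with $Y\succeq0$, $Y_{ii}=1$ for all $i$, $\sum_{i,j}Y_{ij}=0$ (i.e. feasible for the SDP maximizing $\langle A,Y\rangle$ under these constraints), and $\langle A,Y\rangle\ge\langle A,Y^*\rangle$, where $\langle A,Y\rangle=\sum_{i,j}A_{ij}Y_{ij}$. $\|M\|_1=\sum_{i,j}|M_{ij}|$. $\mathrm{err}(\sigma,\sigma')=\min_{g\in\{\pm1\}}\frac1n\sum_{i=1}^n\mathbf{1}\{g\sigma_i\ne\sigma'_i\}$. The sign of $0$ is taken to be $1$. The $o(1)$ terms are deterministic sequences tending to $0$ as $n\to\infty$. *)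

theory Defs
  imports "HOL-Probability.Probability" "Jordan_Normal_Form.Char_Poly"
begin

unbundle no vec_syntax

definition frob_inner :: "nat \<Rightarrow> real mat \<Rightarrow> real mat \<Rightarrow> real" where
  "frob_inner n A B = (\<Sum>i<n. \<Sum>j<n. A $$ (i, j) * B $$ (i, j))"

definition entry_l1_norm :: "nat \<Rightarrow> real mat \<Rightarrow> real" where
  "entry_l1_norm n M = (\<Sum>i<n. \<Sum>j<n. \<bar>M $$ (i, j)\<bar>)"

definition psd :: "nat \<Rightarrow> real mat \<Rightarrow> bool" where
  "psd n Y \<longleftrightarrow> Y \<in> carrier_mat n n \<and> transpose_mat Y = Y \<and>
     (\<forall>x \<in> carrier_vec n. 0 \<le> scalar_prod x (Y *\<^sub>v x))"

definition top_eigenvector :: "real mat \<Rightarrow> real Matrix.vec \<Rightarrow> bool" where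
  "top_eigenvector Y v \<longleftrightarrow> (\<exists>l. eigenvector Y v l \<and> (\<forall>k. eigenvalue Y k \<longrightarrow> k \<le> l))"

definition sign_vec :: "real Matrix.vec \<Rightarrow> real Matrix.vec" where
  "sign_vec v = map_vec (\<lambda>x. if 0 \<le> x then 1 else - 1) v"

definition balanced_labels :: "nat \<Rightarrow> real Matrix.vec \<Rightarrow> bool" where
  "balanced_labels n s \<longleftrightarrow>
     s \<in> carrier_vec n \<and> (\<forall>i<n. s $ i \<in> {-1, 1}) \<and> (\<Sum>i<n. s $ i) = 0"

definition cluster_mat :: "nat \<Rightarrow> real Matrix.vec \<Rightarrow> real mat" where
  "cluster_mat n s = mat n n (\<lambda>(i, j). s $ i * s $ j)"

definition err :: "nat \<Rightarrow> real Matrix.vec \<Rightarrow> real Matrix.vec \<Rightarrow> real" where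
  "err n s t = (MIN g\<in>{-1, 1}. (1 / real n) * (\<Sum>i<n. of_bool (g * s $ i \<noteq> t $ i)))"

definition upper_pairs :: "nat \<Rightarrow> (nat \<times> nat) set" where
  "upper_pairs n = {(i, j). i \<le> j \<and> j < n}"

definition edge_prob ::
  "real Matrix.vec \<Rightarrow> (nat \<Rightarrow> nat \<Rightarrow> real) \<Rightarrow> (nat \<Rightarrow> nat \<Rightarrow> real) \<Rightarrow> nat \<times> nat \<Rightarrow> real" where
  "edge_prob s P Q = (\<lambda>(i, j). if s $ i * s $ j = 1 then P i j else Q i j)"

definition sym_adj :: "nat \<Rightarrow> (nat \<times> nat \<Rightarrow> bool) \<Rightarrow> real mat" where
  "sym_adj n f = mat n n (\<lambda>(i, j). of_bool (f (min i j, max i j)))"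

text \<open>
  The law of the random symmetric 0/1 matrix whose entries on and above the diagonal are independent
  Bernoulli variables. Lemma \<open>hsbm_law\<close> below shows that any random matrix of this kind, on any
  probability space, has this law.
\<close>

definition hsbm ::
  "nat \<Rightarrow> real Matrix.vec \<Rightarrow> (nat \<Rightarrow> nat \<Rightarrow> real) \<Rightarrow> (nat \<Rightarrow> nat \<Rightarrow> real) \<Rightarrow> real mat pmf" where
  "hsbm n s P Q = map_pmf (sym_adj n)
     (Pi_pmf (upper_pairs n) False (\<lambda>k. bernoulli_pmf (edge_prob s P Q k)))"

text \<open>
  For each pair only one of \<open>P i j\<close>, \<open>Q i j\<close> is used by \<open>hsbm\<close>; the other one is unconstrained by
  the model, so bounding both loses no generality.
\<close>

definition hsbm_params ::
  "nat \<Rightarrow> real Matrix.vec \<Rightarrow> real \<Rightarrow> real \<Rightarrow> (nat \<Rightarrow> nat \<Rightarrow> real) \<Rightarrow> (nat \<Rightarrow> nat \<Rightarrow> real) \<Rightarrow> bool" where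
  "hsbm_params n s p q P Q \<longleftrightarrow> balanced_labels n s \<and>
     (\<forall>i j. i \<le> j \<and> j < n \<longrightarrow>
        0 \<le> Q i j \<and> Q i j \<le> q \<and> q < p \<and> p \<le> P i j \<and> P i j \<le> 1)"

text \<open>The Renyi divergence of order 1/2 between the Bernoulli laws with parameters p and q.\<close>

definition renyi_info :: "real \<Rightarrow> real \<Rightarrow> real" where
  "renyi_info p q = - 2 * ln (sqrt (p * q) + sqrt ((1 - p) * (1 - q)))"

definition sdp_feasible :: "nat \<Rightarrow> real mat set" where
  "sdp_feasible n = {Y. psd n Y \<and> (\<forall>i<n. Y $$ (i, i) = 1) \<and> (\<Sum>i<n. \<Sum>j<n. Y $$ (i, j)) = 0}"

definition sdp_set :: "nat \<Rightarrow> real Matrix.vec \<Rightarrow> real mat \<Rightarrow> real mat set" where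
  "sdp_set n s A =
     {Y \<in> sdp_feasible n. frob_inner n A (cluster_mat n s) \<le> frob_inner n A Y}"

lemma finite_upper_pairs: "finite (upper_pairs n)"
  by (rule finite_subset[of _ "{..<n} \<times> {..<n}"]) (auto simp: upper_pairs_def)

lemma hsbm_law:
  fixes M :: "'w measure" and A :: "'w \<Rightarrow> real mat"
  assumes M: "prob_space M"
    and carrier: "\<And>w. w \<in> space M \<Longrightarrow> A w \<in> carrier_mat n n"
    and binary: "\<And>w i j. w \<in> space M \<Longrightarrow> i < n \<Longrightarrow> j < n \<Longrightarrow> A w $$ (i, j) \<in> {0, 1}"
    and sym: "\<And>w i j. w \<in> space M \<Longrightarrow> i < n \<Longrightarrow> j < n \<Longrightarrow> A w $$ (i, j) = A w $$ (j, i)"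
    and indep: "prob_space.indep_vars M (\<lambda>_. borel) (\<lambda>k w. A w $$ k) (upper_pairs n)"
    and edge: "\<And>k. k \<in> upper_pairs n \<Longrightarrow>
        measure M {w \<in> space M. A w $$ k = 1} = edge_prob s P Q k"
  shows "measure M {w \<in> space M. A w \<in> S} = measure_pmf.prob (hsbm n s P Q) S"
proof -
  interpret prob_space M by (rule M)
  let ?I = "upper_pairs n"
  let ?p = "Pi_pmf ?I False (\<lambda>k. bernoulli_pmf (edge_prob s P Q k))"
  let ?F = "PiE_dflt ?I False (\<lambda>_. UNIV :: bool set)"
  let ?f = "\<lambda>w k. k \<in> ?I \<and> A w $$ k = 1"
  have fin: "finite ?I" by (rule finite_upper_pairs)
  have finF: "finite ?F" by (rule finite_PiE_dflt) (auto intro: fin)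
  have A_eq: "A w = sym_adj n (?f w)" if w: "w \<in> space M" for w
  proof (rule eq_matI)
    fix i j assume "i < dim_row (sym_adj n (?f w))" "j < dim_col (sym_adj n (?f w))"
    then have ij: "i < n" "j < n" by (auto simp: sym_adj_def)
    then have "(min i j, max i j) \<in> ?I" by (auto simp: upper_pairs_def)
    moreover have "A w $$ (min i j, max i j) = A w $$ (i, j)"
      using sym[OF w ij] by (cases "i \<le> j") (auto simp: min_def max_def)
    ultimately show "A w $$ (i, j) = sym_adj n (?f w) $$ (i, j)"
      using binary[OF w ij] ij by (auto simp: sym_adj_def)
  qed (use carrier[OF w] in \<open>auto simp: sym_adj_def\<close>)
  have rv: "random_variable borel (\<lambda>w. A w $$ k)" if "k \<in> ?I" for k
    using indep that by (auto simp: indep_vars_def)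
  have ev1: "{w \<in> space M. A w $$ k = 1} \<in> events" if "k \<in> ?I" for k
    using measurable_sets[OF rv[OF that], of "{1}"] by (simp add: vimage_def Int_def conj_commute)
  have bin: "A w $$ k \<in> {0, 1}" if "w \<in> space M" "k \<in> ?I" for w k
    using binary[OF that(1), of "fst k" "snd k"] that(2) by (auto simp: upper_pairs_def)
  let ?E = "\<lambda>g k. {w \<in> space M. A w $$ k \<in> {of_bool (g k)}}"
  have E_ev: "?E g k \<in> events" if "k \<in> ?I" for g k
    using measurable_sets[OF rv[OF that], of "{of_bool (g k)}"]
    by (simp add: vimage_def Int_def conj_commute)
  have p01: "0 \<le> edge_prob s P Q k" "edge_prob s P Q k \<le> 1" if "k \<in> ?I" for k
    using edge[OF that, symmetric] by auto
  have E_prob: "prob (?E g k) = pmf (bernoulli_pmf (edge_prob s P Q k)) (g k)" if k: "k \<in> ?I" for g k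
  proof (cases "g k")
    case True
    then show ?thesis using edge[OF k] p01[OF k] by simp
  next
    case False
    have "?E g k = space M - {w \<in> space M. A w $$ k = 1}"
      using bin[OF _ k] False by auto
    then show ?thesis using prob_compl[OF ev1[OF k]] edge[OF k] p01[OF k] False by simp
  qed
  let ?G = "\<lambda>g. {w \<in> space M. ?f w = g}"
  have G_eq: "?G g = {w \<in> space M. \<forall>k\<in>?I. A w $$ k \<in> {of_bool (g k)}}" if g: "g \<in> ?F" for g
  proof -
    have "?f w = g \<longleftrightarrow> (\<forall>k\<in>?I. A w $$ k \<in> {of_bool (g k)})" if w: "w \<in> space M" for w
    proof -
      have *: "(A w $$ k = 1) = g k \<longleftrightarrow> A w $$ k \<in> {of_bool (g k)}" if "k \<in> ?I" for k
        using bin[OF w that] by (cases "g k") auto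
      have "?f w = g \<longleftrightarrow> (\<forall>k\<in>?I. (A w $$ k = 1) = g k)"
        using g by (auto simp: PiE_dflt_def fun_eq_iff)
      also have "\<dots> \<longleftrightarrow> (\<forall>k\<in>?I. A w $$ k \<in> {of_bool (g k)})"
        using * by (intro ball_cong) auto
      finally show ?thesis .
    qed
    then show ?thesis by (intro Collect_cong conj_cong refl)
  qed
  have G: "?G g \<in> events \<and> prob (?G g) = pmf ?p g" if g: "g \<in> ?F" for g
  proof
    show "?G g \<in> events"
      unfolding G_eq[OF g] by (rule sets.sets_Collect_finite_All[OF E_ev fin])
  next
    have "prob (?G g) = (\<Prod>k\<in>?I. prob (?E g k))"
    proof (cases "?I = {}")
      case True
      then show ?thesis unfolding G_eq[OF g] by (simp add: prob_space)
    next
      case False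
      have "prob (\<Inter>k\<in>?I. (\<lambda>w. A w $$ k) -` {of_bool (g k)} \<inter> space M) =
          (\<Prod>k\<in>?I. prob ((\<lambda>w. A w $$ k) -` {of_bool (g k)} \<inter> space M))"
        by (rule indep_varsD[OF indep False fin]) auto
      moreover have "(\<Inter>k\<in>?I. (\<lambda>w. A w $$ k) -` {of_bool (g k)} \<inter> space M) = ?G g"
        unfolding G_eq[OF g] using False by auto
      moreover have "(\<lambda>w. A w $$ k) -` {of_bool (g k)} \<inter> space M = ?E g k" for k
        by auto
      ultimately show ?thesis by simp
    qed
    also have "\<dots> = (\<Prod>k\<in>?I. pmf (bernoulli_pmf (edge_prob s P Q k)) (g k))"
      by (rule prod.cong) (use E_prob in auto)
    also have "\<dots> = pmf ?p g"
      using g by (subst pmf_Pi'[OF fin]) (auto simp: PiE_dflt_def)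
    finally show "prob (?G g) = pmf ?p g" .
  qed
  let ?T = "{g \<in> ?F. sym_adj n g \<in> S}"
  have "{w \<in> space M. A w \<in> S} = (\<Union>g\<in>?T. ?G g)"
    using A_eq by (auto simp: PiE_dflt_def)
  also have "prob \<dots> = (\<Sum>g\<in>?T. prob (?G g))"
    by (rule finite_measure_finite_Union)
      (use finF G in \<open>auto simp: disjoint_family_on_def\<close>)
  also have "\<dots> = (\<Sum>g\<in>?T. pmf ?p g)"
    using G by (intro sum.cong) auto
  also have "\<dots> = measure_pmf.prob ?p ?T"
    using finF by (simp add: measure_measure_pmf_finite)
  also have "\<dots> = measure_pmf.prob ?p (sym_adj n -` S)"
  proof (rule measure_pmf.finite_measure_eq_AE)
    have "set_pmf ?p \<subseteq> ?F"
      using set_Pi_pmf_subset'[OF fin] by (fastforce simp: PiE_dflt_def)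
    then show "AE g in measure_pmf ?p. (g \<in> ?T) = (g \<in> sym_adj n -` S)"
      by (auto simp: AE_measure_pmf_iff)
  qed auto
  also have "\<dots> = measure_pmf.prob (hsbm n s P Q) S"
    by (simp add: hsbm_def)
  finally show ?thesis .
qed

end

theory Submission
  imports Defs "HOL-Real_Asymp.Real_Asymp"
begin

text \<open>
  Let \<open>P\<close> be the projection orthogonal to the labels \<open>s\<close>. For admissible \<open>Y\<close> the matrix \<open>V = P Y P\<close> is positive
  semidefinite, has \<open>s\<close> and the constant vector in its kernel, and its trace is the normalized error
  \<open>||Y - s s\<^sup>T||_1 / n\<close>. If \<open>D\<close> is the diagonal matrix of the signed degrees \<open>d_i = \<Sum>j A_ij s_i s_j\<close>, then
  \<open>(D - A) s = 0\<close>, so admissibility says \<open>\<langle>D - A, V\<rangle> \<le> 0\<close>, that is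
  \<open>\<Sum>i V_ii d_i \<le> \<langle>A - EA, V\<rangle>\<close>. The argument of Kahn and Szemeredi bounds the right-hand side by
  \<open>O(sqrt (n p)) tr V\<close> up to the contribution of vertices of degree much larger than \<open>n p\<close>. Hence the weights \<open>V_ii \<le> 4\<close>
  must sit on vertices with \<open>d_i = O(sqrt (n p))\<close>. These are counted by \<open>\<Sum>i exp (- t d_i)\<close>, where \<open>t\<close> is the
  optimal Chernoff exponent: the mean is of order \<open>n exp (- n I / 2)\<close>, and replacing the threshold 0 by
  \<open>O(sqrt (n p))\<close> costs a factor \<open>exp (O(sqrt (n I)))\<close>, which is the error term of the theorem. If this count is
  below 1 there are no such vertices and \<open>V = 0\<close>, which accounts for the floor. Comparing Rayleigh quotients turns
  the trace bound into a bound for the signs of a top eigenvector.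
\<close>

section \<open>Heavy pairs\<close>

text \<open>The hypotheses allow \<open>n p\<close> of constant order. There a few vertices of large
  degree can push the norm of \<open>A - EA\<close> far above \<open>sqrt (n p)\<close>, so the form
  is bounded only on vectors supported on vertices of degree at most \<open>K n p\<close>. In the
  remaining rows and columns the entries of \<open>V\<close> are at most 4 in absolute value, and
  the degrees above \<open>K n p\<close> that they cost are controlled by a second exponential sum,
  that of \<open>exp (2 deg - K n p)\<close>. The threshold is cheap because \<open>t\<close> is
  comparable to \<open>(p - q) / p\<close> and \<open>I\<close> to \<open>(p - q)^2 / p\<close>:
  hence \<open>t * sqrt (n p)\<close> is comparable to \<open>sqrt (n I)\<close>, of lower order
  than the main exponent \<open>n I / 2\<close>. The probabilistic estimates concern the homogeneous
  model with parameters \<open>p\<close> and \<open>q\<close>. The noise and degree events are not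
  monotone in the edges, so the coupling does not transport them to the heterogeneous model. It
  transports their consequence: a matrix admissible for the heterogeneous graph is admissible for
  the coupled homogeneous one, where the deterministic argument applies to it.\<close>

lemma sum_pow2_below:
  fixes X :: real
  assumes "0 \<le> X"
  shows "(\<Sum>k<m. if 2^k < X then 2^k else 0) \<le> 2 * X"
proof (induction m)
  case 0 then show ?case using assms by simp
next
  case (Suc m)
  show ?case
  proof (cases "2^m < X")
    case True
    have "(\<Sum>k<Suc m. if 2^k < X then 2^k else 0) \<le> (\<Sum>k<Suc m. (2::real)^k)"
      by (intro sum_mono) auto
    also have "\<dots> = 2 * 2^m - 1" by (subst geometric_sum) auto
    also have "\<dots> \<le> 2 * X" using True by simp
    finally show ?thesis .
  next
    case False
    then show ?thesis using Suc by simp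
  qed
qed

lemma sum_inverse_pow2_above:
  fixes X :: real
  assumes "0 < X"
  shows "(\<Sum>k<m. if X < 2^k then 1 / 2^k else 0) \<le> 2 / X"
  using assms
proof (induction m arbitrary: X)
  case 0 then show ?case by simp
next
  case (Suc m)
  show ?case
  proof (cases "X < 1")
    case True
    have "(\<Sum>k<Suc m. if X < 2^k then 1 / 2^k else 0) \<le> (\<Sum>k<Suc m. (1/2::real)^k)"
      by (intro sum_mono) (auto simp: power_divide)
    also have "\<dots> \<le> 2" by (subst geometric_sum) auto
    also have "\<dots> \<le> 2 / X" using True Suc.prems by (simp add: field_simps)
    finally show ?thesis .
  next
    \<comment> \<open>Now \<open>X >= 1\<close>, so the term \<open>k = 0\<close> vanishes. Shifting
      the index halves \<open>X\<close>, which is why the induction generalizes over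
      \<open>X\<close>.\<close>
    case False
    have "(\<Sum>k<Suc m. if X < 2^k then 1 / 2^k else 0)
      = (\<Sum>k<m. if X < 2^Suc k then 1 / (2::real)^Suc k else 0)"
      using False by (subst sum.lessThan_Suc_shift) auto
    also have "\<dots> = (\<Sum>k<m. 1/2 * (if X/2 < 2^k then 1 / (2::real)^k else 0))"
      by (intro sum.cong) auto
    also have "\<dots> = 1/2 * (\<Sum>k<m. if X/2 < 2^k then 1 / (2::real)^k else 0)"
      by (rule sum_distrib_left[symmetric])
    also have "\<dots> \<le> 1/2 * (2 / (X/2))"
      using Suc.prems by (intro mult_left_mono Suc.IH) auto
    also have "\<dots> = 2 / X" by simp
    finally show ?thesis .
  qed
qed

text \<open>Here \<open>s \<le> t\<close> are the sizes of the level sets of a vector at heights \<open>u\<close> and \<open>v\<close>, and \<open>e\<close> is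
the number of edges between them. The four summands are the four regimes of the heavy-pair argument
of Kahn and Szemeredi: edge density within a constant factor of its mean; density so large that the
discrepancy bound forces \<open>e = O(t)\<close>; and two intermediate regimes, according to the mass \<open>t v^2 / n\<close>
of the larger level.\<close>

lemma level_pair_bound:
  fixes s t u v d e n C1 C2 :: real
  assumes st: "1 \<le> s" "s \<le> t" "t \<le> n" and uv1: "1 \<le> u" "1 \<le> v" and d: "1 \<le> d"
    and tv: "t * v^2 \<le> n" and e: "0 \<le> e" and C1: "3 \<le> C1" and C2: "0 \<le> C2"
    and disc: "e \<le> C1 * (d/n) * s * t \<or> e * ln (e / ((d/n) * s * t)) \<le> C2 * t * ln (exp 1 * n / t)"
    and heavy: "sqrt d < 4 * (u * v)"
  shows "u * v * e \<le> 4 * C1 * sqrt d * n * (s * u^2/n) * (t * v^2/n) + 4 * C2 * u * v * t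
     + (if u < sqrt d then 4 * C2 * u * v^2 * t else 0) + 2 * sqrt d * n * (s * u^2/n) * (sqrt d/(u * v))"
proof -
  have n: "0 < n" using st by linarith
  have pos: "0 < s" "0 < t" "0 < u" "0 < v" using st uv1 by auto
  have sd: "1 \<le> sqrt d" "sqrt d * sqrt d = d" using d by auto
  define \<mu> where "\<mu> = (d/n) * s * t"
  define L where "L = e / \<mu>"
  define \<beta> where "\<beta> = t * v^2 / n"
  have mu: "0 < \<mu>" unfolding \<mu>_def using pos n d by auto
  have beta: "0 < \<beta>" "\<beta> \<le> 1" unfolding \<beta>_def using pos n tv by auto
  have L0: "0 \<le> L" unfolding L_def using e mu by auto
  have eL: "e = L * \<mu>" unfolding L_def using mu by auto
  let ?A = "4 * C1 * sqrt d * n * (s * u^2/n) * (t * v^2/n)" and ?B = "4 * C2 * u * v * t"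
   and ?C = "if u < sqrt d then 4 * C2 * u * v^2 * t else 0" and ?D = "2 * sqrt d * n * (s * u^2/n) * (sqrt d/(u
       * v))"
  have nn: "0 \<le> ?A" "0 \<le> ?B" "0 \<le> ?C" "0 \<le> ?D"
    using pos n C1 C2 d by (auto intro!: mult_nonneg_nonneg divide_nonneg_nonneg)
  \<comment> \<open>All regimes are read off one normal form: the masses \<open>s u^2 / n\<close>
    and \<open>t v^2 / n\<close> of the two levels, times \<open>L sqrt d / (u v)\<close>, where
    \<open>L\<close> compares \<open>e\<close> with its expected order.\<close>
  have main: "u * v * e = sqrt d * n * (s * u^2/n) * (t * v^2/n) * (L * sqrt d / (u * v))"
  proof -
    have "u * v * (L * (q * q / n * s * t)) = q * n * (s * u^2/n) * (t * v^2/n) * (L * q / (u * v))" for q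
    proof -
      have "n \<noteq> 0" "u \<noteq> 0" "v \<noteq> 0" using n pos by auto
      then show ?thesis by (simp add: field_simps power2_eq_square)
    qed
    from this[of "sqrt d"] show ?thesis unfolding eL \<mu>_def sd(2) .
  qed
  consider (A) "L * sqrt d \<le> 4 * C1 * (u * v)" | (N) "4 * C1 * (u * v) < L * sqrt d" by linarith
  then show ?thesis
  proof cases
    case A
    have "L * sqrt d / (u * v) \<le> 4 * C1" using A pos by (simp add: pos_divide_le_eq)
    then have "u * v * e \<le> sqrt d * n * (s * u^2/n) * (t * v^2/n) * (4 * C1)"
      unfolding main using pos n sd by (intro mult_left_mono) auto
    also have "\<dots> = ?A" by simp
    finally show ?thesis using nn by linarith
  next
    case N
    \<comment> \<open>Heaviness says \<open>sqrt d < 4 u v\<close>, so a large value of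
      \<open>L sqrt d / (u v)\<close> forces \<open>L > C1\<close>. The density alternative in
      \<open>disc\<close> then fails, and the logarithmic one must hold.\<close>
    have "4 * C1 * (u * v) < L * (4 * (u * v))"
      using N heavy L0 by (smt (verit) mult_left_mono)
    then have "C1 * (4 * (u * v)) < L * (4 * (u * v))" by (simp add: ac_simps)
    then have LC: "C1 < L" using pos by (simp add: mult_less_cancel_right)
    have L3: "3 < L" using LC C1 by simp
    have lnL: "1 \<le> ln L"
    proof -
      have "exp 1 \<le> L" using L3 exp_le by linarith
      then show ?thesis using L3 by (subst ln_ge_iff) auto
    qed
    have "\<not> e \<le> C1 * \<mu>" using LC mu unfolding eL by (simp add: mult_less_cancel_right not_le)
    then have dis: "e * ln L \<le> C2 * t * ln (exp 1 * n / t)"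
      using disc unfolding \<mu>_def L_def by (simp add: ac_simps)
    have ln1: "1 \<le> ln (exp 1 * n / t)"
    proof -
      have "exp 1 \<le> exp 1 * n / t" using st pos by (simp add: field_simps)
      then show ?thesis using pos n by (subst ln_ge_iff) auto
    qed
    show ?thesis
    proof (cases "ln (exp 1 * n / t) \<le> 4 * ln L")
      case True
      have "e * (ln (exp 1 * n / t)) \<le> e * (4 * ln L)" using True e by (rule mult_left_mono)
      also have "\<dots> \<le> 4 * (C2 * t * ln (exp 1 * n / t))" using dis by simp
      finally have "e * ln (exp 1 * n / t) \<le> (4 * C2 * t) * ln (exp 1 * n / t)" by simp
      then have "e \<le> 4 * C2 * t" using ln1 by (simp add: mult_le_cancel_right)
      then have "u * v * e \<le> u * v * (4 * C2 * t)" using pos by (intro mult_left_mono) auto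
      also have "\<dots> = ?B" by simp
      finally show ?thesis using nn by linarith
    next
      case False
      have "ln (L^4) < ln (exp 1 * n / t)" using False L3 by (simp add: ln_realpow)
      then have L4: "L^4 < exp 1 * n / t" using L3 pos n by (subst (asm) ln_less_cancel_iff) auto
      \<comment> \<open>\<open>L^4 < e v^2 / \<beta>\<close> is at most a constant times
        \<open>v^4\<close> or times \<open>1 / \<beta>^4\<close>, according to whether
        \<open>\<beta> v^2\<close> is at least 1. The fourth power is what makes both alternatives
        close.\<close>
      have nt: "exp 1 * n / t = exp 1 * v^2 / \<beta>" unfolding \<beta>_def using pos n by (simp add: field_simps)
      show ?thesis
      proof (cases "1 \<le> \<beta> * v^2")
        case True
        have "exp 1 * v^2 / \<beta> \<le> exp 1 * v^4"
        proof -
          have "exp 1 * v^2 * 1 \<le> exp 1 * v^2 * (\<beta> * v^2)" using True by (intro mult_left_mono) auto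
          then show ?thesis using beta by (simp add: pos_divide_le_eq power2_eq_square power4_eq_xxxx ac_simps)
        qed
        then have le: "exp 1 * n / t \<le> exp 1 * v^4" using nt by simp
        have "L^4 < 16 * v^4"
        proof -
          have "exp 1 * v^4 \<le> 3 * v^4" using exp_le by (intro mult_right_mono) auto
          moreover have "0 \<le> v^4" by simp
          ultimately show ?thesis using L4 le by linarith
        qed
        also have "\<dots> = (2 * v)^4" by (simp add: power_mult_distrib)
        finally have L2: "L < 2 * v" using pos by (meson power_less_imp_less_base less_le mult_nonneg_nonneg
            zero_le_numeral)
        \<comment> \<open>With \<open>L < 2 v\<close> the factor \<open>v\<close> cancels in
          \<open>N\<close>, leaving the cutoff \<open>u < sqrt d\<close>. This cutoff later makes
          the third summand geometric in dyadic \<open>u\<close>.\<close>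
        have "4 * C1 * (u * v) < (2 * v) * sqrt d" using N L2 sd by (smt (verit) mult_right_mono)
        then have "(2 * C1 * u) * (2 * v) < sqrt d * (2 * v)" by (simp add: ac_simps)
        then have "2 * C1 * u < sqrt d" using pos by (simp add: mult_less_cancel_right)
        moreover have "1 * u \<le> 2 * C1 * u" using C1 pos by (intro mult_right_mono) auto
        ultimately have us: "u < sqrt d" by simp
        have "e \<le> e * ln L" using lnL e by (simp add: mult_le_cancel_left1)
        also have "\<dots> \<le> C2 * t * ln (exp 1 * v^4)"
          using dis le pos n C2 by (smt (verit) ln_mono mult_left_mono mult_nonneg_nonneg divide_pos_pos
              mult_pos_pos exp_gt_zero)
        also have "ln (exp 1 * v^4) = 1 + 4 * ln v" using pos by (simp add: ln_mult ln_realpow)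
        also have "C2 * t * (1 + 4 * ln v) \<le> C2 * t * (4 * v)"
          using ln_le_minus_one[of v] pos C2 by (intro mult_left_mono) auto
        finally have "u * v * e \<le> u * v * (C2 * t * (4 * v))" using pos by (intro mult_left_mono) auto
        also have "\<dots> = ?C" using us by (simp add: power2_eq_square)
        finally show ?thesis using nn by linarith
      next
        case False
        have "L^4 * \<beta>^4 < (exp 1 * v^2 / \<beta>) * \<beta>^4"
          using L4 nt beta by (intro mult_strict_right_mono) auto
        also have "\<dots> = exp 1 * (\<beta> * v^2) * \<beta>^2" using beta by (simp add: power2_eq_square power4_eq_xxxx)
        also have "\<dots> \<le> 3 * 1 * 1"
          using exp_le False beta by (intro mult_mono) (auto simp: power_le_one)
        finally have "(L*\<beta>)^4 < 2^4" by (simp add: power_mult_distrib)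
        then have Lb: "L * \<beta> < 2" by (meson power_less_imp_less_base zero_le_numeral)
        have "u * v * e = sqrt d * n * (s * u^2/n) * (sqrt d / (u * v)) * (L * \<beta>)"
          unfolding main \<beta>_def by (simp only: divide_inverse ac_simps)
        also have "\<dots> \<le> sqrt d * n * (s * u^2/n) * (sqrt d / (u * v)) * 2"
          using Lb pos n sd by (intro mult_left_mono) auto
        also have "\<dots> = ?D" by simp
        finally show ?thesis using nn by linarith
      qed
    qed
  qed
qed

lemma ex_pow2_interval:
  fixes y :: real
  assumes "1 \<le> y"
  shows "\<exists>k. 2^k \<le> y \<and> y < 2^(k+1)"
proof -
  obtain m where m: "y < 2^m" using real_arch_pow[of 2 y] by auto
  define M where "M = (LEAST m. y < 2^m)"
  have M: "y < 2^M" unfolding M_def using m by (rule LeastI)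
  have M0: "M \<noteq> 0" using M assms by (cases M) auto
  then obtain k where k: "M = Suc k" by (cases M) auto
  have "\<not> y < 2^k" using not_less_Least[of k "\<lambda>m. y < 2^m"] k unfolding M_def by auto
  then show ?thesis using M k by (intro exI[of _ k]) auto
qed

text \<open>Pairs whose entries differ by a factor of at least \<open>sqrt d\<close> are paid for by
  the row sums, once for each order: this gives \<open>2 * K\<close>. The other pairs fall into
  dyadic levels, where \<open>level_pair_bound\<close> applies and each of its four regimes sums to
  \<open>O(sqrt d * n)\<close>. The factor 8 is 4 for rounding two entries to powers of 2, times 2
  for ordering the levels by size; \<open>4 * C1 + 24 * C2 + 16\<close> collects the four regimes.
  Row sums are bounded only on the support of \<open>y\<close>, which is all that truncation by
  degree provides.\<close>

lemma heavy_pairs_bound: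
  fixes a :: "nat \<Rightarrow> nat \<Rightarrow> real" and y :: "nat \<Rightarrow> real" and d K C1 C2 :: real
  assumes n: "0 < n" and d: "1 \<le> d" and C1: "3 \<le> C1" and C2: "0 \<le> C2" and K: "0 \<le> K"
    and a0: "\<And>i j. 0 \<le> a i j" and asym: "\<And>i j. a i j = a j i"
    and y0: "\<And>i. 0 \<le> y i" and y2: "(\<Sum>i<n. (y i)^2) \<le> real n"
    and deg: "\<And>i. i < n \<Longrightarrow> y i \<noteq> 0 \<Longrightarrow> (\<Sum>j<n. a i j) \<le> K * d"
    and disc: "\<And>S T. S \<subseteq> {..<n} \<Longrightarrow> T \<subseteq> {..<n} \<Longrightarrow> S \<noteq> {} \<Longrightarrow> card S \<le> card T \<Longrightarrow>
       (\<Sum>i\<in>S. \<Sum>j\<in>T. a i j) \<le> C1 * (d/real n) * real (card S) * real (card T) \<or>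
       (\<Sum>i\<in>S. \<Sum>j\<in>T. a i j) * ln ((\<Sum>i\<in>S. \<Sum>j\<in>T. a i j) / ((d/real n) * real (card S) * real (card T)))
         \<le> C2 * real (card T) * ln (exp 1 * real n / real (card T))"
  shows "(\<Sum>i<n. \<Sum>j<n. if sqrt d \<le> y i * y j then a i j * (y i * y j) else 0)
     \<le> (2 * K + 8 * (4 * C1 + 24 * C2 + 16)) * sqrt d * real n"
proof -
  define q where "q = sqrt d"
  have q1: "1 \<le> q" and qq: "q * q = d" unfolding q_def using d by auto
  define S where "S k = {i\<in>{..<n}. 2^k \<le> y i \<and> y i < 2^(k+1)}" for k :: nat
  define e where "e k l = (\<Sum>i\<in>S k. \<Sum>j\<in>S l. a i j)" for k l
  define s where "s k = real (card (S k))" for k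
  \<comment> \<open>What a near pair forces on its dyadic levels, with a factor 2 lost for each
    entry rounded in the estimate. These inequalities supply the cutoffs that make the sums over
    levels converge.\<close>
  define cnd where "cnd k l \<longleftrightarrow> q < 4 * (2^k * 2^l) \<and> (2::real)^k < 2 * q * 2^l \<and> (2::real)^l < 2 * q * 2^k" for k
      l :: nat
  define F where "F k l = (if cnd k l then 2^k * 2^l * e k l else 0)" for k l
  define al where "al k = s k * (2^k)^2 / n" for k :: nat
  have finS: "finite (S k)" for k unfolding S_def by auto
  have Ssub: "S k \<subseteq> {..<n}" for k unfolding S_def by auto
  have e0: "0 \<le> e k l" for k l unfolding e_def by (intro sum_nonneg a0)
  have esym: "e k l = e l k" for k l
    unfolding e_def by (subst sum.swap) (simp add: asym)
  have cndsym: "cnd k l = cnd l k" for k l unfolding cnd_def by (auto simp: ac_simps)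
  have F0: "0 \<le> F k l" for k l unfolding F_def using e0 by auto
  have Fsym: "F k l = F l k" for k l unfolding F_def using esym[of k l] cndsym[of k l] by (simp add: ac_simps)
  have disj: "k = l" if "i \<in> S k" "i \<in> S l" for i k l
  proof -
    have "(2::real)^k < 2^(l+1)" "(2::real)^l < 2^(k+1)" using that unfolding S_def by auto
    then have "k < l + 1" "l < k + 1" by (metis one_less_numeral_iff power_less_imp_less_exp semiring_norm(76))+
    then show ?thesis by auto
  qed
  have al0: "0 \<le> al k" for k unfolding al_def s_def by auto
  have alsum: "(\<Sum>k<n. al k) \<le> 1"
  proof -
    have "(\<Sum>k<n. s k * (2^k)^2) \<le> (\<Sum>k<n. \<Sum>i\<in>S k. (y i)^2)"
    proof (intro sum_mono)
      fix k
      have "(\<Sum>i\<in>S k. (2^k)^2) \<le> (\<Sum>i\<in>S k. (y i)^2)"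
        by (intro sum_mono power_mono) (auto simp: S_def)
      then show "s k * (2^k)^2 \<le> (\<Sum>i\<in>S k. (y i)^2)" by (simp add: s_def)
    qed
    also have "\<dots> = (\<Sum>i\<in>(\<Union>k<n. S k). (y i)^2)"
      by (rule sum.UNION_disjoint[symmetric]) (use finS disj in \<open>auto\<close>)
    also have "\<dots> \<le> (\<Sum>i<n. (y i)^2)" by (rule sum_mono2) (use Ssub in auto)
    also have "\<dots> \<le> n" by (rule y2)
    finally show ?thesis unfolding al_def sum_divide_distrib[symmetric] using n by simp
  qed
  have al1: "al k \<le> 1" if "k < n" for k
    using member_le_sum[of k "{..<n}" al] al0 alsum that by force
  \<comment> \<open>If \<open>y j <= y i / q\<close>, the product is at most
    \<open>(y i)^2 / q\<close>. Summing over \<open>j\<close> first brings in the row sum of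
    \<open>i\<close>, and rows with \<open>y i = 0\<close> contribute nothing.\<close>
  have far: "(\<Sum>i<n. \<Sum>j<n. if y j * q \<le> y i then a i j * (y i * y j) else 0) \<le> K * q * n"
  proof -
    have "(\<Sum>i<n. \<Sum>j<n. if y j * q \<le> y i then a i j * (y i * y j) else 0)
       \<le> (\<Sum>i<n. \<Sum>j<n. a i j * ((y i)^2 / q))"
    proof (intro sum_mono)
      fix i j
      show "(if y j * q \<le> y i then a i j * (y i * y j) else 0) \<le> a i j * ((y i)^2 / q)"
      proof (cases "y j * q \<le> y i")
        case True
        then have "y j \<le> y i / q" using q1 by (simp add: pos_le_divide_eq)
        then have "y i * y j \<le> y i * (y i / q)" using y0 by (intro mult_left_mono) auto
        then have "a i j * (y i * y j) \<le> a i j * (y i * (y i / q))" using a0 by (rule mult_left_mono)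
        then show ?thesis using True by (simp add: power2_eq_square)
      qed (use a0 q1 in auto)
    qed
    also have "\<dots> = (\<Sum>i<n. (\<Sum>j<n. a i j) * ((y i)^2 / q))" by (simp only: sum_distrib_right)
    also have "\<dots> \<le> (\<Sum>i<n. (K * d) * ((y i)^2 / q))"
    proof (intro sum_mono)
      fix i assume "i \<in> {..<n}"
      then show "(\<Sum>j<n. a i j) * ((y i)^2 / q) \<le> (K * d) * ((y i)^2 / q)"
        using mult_right_mono[of "\<Sum>j<n. a i j" "K * d" "(y i)^2 / q"] deg[of i] q1 by (cases "y i = 0") simp_all
    qed
    also have "\<dots> = K * q * (\<Sum>i<n. (y i)^2)"
      unfolding sum_distrib_left using q1 by (intro sum.cong) (auto simp: qq[symmetric])
    also have "\<dots> \<le> K * q * n"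
      using y2 q1 K by (intro mult_left_mono) auto
    finally show ?thesis .
  qed
  have far': "(\<Sum>i<n. \<Sum>j<n. if y i * q \<le> y j then a i j * (y i * y j) else 0) \<le> K * q * n"
  proof -
    have "(\<Sum>i<n. \<Sum>j<n. if y i * q \<le> y j then a i j * (y i * y j) else 0)
      = (\<Sum>i<n. \<Sum>j<n. if y j * q \<le> y i then a i j * (y i * y j) else 0)"
      by (subst sum.swap, intro sum.cong refl) (simp add: asym mult.commute)
    then show ?thesis using far by simp
  qed
  define near where "near i j \<longleftrightarrow> q \<le> y i * y j \<and> y i < y j * q \<and> y j < y i * q" for i j
  have levels: "(\<Sum>i<n. \<Sum>j<n. if near i j then a i j * (y i * y j) else 0) \<le> 4 * (\<Sum>k<n. \<Sum>l<n. F k l)"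
  proof -
    define G where "G i j k l = (if i \<in> S k \<and> j \<in> S l \<and> cnd k l then 4 * (2^k * 2^l) * a i j else 0)" for i j k
        l
    have G0: "0 \<le> G i j k l" for i j k l unfolding G_def using a0 by auto
    have pt: "(if near i j then a i j * (y i * y j) else 0) \<le> (\<Sum>k<n. \<Sum>l<n. G i j k l)"
      if ij: "i < n" "j < n" for i j
    proof (cases "near i j")
      case True
      have h: "q \<le> y i * y j" "y i < y j * q" "y j < y i * q" using True unfolding near_def by auto
      \<comment> \<open>Both entries of a near pair are at least 1, since \<open>q <= z w\<close>
        and \<open>w < z q\<close> give \<open>z^2 >= 1\<close>. Hence only levels with nonnegative
        exponent occur.\<close>
      have one: "1 \<le> z" if "q \<le> z * w" "w < z * q" "0 \<le> z" "0 \<le> w" for z w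
      proof (rule ccontr)
        assume "\<not> 1 \<le> z"
        then have z: "z < 1" by simp
        have "q \<le> z * w" by fact
        also have "\<dots> \<le> z * (z * q)" using that by (intro mult_left_mono) auto
        also have "\<dots> = (z * z) * q" by simp
        also have "\<dots> < 1 * q"
        proof (intro mult_strict_right_mono)
          have "z * z \<le> z * 1" using z that by (intro mult_left_mono) auto
          then show "z * z < 1" using z by simp
        qed (use q1 in auto)
        finally show False by simp
      qed
      have yi: "1 \<le> y i" using one[of "y i" "y j"] h y0 by auto
      have yj: "1 \<le> y j" using one[of "y j" "y i"] h y0 by (auto simp: mult.commute)
      obtain k where k: "2^k \<le> y i" "y i < 2^(k+1)" using ex_pow2_interval[OF yi] by auto
      obtain l where l: "2^l \<le> y j" "y j < 2^(l+1)" using ex_pow2_interval[OF yj] by auto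
      \<comment> \<open>The total mass bounds the levels: \<open>4^m <= n < 2^n\<close>, so summing
        over exponents below \<open>n\<close> loses no level.\<close>
      have small: "m < n" if "2^m \<le> y r" "r < n" for m r
      proof -
        have "((2::real)^m)^2 \<le> (y r)^2" using that by (intro power_mono) auto
        also have "\<dots> \<le> (\<Sum>i<n. (y i)^2)" using that by (intro member_le_sum) auto
        also have "\<dots> \<le> n" by (rule y2)
        also have "real n < 2^n" by (rule of_nat_less_two_power)
        finally have "((2::real)^m)^2 < 2^n" .
        moreover have "(2::real)^m \<le> ((2::real)^m)^2" by (simp add: power2_eq_square)
        ultimately have "(2::real)^m < 2^n" by linarith
        then show ?thesis by simp
      qed
      have kn: "k < n" and ln: "l < n" using small[OF k(1) ij(1)] small[OF l(1) ij(2)] by auto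
      have c: "cnd k l"
        unfolding cnd_def
      proof (intro conjI)
        have "y i * y j < 2^(k+1) * 2^(l+1)" using k l y0 yi yj by (intro mult_strict_mono) auto
        then show "q < 4 * (2^k * 2^l)" using h by simp
        have "2^k \<le> y i" by fact
        also have "\<dots> < y j * q" by fact
        also have "\<dots> < 2^(l+1) * q" using l q1 by (intro mult_strict_right_mono) auto
        finally show "(2::real)^k < 2 * q * 2^l" by (simp add: ac_simps)
        have "2^l \<le> y j" by fact
        also have "\<dots> < y i * q" by fact
        also have "\<dots> < 2^(k+1) * q" using k q1 by (intro mult_strict_right_mono) auto
        finally show "(2::real)^l < 2 * q * 2^k" by (simp add: ac_simps)
      qed
      have "y i * y j \<le> 2^(k+1) * 2^(l+1)" using k l y0 yi yj by (intro mult_mono) auto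
      then have "a i j * (y i * y j) \<le> a i j * (2^(k+1) * 2^(l+1))" using a0 by (rule mult_left_mono)
      also have "\<dots> = G i j k l" unfolding G_def S_def using k l c ij by auto
      also have "\<dots> \<le> (\<Sum>l<n. G i j k l)" using ln G0 by (intro member_le_sum) auto
      also have "\<dots> \<le> (\<Sum>k<n. \<Sum>l<n. G i j k l)"
        using kn G0 by (intro member_le_sum[of k _ "\<lambda>k. \<Sum>l<n. G i j k l"] sum_nonneg) auto
      finally show ?thesis using True by simp
    qed (use G0 in \<open>auto intro!: sum_nonneg\<close>)
    have "(\<Sum>i<n. \<Sum>j<n. if near i j then a i j * (y i * y j) else 0) \<le> (\<Sum>i<n. \<Sum>j<n. \<Sum>k<n. \<Sum>l<n. G i j k l)"
      by (intro sum_mono pt) auto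
    also have "\<dots> = (\<Sum>k<n. \<Sum>l<n. \<Sum>i<n. \<Sum>j<n. G i j k l)"
    proof -
      have swap3: "(\<Sum>j<n. \<Sum>k<n. \<Sum>l<n. f j k l) = (\<Sum>k<n. \<Sum>l<n. \<Sum>j<n. f j k l)"
        for f :: "nat \<Rightarrow> nat \<Rightarrow> nat \<Rightarrow> real"
        by (rule trans[OF sum.swap], rule sum.cong[OF refl], rule sum.swap)
      have "(\<Sum>i<n. \<Sum>j<n. \<Sum>k<n. \<Sum>l<n. G i j k l) = (\<Sum>i<n. \<Sum>k<n. \<Sum>l<n. \<Sum>j<n. G i j k l)"
        by (rule sum.cong[OF refl], rule swap3)
      also have "\<dots> = (\<Sum>k<n. \<Sum>l<n. \<Sum>i<n. \<Sum>j<n. G i j k l)" by (rule swap3)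
      finally show ?thesis .
    qed
    also have "\<dots> = (\<Sum>k<n. \<Sum>l<n. 4 * F k l)"
    proof (intro sum.cong refl)
      fix k l
      have "(\<Sum>i<n. \<Sum>j<n. G i j k l) = (\<Sum>i\<in>S k. \<Sum>j\<in>S l. if cnd k l then 4 * (2^k * 2^l) * a i j else 0)"
      proof -
        have "(\<Sum>i<n. \<Sum>j<n. G i j k l) = (\<Sum>i<n. if i \<in> S k then (\<Sum>j\<in>S l. if cnd k l then 4 * (2^k * 2^l) * a i j
            else 0) else 0)"
        proof (intro sum.cong refl)
          fix i
          have "(\<Sum>j<n. G i j k l) = (\<Sum>j<n. if j \<in> S l then G i j k l else 0)"
            by (intro sum.cong) (auto simp: G_def)
          also have "\<dots> = (\<Sum>j\<in>S l. G i j k l)" using Ssub[of l] by (simp add: sum.inter_restrict[symmetric]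
              Int_absorb1)
          also have "\<dots> = (if i \<in> S k then (\<Sum>j\<in>S l. if cnd k l then 4 * (2^k * 2^l) * a i j else 0) else 0)"
            by (cases "i \<in> S k") (auto simp: G_def intro!: sum.cong)
          finally show "(\<Sum>j<n. G i j k l) = (if i \<in> S k then (\<Sum>j\<in>S l. if cnd k l then 4 * (2^k * 2^l) * a i j
              else 0) else 0)" .
        qed
        then show ?thesis using Ssub[of k] by (simp add: sum.inter_restrict[symmetric] Int_absorb1)
      qed
      also have "\<dots> = 4 * F k l"
        unfolding F_def e_def by (cases "cnd k l") (simp_all only: if_True if_False sum_distrib_left mult.assoc
            sum.neutral_const mult_zero_right)
      finally show "(\<Sum>i<n. \<Sum>j<n. G i j k l) = 4 * F k l" .
    qed
    also have "\<dots> = 4 * (\<Sum>k<n. \<Sum>l<n. F k l)" by (simp add: sum_distrib_left)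
    finally show ?thesis .
  qed
  \<comment> \<open>\<open>level_pair_bound\<close> wants the smaller level set first; symmetry of
    \<open>F\<close> reduces to that order at the price of a factor 2.\<close>
  define F' where "F' k l = (if s k \<le> s l then F k l else 0)" for k l
  have F'0: "0 \<le> F' k l" for k l unfolding F'_def using F0 by auto
  have symred: "(\<Sum>k<n. \<Sum>l<n. F k l) \<le> 2 * (\<Sum>k<n. \<Sum>l<n. F' k l)"
  proof -
    have "(\<Sum>k<n. \<Sum>l<n. F k l) \<le> (\<Sum>k<n. \<Sum>l<n. F' k l + F' l k)"
      by (intro sum_mono) (use F0 Fsym in \<open>auto simp: F'_def\<close>)
    also have "\<dots> = (\<Sum>k<n. \<Sum>l<n. F' k l) + (\<Sum>k<n. \<Sum>l<n. F' l k)" by (simp add: sum.distrib)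
    also have "(\<Sum>k<n. \<Sum>l<n. F' l k) = (\<Sum>k<n. \<Sum>l<n. F' k l)" by (rule sum.swap)
    finally show ?thesis by simp
  qed
  \<comment> \<open>The four regimes with explicit cutoffs. In \<open>A2\<close> and
    \<open>A3\<close> the sum over \<open>k\<close> becomes geometric below a cutoff, in
    \<open>A4\<close> the sum over \<open>l\<close> becomes geometric above one, and
    \<open>A1\<close> is a product of masses whose sums are at most 1.\<close>
  define A1 where "A1 k l = 4 * C1 * q * n * al k * al l" for k l
  define A2 where "A2 k l = (if (2::real)^k < 2 * q * 2^l then 2^k else 0) * (4 * C2 * 2^l * s l)" for k l ::
      nat
  define A3 where "A3 k l = (if (2::real)^k < q then 2^k else 0) * (4 * C2 * (2^l)^2 * s l)" for k l :: nat
  define A4 where "A4 k l = 2 * q * n * al k * (q / 2^k) * (if q / (4 * 2^k) < (2::real)^l then 1 / 2^l else 0)"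
      for k l :: nat
  have nn: "0 \<le> A1 k l" "0 \<le> A2 k l" "0 \<le> A3 k l" "0 \<le> A4 k l" for k l
    unfolding A1_def A2_def A3_def A4_def using C1 C2 q1 al0[of k] al0[of l] by (auto simp: s_def)
  have pw: "F' k l \<le> A1 k l + A2 k l + A3 k l + A4 k l" if kl: "k < n" "l < n" for k l
  proof (cases "s k \<le> s l \<and> cnd k l \<and> S k \<noteq> {}")
    case False
    then have "F' k l = 0" unfolding F'_def F_def e_def by auto
    then show ?thesis using nn[of k l] by linarith
  next
    case True
    then have c: "q < 4 * (2^k * 2^l)" "(2::real)^k < 2 * q * 2^l" "s k \<le> s l" "S k \<noteq> {}" "cnd k l"
      unfolding cnd_def by auto
    have s1: "1 \<le> s k" unfolding s_def using c(4) finS[of k] by (simp add: Suc_le_eq card_gt_0_iff)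
    have sn: "s l \<le> n" unfolding s_def using card_mono[OF _ Ssub[of l]] by simp
    have tv: "s l * (2^l)^2 \<le> n" using al1[OF kl(2)] n unfolding al_def by simp
    have D: "e k l \<le> C1 * (d/n) * s k * s l \<or> e k l * ln (e k l / ((d/n) * s k * s l)) \<le> C2 * s l * ln (exp 1 *
        n / s l)"
      unfolding e_def s_def by (rule disc) (use Ssub c in \<open>auto simp: s_def\<close>)
    have "2^k * 2^l * e k l \<le> 4 * C1 * sqrt d * n * (s k * (2^k)^2/n) * (s l * (2^l)^2/n) + 4 * C2 * 2^k * 2^l *
        s l
     + (if 2^k < sqrt d then 4 * C2 * 2^k * (2^l)^2 * s l else 0) + 2 * sqrt d * n * (s k * (2^k)^2/n) * (sqrt
         d/(2^k * 2^l))"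
      by (rule level_pair_bound) (use s1 c sn tv D e0 C1 C2 d in \<open>auto simp: q_def\<close>)
    also have "\<dots> = A1 k l + A2 k l + A3 k l + A4 k l"
    proof -
      have "q / (4 * 2^k) < 2^l" using c(1) by (simp add: pos_divide_less_eq ac_simps)
      then show ?thesis unfolding A1_def A2_def A3_def A4_def al_def q_def[symmetric] using c(2) by simp
    qed
    finally show ?thesis unfolding F'_def F_def using c by simp
  qed
  have S1: "(\<Sum>k<n. \<Sum>l<n. A1 k l) \<le> 4 * C1 * q * n"
  proof -
    have "(\<Sum>k<n. \<Sum>l<n. A1 k l) = 4 * C1 * q * n * ((\<Sum>k<n. al k) * (\<Sum>l<n. al l))"
      unfolding A1_def sum_product by (simp add: sum_distrib_left ac_simps)
    also have "\<dots> \<le> 4 * C1 * q * n * (1 * 1)"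
      using alsum al0 C1 q1 by (intro mult_left_mono mult_mono) (auto intro!: sum_nonneg)
    finally show ?thesis by simp
  qed
  have tvsum: "(\<Sum>l<n. (2^l)^2 * s l) \<le> n"
    using alsum n unfolding al_def sum_divide_distrib[symmetric] by (simp add: ac_simps)
  have S2: "(\<Sum>k<n. \<Sum>l<n. A2 k l) \<le> 16 * C2 * q * n"
  proof -
    have "(\<Sum>k<n. \<Sum>l<n. A2 k l) = (\<Sum>l<n. (\<Sum>k<n. if (2::real)^k < 2 * q * 2^l then 2^k else 0) * (4 * C2 * 2^l * s
        l))"
      unfolding A2_def by (subst sum.swap) (simp only: sum_distrib_right)
    also have "\<dots> \<le> (\<Sum>l<n. (2 * (2 * q * 2^l)) * (4 * C2 * 2^l * s l))"
      using q1 C2 by (intro sum_mono mult_right_mono sum_pow2_below) (auto simp: s_def)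
    also have "\<dots> = 16 * C2 * q * (\<Sum>l<n. (2^l)^2 * s l)"
      unfolding sum_distrib_left by (intro sum.cong) (auto simp: power2_eq_square)
    also have "\<dots> \<le> 16 * C2 * q * n" using tvsum C2 q1 by (intro mult_left_mono) auto
    finally show ?thesis .
  qed
  have S3: "(\<Sum>k<n. \<Sum>l<n. A3 k l) \<le> 8 * C2 * q * n"
  proof -
    have "(\<Sum>k<n. \<Sum>l<n. A3 k l) = (\<Sum>k<n. if (2::real)^k < q then 2^k else 0) * (4 * C2 * (\<Sum>l<n. (2^l)^2 * s l))"
    proof -
      have "(\<Sum>k<n. \<Sum>l<n. A3 k l) = (\<Sum>k<n. if (2::real)^k < q then 2^k else 0) * (\<Sum>l<n. 4 * C2 * (2^l)^2 * s l)"
        unfolding A3_def by (rule sum_product[symmetric])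
      then show ?thesis by (simp only: sum_distrib_left mult.assoc)
    qed
    also have "\<dots> \<le> (2 * q) * (4 * C2 * n)"
      using q1 C2 tvsum by (intro mult_mono sum_pow2_below mult_left_mono mult_nonneg_nonneg sum_nonneg) (auto
          simp: s_def)
    finally show ?thesis by (simp add: ac_simps)
  qed
  have S4: "(\<Sum>k<n. \<Sum>l<n. A4 k l) \<le> 16 * q * n"
  proof -
    have "(\<Sum>k<n. \<Sum>l<n. A4 k l) = (\<Sum>k<n. 2 * q * n * al k * (q / 2^k) * (\<Sum>l<n. if q / (4 * 2^k) < (2::real)^l
        then 1 / 2^l else 0))"
      unfolding A4_def sum_distrib_left ..
    also have "\<dots> \<le> (\<Sum>k<n. 2 * q * n * al k * (q / 2^k) * (2 / (q / (4 * 2^k))))"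
      using q1 al0 by (intro sum_mono mult_left_mono sum_inverse_pow2_above) auto
    also have "\<dots> = 16 * q * n * (\<Sum>k<n. al k)"
      unfolding sum_distrib_left using q1 by (intro sum.cong) auto
    also have "\<dots> \<le> 16 * q * n * 1" using alsum q1 by (intro mult_left_mono) auto
    finally show ?thesis by simp
  qed
  have "(\<Sum>k<n. \<Sum>l<n. F' k l) \<le> (\<Sum>k<n. \<Sum>l<n. A1 k l + A2 k l + A3 k l + A4 k l)"
    by (intro sum_mono pw) auto
  also have "\<dots> \<le> 4 * C1 * q * n + 16 * C2 * q * n + 8 * C2 * q * n + 16 * q * n"
    unfolding sum.distrib by (intro add_mono S1 S2 S3 S4)
  finally have F's: "(\<Sum>k<n. \<Sum>l<n. F' k l) \<le> (4 * C1 + 24 * C2 + 16) * q * n" by (simp add: algebra_simps)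
  have "(\<Sum>i<n. \<Sum>j<n. if sqrt d \<le> y i * y j then a i j * (y i * y j) else 0)
    \<le> (\<Sum>i<n. \<Sum>j<n. (if y j * q \<le> y i then a i j * (y i * y j) else 0)
        + (if y i * q \<le> y j then a i j * (y i * y j) else 0) + (if near i j then a i j * (y i * y j) else 0))"
    by (intro sum_mono) (use a0 y0 in \<open>auto simp: near_def q_def[symmetric]\<close>)
  also have "\<dots> \<le> K * q * n + K * q * n + 8 * ((4 * C1 + 24 * C2 + 16) * q * n)"
    unfolding sum.distrib using far far' levels symred F's by (intro add_mono) auto
  finally show ?thesis unfolding q_def[symmetric] by (simp add: algebra_simps)
qed

section \<open>Products of Bernoulli variables\<close>

definition bern_prod :: "'a set \<Rightarrow> ('a \<Rightarrow> real) \<Rightarrow> ('a \<Rightarrow> bool) pmf" where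
  "bern_prod I r = Pi_pmf I False (\<lambda>k. bernoulli_pmf (r k))"

lemma finite_set_bern_prod: "finite I \<Longrightarrow> finite (set_pmf (bern_prod I r))"
proof -
  assume fin: "finite I"
  have "set_pmf (bern_prod I r) \<subseteq> PiE_dflt I False (\<lambda>_. UNIV)"
    using set_Pi_pmf_subset'[OF fin] unfolding bern_prod_def by (fastforce simp: PiE_dflt_def)
  then show ?thesis by (rule finite_subset) (auto intro: fin)
qed

lemma integrable_bern_prod [simp]:
  fixes f :: "_ \<Rightarrow> real"
  shows "finite I \<Longrightarrow> integrable (measure_pmf (bern_prod I r)) f"
  by (intro integrable_measure_pmf_finite finite_set_bern_prod)

lemma expectation_bern_prod_exp:
  fixes r c :: "'a \<Rightarrow> real"
  assumes fin: "finite I" and r: "\<And>k. k \<in> I \<Longrightarrow> 0 \<le> r k \<and> r k \<le> 1"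
  shows "measure_pmf.expectation (bern_prod I r) (\<lambda>\<omega>. exp (\<Sum>k\<in>I. c k * of_bool (\<omega> k)))
    = (\<Prod>k\<in>I. 1 - r k + r k * exp (c k))"
proof -
  have "measure_pmf.expectation (bern_prod I r) (\<lambda>\<omega>. exp (\<Sum>k\<in>I. c k * of_bool (\<omega> k)))
    = measure_pmf.expectation (bern_prod I r) (\<lambda>\<omega>. \<Prod>k\<in>I. exp (c k * of_bool (\<omega> k)))"
    by (simp only: exp_sum[OF fin])
  also have "\<dots> = (\<Prod>k\<in>I. measure_pmf.expectation (bernoulli_pmf (r k)) (\<lambda>v. exp (c k * of_bool v)))"
    unfolding bern_prod_def using fin
    by (intro expectation_prod_Pi_pmf integrable_measure_pmf_finite) auto
  also have "\<dots> = (\<Prod>k\<in>I. 1 - r k + r k * exp (c k))"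
    using r by (intro prod.cong) auto
  finally show ?thesis .
qed

lemma prob_ge_Markov:
  fixes X :: "'b \<Rightarrow> real" and M :: "'b pmf"
  assumes fin: "finite (set_pmf M)" and X: "\<And>\<omega>. 0 \<le> X \<omega>" and t: "0 < t"
  shows "measure_pmf.prob M {\<omega>. t \<le> X \<omega>} \<le> measure_pmf.expectation M X / t"
  using integral_Markov_inequality_measure[where M = "measure_pmf M" and u = X and c = t and A = UNIV] X t
    integrable_measure_pmf_finite[OF fin, of X] by simp

text \<open>For \<open>y = - x < 0\<close>, multiply out
  \<open>(1 - x + x^2) (1 + x + x^2/2) >= 1\<close> and use the quadratic Taylor lower bound for
  \<open>exp x\<close>.\<close>

lemma exp_le_quadratic:
  fixes y :: real
  assumes "\<bar>y\<bar> \<le> 1"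
  shows "exp y \<le> 1 + y + y^2"
proof (cases "0 \<le> y")
  case True
  then show ?thesis using exp_bound[of y] assms by simp
next
  case False
  define x where "x = - y"
  have x: "0 \<le> x" using False x_def by simp
  have "1 \<le> 1 + x^2/2 + x^3/2 + x^4/2" using x by simp
  also have "\<dots> = (1 - x + x^2) * (1 + x + x^2/2)"
    by (simp add: field_simps power2_eq_square power3_eq_cube power4_eq_xxxx)
  also have "\<dots> \<le> (1 - x + x^2) * exp x"
  proof (rule mult_left_mono)
    show "1 + x + x^2/2 \<le> exp x" using exp_lower_Taylor_quadratic[OF x] .
    have "0 \<le> (x - 1/2)^2 + 3/4" by simp
    also have "\<dots> = 1 - x + x^2" by (simp add: power2_eq_square algebra_simps)
    finally show "0 \<le> 1 - x + x^2" .
  qed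
  finally have "1 / exp x \<le> 1 - x + x^2" by (simp add: pos_divide_le_eq)
  then show ?thesis unfolding x_def by (simp add: exp_minus inverse_eq_divide)
qed

text \<open>A Bernstein bound with the exponent left to the caller. The variance proxy carries the
  weights \<open>r k\<close>; this is what yields deviations of order \<open>sqrt (n p)\<close>
  rather than \<open>sqrt n\<close> in the sparse regime.\<close>

lemma bern_prod_chernoff_centered:
  fixes r c :: "'a \<Rightarrow> real"
  assumes fin: "finite I" and r: "\<And>k. k \<in> I \<Longrightarrow> 0 \<le> r k \<and> r k \<le> 1"
    and th: "0 < \<theta>" and c: "\<And>k. k \<in> I \<Longrightarrow> \<bar>\<theta> * c k\<bar> \<le> 1"
    and V: "(\<Sum>k\<in>I. r k * (c k)^2) \<le> V"
  shows "measure_pmf.prob (bern_prod I r) {\<omega>. t \<le> (\<Sum>k\<in>I. c k * (of_bool (\<omega> k) - r k))} \<le> exp (\<theta>^2 * V - \<theta> * t)"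
proof -
  let ?M = "bern_prod I r"
  let ?X = "\<lambda>\<omega>. exp (\<theta> * (\<Sum>k\<in>I. c k * (of_bool (\<omega> k) - r k)))"
  have "{\<omega>. t \<le> (\<Sum>k\<in>I. c k * (of_bool (\<omega> k) - r k))} = {\<omega>. exp (\<theta> * t) \<le> ?X \<omega>}"
    using th by auto
  then have "measure_pmf.prob ?M {\<omega>. t \<le> (\<Sum>k\<in>I. c k * (of_bool (\<omega> k) - r k))} \<le> measure_pmf.expectation ?M ?X /
      exp (\<theta> * t)"
    using prob_ge_Markov[OF finite_set_bern_prod[OF fin], where X = ?X and t = "exp (\<theta> * t)"] by simp
  also have "measure_pmf.expectation ?M ?X
    = measure_pmf.expectation ?M (\<lambda>\<omega>. exp (\<Sum>k\<in>I. (\<theta> * c k) * of_bool (\<omega> k)) * exp (- (\<Sum>k\<in>I. \<theta> * c k * r k)))"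
    by (intro Bochner_Integration.integral_cong refl)
      (simp add: exp_add[symmetric] sum_distrib_left algebra_simps sum_subtractf)
  also have "\<dots> = (\<Prod>k\<in>I. 1 - r k + r k * exp (\<theta> * c k)) * (\<Prod>k\<in>I. exp (- (\<theta> * c k * r k)))"
    using expectation_bern_prod_exp[OF fin r, where c = "\<lambda>k. \<theta> * c k"] fin by (simp add: exp_sum
        sum_negf[symmetric])
  also have "\<dots> = (\<Prod>k\<in>I. (1 - r k + r k * exp (\<theta> * c k)) * exp (- (\<theta> * c k * r k)))"
    by (rule prod.distrib[symmetric])
  also have "\<dots> \<le> (\<Prod>k\<in>I. exp (\<theta>^2 * (r k * (c k)^2)))"
  proof (intro prod_mono conjI)
    fix k assume k: "k \<in> I"
    let ?y = "\<theta> * c k"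
    have r01: "0 \<le> r k" "r k \<le> 1" using r[OF k] by auto
    have b: "exp ?y \<le> 1 + ?y + ?y^2" using c[OF k] by (rule exp_le_quadratic)
    have "1 - r k + r k * exp ?y = 1 + r k * (exp ?y - 1)" by (simp add: algebra_simps)
    also have "\<dots> \<le> exp (r k * (exp ?y - 1))" by (rule exp_ge_add_one_self)
    also have "\<dots> \<le> exp (r k * (?y + ?y^2))" using b r01 by (auto intro!: mult_left_mono)
    finally have "(1 - r k + r k * exp ?y) * exp (- (?y * r k)) \<le> exp (r k * (?y + ?y^2)) * exp (- (?y * r k))"
      by (intro mult_right_mono) auto
    also have "\<dots> = exp (\<theta>^2 * (r k * (c k)^2))" by (simp add: exp_add[symmetric] algebra_simps power2_eq_square)
    finally show "(1 - r k + r k * exp ?y) * exp (- (?y * r k)) \<le> exp (\<theta>^2 * (r k * (c k)^2))" .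
    show "0 \<le> (1 - r k + r k * exp ?y) * exp (- (?y * r k))" using r01 by auto
  qed
  also have "\<dots> = exp (\<theta>^2 * (\<Sum>k\<in>I. r k * (c k)^2))" using fin by (simp add: exp_sum sum_distrib_left)
  also have "\<dots> \<le> exp (\<theta>^2 * V)" using V by (auto intro: mult_left_mono)
  finally show ?thesis by (simp add: exp_diff divide_right_mono)
qed

text \<open>The Poisson regime. The choice \<open>\<theta> = ln (x / \<mu>)\<close> gives the
  exponent \<open>x - x \<theta>\<close>, and \<open>x >= exp 2 * \<mu>\<close> means
  \<open>\<theta> >= 2\<close>, so half of \<open>x \<theta>\<close> absorbs
  \<open>x\<close>.\<close>

lemma bern_prod_chernoff_upper:
  fixes r :: "'a \<Rightarrow> real"
  assumes fin: "finite I" and r: "\<And>k. k \<in> I \<Longrightarrow> 0 \<le> r k \<and> r k \<le> 1" and J: "J \<subseteq> I"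
    and mu: "(\<Sum>k\<in>J. r k) \<le> \<mu>" "0 < \<mu>" and x: "exp 2 * \<mu> \<le> x"
  shows "measure_pmf.prob (bern_prod I r) {\<omega>. x \<le> (\<Sum>k\<in>J. of_bool (\<omega> k))} \<le> exp (- (x * ln (x / \<mu>) / 2))"
proof -
  let ?M = "bern_prod I r"
  define \<theta> where "\<theta> = ln (x / \<mu>)"
  have xm: "exp 2 \<le> x / \<mu>" using mu x by (simp add: pos_le_divide_eq)
  then have xp: "0 < x / \<mu>" by (smt (verit) exp_gt_zero)
  then have x0: "0 < x" using mu by (simp add: zero_less_divide_iff)
  have th2: "2 \<le> \<theta>" unfolding \<theta>_def using xm xp by (simp add: ln_ge_iff)
  have eth: "exp \<theta> = x / \<mu>" unfolding \<theta>_def using xp by simp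
  let ?X = "\<lambda>\<omega>. exp (\<Sum>k\<in>I. (if k \<in> J then \<theta> else 0) * of_bool (\<omega> k))"
  have Xeq: "(\<Sum>k\<in>I. (if k \<in> J then \<theta> else 0) * of_bool (\<omega> k)) = \<theta> * (\<Sum>k\<in>J. of_bool (\<omega> k))" for \<omega>
  proof -
    have "(\<Sum>k\<in>I. (if k \<in> J then \<theta> else 0) * of_bool (\<omega> k)) = (\<Sum>k\<in>J. (if k \<in> J then \<theta> else 0) * of_bool (\<omega> k))"
      by (rule sum.mono_neutral_right) (use fin J in auto)
    also have "\<dots> = \<theta> * (\<Sum>k\<in>J. of_bool (\<omega> k))" by (simp add: sum_distrib_left)
    finally show ?thesis .
  qed
  have "{\<omega>. x \<le> (\<Sum>k\<in>J. of_bool (\<omega> k))} = {\<omega>. exp (\<theta> * x) \<le> ?X \<omega>}"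
    unfolding Xeq using th2 by auto
  then have "measure_pmf.prob ?M {\<omega>. x \<le> (\<Sum>k\<in>J. of_bool (\<omega> k))} \<le> measure_pmf.expectation ?M ?X / exp (\<theta> * x)"
    using prob_ge_Markov[OF finite_set_bern_prod[OF fin], where X = ?X and t = "exp (\<theta> * x)"] by simp
  also have "measure_pmf.expectation ?M ?X = (\<Prod>k\<in>I. 1 - r k + r k * exp (if k \<in> J then \<theta> else 0))"
    by (rule expectation_bern_prod_exp[OF fin r])
  also have "\<dots> \<le> (\<Prod>k\<in>I. exp (if k \<in> J then r k * exp \<theta> else 0))"
  proof (intro prod_mono conjI)
    fix k assume k: "k \<in> I"
    show "0 \<le> 1 - r k + r k * exp (if k \<in> J then \<theta> else 0)" using r[OF k] by auto
    have "1 + r k * (exp \<theta> - 1) \<le> exp (r k * (exp \<theta> - 1))" by (rule exp_ge_add_one_self)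
    also have "\<dots> \<le> exp (r k * exp \<theta>)" using r[OF k] by (auto intro!: mult_left_mono)
    finally show "1 - r k + r k * exp (if k \<in> J then \<theta> else 0) \<le> exp (if k \<in> J then r k * exp \<theta> else 0)"
      by (auto simp: algebra_simps)
  qed
  also have "\<dots> = exp (\<Sum>k\<in>I. if k \<in> J then r k * exp \<theta> else 0)" using fin by (simp add: exp_sum)
  also have "(\<Sum>k\<in>I. if k \<in> J then r k * exp \<theta> else 0) = exp \<theta> * (\<Sum>k\<in>J. r k)"
  proof -
    have "(\<Sum>k\<in>I. if k \<in> J then r k * exp \<theta> else 0) = (\<Sum>k\<in>J. if k \<in> J then r k * exp \<theta> else 0)"
      by (rule sum.mono_neutral_right) (use fin J in auto)
    then show ?thesis by (simp add: sum_distrib_left mult.commute)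
  qed
  also have "exp (exp \<theta> * (\<Sum>k\<in>J. r k)) / exp (\<theta> * x) \<le> exp (exp \<theta> * \<mu>) / exp (\<theta> * x)"
    using mu by (auto intro!: divide_right_mono mult_left_mono)
  also have "\<dots> = exp (x - \<theta> * x)" unfolding eth using mu by (simp add: exp_diff)
  also have "\<dots> \<le> exp (- (x * \<theta> / 2))" 
  proof -
    have "x * 2 \<le> x * \<theta>" using th2 x0 by (intro mult_left_mono) auto
    then show ?thesis by (simp add: algebra_simps)
  qed
  finally show ?thesis unfolding \<theta>_def[symmetric] by (simp add: divide_right_mono)
qed

text \<open>Two exponentials of linear forms that share a single variable are independent apart from
  that variable. In the product formula only its factor changes, and \<open>\<kappa>\<close>
  measures the relative increase. The two forms will be the degrees of two vertices, which share
  just the edge between them.\<close>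

lemma bern_prod_exp_pair:
  fixes r c c' :: "'a \<Rightarrow> real"
  assumes fin: "finite I" and r: "\<And>k. k \<in> I \<Longrightarrow> 0 \<le> r k \<and> r k \<le> 1"
    and k0: "k0 \<in> I" and sep: "\<And>k. k \<in> I \<Longrightarrow> k \<noteq> k0 \<Longrightarrow> c k = 0 \<or> c' k = 0"
    and kap: "1 - r k0 + r k0 * exp (c k0 + c' k0) \<le> (1 + \<kappa>) * ((1 - r k0 + r k0 * exp (c k0)) * (1 - r k0 + r
        k0 * exp (c' k0)))"
  shows "measure_pmf.expectation (bern_prod I r) (\<lambda>\<omega>. exp (\<Sum>k\<in>I. c k * of_bool (\<omega> k)) * exp (\<Sum>k\<in>I. c' k *
      of_bool (\<omega> k)))
    \<le> (1 + \<kappa>) * (measure_pmf.expectation (bern_prod I r) (\<lambda>\<omega>. exp (\<Sum>k\<in>I. c k * of_bool (\<omega> k)))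
       * measure_pmf.expectation (bern_prod I r) (\<lambda>\<omega>. exp (\<Sum>k\<in>I. c' k * of_bool (\<omega> k))))"
proof -
  let ?f = "\<lambda>c k. 1 - r k + r k * exp (c k)"
  have f0: "0 \<le> ?f c k" if "k \<in> I" for c k using r[OF that] by auto
  have "measure_pmf.expectation (bern_prod I r) (\<lambda>\<omega>. exp (\<Sum>k\<in>I. c k * of_bool (\<omega> k)) * exp (\<Sum>k\<in>I. c' k * of_bool
      (\<omega> k)))
    = measure_pmf.expectation (bern_prod I r) (\<lambda>\<omega>. exp (\<Sum>k\<in>I. (c k + c' k) * of_bool (\<omega> k)))"
    by (simp add: exp_add[symmetric] sum.distrib algebra_simps)
  also have "\<dots> = (\<Prod>k\<in>I. ?f (\<lambda>k. c k + c' k) k)" by (rule expectation_bern_prod_exp[OF fin r])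
  also have "\<dots> = ?f (\<lambda>k. c k + c' k) k0 * (\<Prod>k\<in>I-{k0}. ?f (\<lambda>k. c k + c' k) k)"
    using fin k0 by (rule prod.remove)
  also have "(\<Prod>k\<in>I-{k0}. ?f (\<lambda>k. c k + c' k) k) = (\<Prod>k\<in>I-{k0}. ?f c k * ?f c' k)"
  proof (intro prod.cong refl)
    fix k assume "k \<in> I - {k0}"
    then show "?f (\<lambda>k. c k + c' k) k = ?f c k * ?f c' k" using sep[of k] by auto
  qed
  also have "?f (\<lambda>k. c k + c' k) k0 * (\<Prod>k\<in>I-{k0}. ?f c k * ?f c' k) \<le> (1 + \<kappa>) * (?f c k0 * ?f c' k0) *
      (\<Prod>k\<in>I-{k0}. ?f c k * ?f c' k)"
    using kap f0 by (intro mult_right_mono prod_nonneg) auto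
  also have "\<dots> = (1 + \<kappa>) * ((\<Prod>k\<in>I. ?f c k) * (\<Prod>k\<in>I. ?f c' k))"
    unfolding prod.distrib prod.remove[OF fin k0, of "?f c"] prod.remove[OF fin k0, of "?f c'"] by (simp only:
        ac_simps)
  finally show ?thesis
    using expectation_bern_prod_exp[OF fin r, where c = c] expectation_bern_prod_exp[OF fin r, where c = c'] by
        simp
qed

text \<open>The variance of the sum is at most \<open>n * B + n^2 * G\<close>: second moments enter
  only on the diagonal, while \<open>G\<close> bounds the covariances. This is useful when second
  moments are large but the covariances are tiny.\<close>

lemma pmf_chebyshev_sum:
  fixes F :: "nat \<Rightarrow> 'b \<Rightarrow> real" and M :: "'b pmf"
  assumes fin: "finite (set_pmf M)"
    and m: "\<And>i. i < n \<Longrightarrow> measure_pmf.expectation M (F i) = m i"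
    and sq: "\<And>i. i < n \<Longrightarrow> measure_pmf.expectation M (\<lambda>\<omega>. (F i \<omega>)^2) \<le> B"
    and cr: "\<And>i j. i < n \<Longrightarrow> j < n \<Longrightarrow> i \<noteq> j \<Longrightarrow> measure_pmf.expectation M (\<lambda>\<omega>. F i \<omega> * F j \<omega>) \<le> m i * m j + G"
    and G: "0 \<le> G" and B: "0 \<le> B" and t: "0 < t"
  shows "measure_pmf.prob M {\<omega>. (\<Sum>i<n. m i) + t \<le> (\<Sum>i<n. F i \<omega>)} \<le> (n * B + n^2 * G) / t^2"
proof -
  note [simp] = integrable_measure_pmf_finite[OF fin]
  let ?X = "\<lambda>\<omega>. ((\<Sum>i<n. F i \<omega> - m i))^2"
  have "measure_pmf.prob M {\<omega>. (\<Sum>i<n. m i) + t \<le> (\<Sum>i<n. F i \<omega>)} \<le> measure_pmf.prob M {\<omega>. t^2 \<le> ?X \<omega>}"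
    using t by (intro measure_pmf.finite_measure_mono) (auto simp: sum_subtractf intro!: power_mono)
  also have "\<dots> \<le> measure_pmf.expectation M ?X / t^2"
    using t by (intro prob_ge_Markov fin) auto
  also have "measure_pmf.expectation M ?X = (\<Sum>i<n. \<Sum>j<n. measure_pmf.expectation M (\<lambda>\<omega>. (F i \<omega> - m i) * (F j \<omega> -
      m j)))"
    by (simp add: power2_eq_square sum_product)
  also have "\<dots> \<le> (\<Sum>i<n. \<Sum>j<n. (if i = j then B else 0) + G)"
  proof (intro sum_mono)
    fix i j assume ij: "i \<in> {..<n}" "j \<in> {..<n}"
    have "measure_pmf.expectation M (\<lambda>\<omega>. (F i \<omega> - m i) * (F j \<omega> - m j))
      = measure_pmf.expectation M (\<lambda>\<omega>. F i \<omega> * F j \<omega> - m j * F i \<omega> - m i * F j \<omega> + m i * m j)"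
      by (simp add: algebra_simps)
    also have "\<dots> = measure_pmf.expectation M (\<lambda>\<omega>. F i \<omega> * F j \<omega>) - m i * m j"
      using ij by (simp add: m)
    also have "\<dots> \<le> (if i = j then B else 0) + G"
    proof (cases "i = j")
      case True
      have "measure_pmf.expectation M (\<lambda>\<omega>. F j \<omega> * F j \<omega>) \<le> B"
        using sq[of j] ij by (simp add: power2_eq_square)
      moreover have "0 \<le> m j * m j" by (rule zero_le_square)
      ultimately have "measure_pmf.expectation M (\<lambda>\<omega>. F j \<omega> * F j \<omega>) - m j * m j \<le> B + G"
        using G by linarith
      then show ?thesis using True by simp
    next
      case False
      then show ?thesis using ij cr[of i j] by simp
    qed
    finally show "measure_pmf.expectation M (\<lambda>\<omega>. (F i \<omega> - m i) * (F j \<omega> - m j)) \<le> (if i = j then B else 0) + G"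
        .
  qed
  also have "\<dots> = n * B + n^2 * G" by (simp add: sum.distrib power2_eq_square algebra_simps)
  finally show ?thesis using t by (simp add: divide_right_mono)
qed

section \<open>Discrepancy\<close>

text \<open>The diagonal is dropped: all feasible matrices have the same one, so it does not affect
admissibility.\<close>

definition adj :: "(nat \<times> nat \<Rightarrow> bool) \<Rightarrow> nat \<Rightarrow> nat \<Rightarrow> real" where
  "adj \<omega> i j = (if i = j then 0 else of_bool (\<omega> (min i j, max i j)))"

definition adj_mean :: "(nat \<times> nat \<Rightarrow> real) \<Rightarrow> nat \<Rightarrow> nat \<Rightarrow> real" where
  "adj_mean r i j = (if i = j then 0 else r (min i j, max i j))"

lemma adj_sym: "adj \<omega> i j = adj \<omega> j i"
  unfolding adj_def by (simp add: min.commute max.commute)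

lemma adj_mean_sym: "adj_mean r i j = adj_mean r j i"
  unfolding adj_mean_def by (simp add: min.commute max.commute)

lemma adj_nonneg [simp]: "0 \<le> adj \<omega> i j" unfolding adj_def by auto

lemma sum_symmetric_upper_pairs:
  fixes g :: "nat \<Rightarrow> nat \<Rightarrow> real"
  assumes "\<And>i j. g i j = g j i" "\<And>i. g i i = 0"
  shows "(\<Sum>i<n. \<Sum>j<n. g i j) = (\<Sum>k\<in>upper_pairs n. 2 * g (fst k) (snd k))"
proof -
  have "(\<Sum>i<n. \<Sum>j<n. g i j) = (\<Sum>i<n. \<Sum>j<n. (if i \<le> j then g i j else 0) + (if j \<le> i then g i j else 0))"
    by (intro sum.cong refl) (use assms(2) in \<open>auto simp: not_le\<close>)
  also have "\<dots> = (\<Sum>i<n. \<Sum>j<n. if i \<le> j then g i j else 0) + (\<Sum>i<n. \<Sum>j<n. if j \<le> i then g i j else 0)"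
    by (simp add: sum.distrib)
  also have "(\<Sum>i<n. \<Sum>j<n. if j \<le> i then g i j else 0) = (\<Sum>i<n. \<Sum>j<n. if i \<le> j then g i j else 0)"
    by (subst sum.swap, intro sum.cong refl) (use assms(1) in auto)
  also have "(\<Sum>i<n. \<Sum>j<n. if i \<le> j then g i j else 0) = (\<Sum>k\<in>{..<n}\<times>{..<n}. if fst k \<le> snd k then g (fst k) (snd
      k) else 0)"
    by (simp add: sum.cartesian_product case_prod_beta)
  also have "\<dots> = (\<Sum>k\<in>upper_pairs n. g (fst k) (snd k))"
    by (subst sum.inter_filter[symmetric], simp, rule sum.cong) (auto simp: upper_pairs_def)
  finally show ?thesis by (simp add: sum_distrib_left)
qed

text \<open>Give every subset the weight \<open>x^(card S)\<close> with
  \<open>x = t / n <= 1\<close>. The subsets counted weigh at least \<open>x^t\<close> each, and all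
  subsets together weigh \<open>(1 + x)^n <= exp t\<close>.\<close>

lemma card_small_subsets_le:
  assumes "1 \<le> t" "t \<le> n"
  shows "real (card {S. S \<subseteq> {..<n} \<and> card S \<le> t}) \<le> exp (real t * ln (exp 1 * real n / real t))"
proof -
  define x where "x = real t / real n"
  have x: "0 < x" "x \<le> 1" using assms unfolding x_def by auto
  let ?F = "{S. S \<subseteq> {..<n} \<and> card S \<le> t}"
  have "real (card ?F) * x^t = (\<Sum>S\<in>?F. x^t)" by simp
  also have "\<dots> \<le> (\<Sum>S\<in>?F. x^card S)" using x by (intro sum_mono power_decreasing) auto
  also have "\<dots> \<le> (\<Sum>S\<in>Pow {..<n}. x^card S)" using x by (intro sum_mono2) auto
  also have "\<dots> = (\<Sum>S\<in>Pow {..<n}. (\<Prod>i\<in>S. x) * (\<Prod>i\<in>{..<n}-S. 1))" by simp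
  also have "\<dots> = (\<Prod>i<n. x + 1)" by (rule prod_add[symmetric]) simp
  also have "\<dots> = (1 + x)^n" by (simp add: add.commute)
  also have "\<dots> \<le> (exp x)^n" using x by (intro power_mono exp_ge_add_one_self) auto
  also have "\<dots> = exp t" unfolding x_def using assms by (simp add: exp_of_nat_mult[symmetric])
  finally have "real (card ?F) \<le> exp t / x^t" using x by (simp add: pos_le_divide_eq)
  also have "x^t = exp (t * ln x)" using x by (simp add: exp_of_nat_mult)
  also have "exp t / exp (t * ln x) = exp (t * (1 - ln x))" by (simp add: exp_diff algebra_simps)
  also have "1 - ln x = ln (exp 1 * real n / real t)" unfolding x_def using assms by (simp add: ln_div ln_mult)
  finally show ?thesis .
qed

text \<open>The left-hand side is the value at \<open>t = 1\<close>, where the right-hand side is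
  smallest. It lets the exponential gain in a union bound over sets of size \<open>t\<close> also
  absorb powers of \<open>n\<close>, uniformly in \<open>t\<close>.\<close>

lemma size_ln_ratio_ge:
  assumes "1 \<le> t" "t \<le> n"
  shows "1 + ln (real n) \<le> real t * ln (exp 1 * real n / real t)"
proof -
  have "ln (real t) \<le> ln (real n)" using assms by simp
  then have "(real t - 1) * (1 + ln (real t)) \<le> (real t - 1) * (1 + ln (real n))" using assms by (intro
      mult_left_mono) auto
  moreover have "ln (real t) \<le> real t - 1" using ln_le_minus_one[of "real t"] assms by simp
  ultimately have "1 + ln n \<le> real t * (1 + ln n - ln t)" by (simp add: algebra_simps)
  moreover have "ln (exp 1 * real n / real t) = 1 + ln n - ln t" using assms by (simp add: ln_div ln_mult)
  ultimately show ?thesis by (simp only:)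
qed

text \<open>The discrepancy property in the argument of Kahn and Szemeredi.\<close>

definition disc_event :: "nat \<Rightarrow> real \<Rightarrow> real \<Rightarrow> real \<Rightarrow> (nat \<times> nat \<Rightarrow> bool) set" where
  "disc_event n p C1 C2 = {\<omega>. \<forall>S T. S \<subseteq> {..<n} \<longrightarrow> T \<subseteq> {..<n} \<longrightarrow> S \<noteq> {} \<longrightarrow> card S \<le> card T \<longrightarrow>
     (let e = \<Sum>i\<in>S. \<Sum>j\<in>T. adj \<omega> i j; m = p * real (card S) * real (card T) in
       e \<le> C1 * m \<or> e * ln (e / m) \<le> C2 * (real (card T) * ln (exp 1 * real n / real (card T))))}"

text \<open>An edge inside the intersection of \<open>S\<close> and \<open>T\<close> is counted
  twice in \<open>e\<close>, so the independent object is the number \<open>x\<close> of distinct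
  edges, with \<open>e <= 2 x\<close>. A violation forces \<open>x * ln (x / m) >= 20 * L\<close>:
  one factor 2 is lost in \<open>e <= 2 x\<close>, another in
  \<open>ln (2 x / m) <= 2 ln (x / m)\<close>, which explains \<open>80 = 4 * 20\<close>. The
  Poisson bound halves 20 to 10, and the sum over possible integers \<open>x\<close> costs
  \<open>n^2 + 1\<close>.\<close>

lemma prob_disc_pair:
  assumes r: "\<And>k. k \<in> upper_pairs n \<Longrightarrow> 0 \<le> r k \<and> r k \<le> p" and p: "0 < p" "p \<le> 1"
    and S: "S \<subseteq> {..<n}" "S \<noteq> {}" and T: "T \<subseteq> {..<n}" and ST: "card S \<le> card T"
  defines "m \<equiv> p * real (card S) * real (card T)" and "L \<equiv> real (card T) * ln (exp 1 * real n / real (card T))"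
  shows "measure_pmf.prob (bern_prod (upper_pairs n) r)
     {\<omega>. \<not> (let e = \<Sum>i\<in>S. \<Sum>j\<in>T. adj \<omega> i j in e \<le> 2 * exp 2 * m \<or> e * ln (e / m) \<le> 80 * L)}
     \<le> real (n^2 + 1) * exp (- 10 * L)"
proof -
  let ?I = "upper_pairs n" and ?M = "bern_prod (upper_pairs n) r"
  have finS: "finite S" "finite T" using S T finite_subset by blast+
  have cS: "1 \<le> card S" using S finS by (simp add: Suc_le_eq card_gt_0_iff)
  have m: "0 < m" unfolding m_def using p cS ST by auto
  have cT: "1 \<le> card T" "card T \<le> n" using cS ST card_mono[OF _ T] by auto
  have L0: "0 < L" using size_ln_ratio_ge[OF cT] cT unfolding L_def
    by (smt (verit) ln_ge_zero of_nat_1 of_nat_le_iff)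
  define J where "J = {k\<in>?I. fst k < snd k \<and> (fst k \<in> S \<and> snd k \<in> T \<or> snd k \<in> S \<and> fst k \<in> T)}"
  have JI: "J \<subseteq> ?I" unfolding J_def by auto
  have finJ: "finite J" using finite_subset[OF JI finite_upper_pairs] .
  \<comment> \<open>Orients each edge from \<open>S\<close> to \<open>T\<close>, so that the
    distinct edges inject into \<open>S \<times> T\<close> and their mean is at most
    \<open>m\<close>.\<close>
  let ?phi = "\<lambda>k. if fst k \<in> S \<and> snd k \<in> T then k else (snd k, fst k)"
  have inj: "inj_on ?phi J"
    by (rule inj_onI) (auto simp: J_def split: if_splits)
  have "card J \<le> card (S \<times> T)"
    by (rule card_inj_on_le[OF inj]) (use finS in \<open>auto simp: J_def\<close>)
  then have cJ: "real (card J) \<le> real (card S) * real (card T)" by (simp add: card_cartesian_product flip: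
      of_nat_mult)
  have mu: "(\<Sum>k\<in>J. r k) \<le> m"
  proof -
    have "(\<Sum>k\<in>J. r k) \<le> (\<Sum>k\<in>J. p)" using r JI by (intro sum_mono) auto
    also have "\<dots> = real (card J) * p" by simp
    also have "\<dots> \<le> (real (card S) * real (card T)) * p" using cJ p by (intro mult_right_mono) auto
    finally show ?thesis unfolding m_def by (simp add: ac_simps)
  qed
  define e' where "e' \<omega> = card {k\<in>J. \<omega> k}" for \<omega> :: "nat \<times> nat \<Rightarrow> bool"
  have e': "real (e' \<omega>) = (\<Sum>k\<in>J. of_bool (\<omega> k))" for \<omega>
    unfolding e'_def using finJ by (simp add: Int_def)
  have e'n: "e' \<omega> \<le> n^2" for \<omega>
  proof -
    have "e' \<omega> \<le> card J" unfolding e'_def by (rule card_mono[OF finJ]) auto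
    also have "\<dots> \<le> card ({..<n} \<times> {..<n})" by (rule card_mono) (auto simp: J_def upper_pairs_def)
    finally show ?thesis by (simp add: power2_eq_square)
  qed
  have ee': "(\<Sum>i\<in>S. \<Sum>j\<in>T. adj \<omega> i j) \<le> 2 * real (e' \<omega>)" for \<omega>
  proof -
    let ?h = "\<lambda>z. (min (fst z) (snd z), max (fst z) (snd z))"
    have "(\<Sum>i\<in>S. \<Sum>j\<in>T. adj \<omega> i j) = (\<Sum>z\<in>S\<times>T. adj \<omega> (fst z) (snd z))"
      by (simp add: sum.cartesian_product case_prod_beta)
    also have "\<dots> = real (card {z\<in>S\<times>T. fst z \<noteq> snd z \<and> \<omega> (?h z)})"
    proof -
      have "(\<Sum>z\<in>S\<times>T. adj \<omega> (fst z) (snd z)) = (\<Sum>z\<in>S\<times>T. of_bool (fst z \<noteq> snd z \<and> \<omega> (?h z)))"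
        by (intro sum.cong) (auto simp: adj_def)
      then show ?thesis using finS by (simp add: Int_def)
    qed
    also have "{z\<in>S\<times>T. fst z \<noteq> snd z \<and> \<omega> (?h z)} \<subseteq> {k\<in>J. \<omega> k} \<union> (\<lambda>k. (snd k, fst k)) ` {k\<in>J. \<omega> k}"
    proof
      fix z assume z: "z \<in> {z\<in>S\<times>T. fst z \<noteq> snd z \<and> \<omega> (?h z)}"
      obtain i j where ij: "z = (i, j)" by (cases z)
      show "z \<in> {k\<in>J. \<omega> k} \<union> (\<lambda>k. (snd k, fst k)) ` {k\<in>J. \<omega> k}"
      proof (cases "i < j")
        case True
        then show ?thesis using z ij S T by (auto simp: J_def upper_pairs_def)
      next
        case False
        then have "(j, i) \<in> {k\<in>J. \<omega> k}" using z ij S T by (auto simp: J_def upper_pairs_def min_def max_def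
            split: if_splits)
        then show ?thesis using ij by (auto intro!: image_eqI[of _ _ "(j, i)"])
      qed
    qed
    then have "card {z\<in>S\<times>T. fst z \<noteq> snd z \<and> \<omega> (?h z)} \<le> card ({k\<in>J. \<omega> k} \<union> (\<lambda>k. (snd k, fst k)) ` {k\<in>J. \<omega> k})"
      using finJ by (intro card_mono) auto
    also have "\<dots> \<le> e' \<omega> + e' \<omega>" unfolding e'_def using finJ
      by (intro order_trans[OF card_Un_le] add_mono order_refl card_image_le) auto
    finally show ?thesis by (simp add: of_nat_mono flip: of_nat_add)
  qed
  define Xs where "Xs = {x\<in>{..n^2}. exp 2 * m \<le> real x \<and> 20 * L \<le> real x * ln (real x / m)}"
  have sub: "{\<omega>. \<not> (let e = \<Sum>i\<in>S. \<Sum>j\<in>T. adj \<omega> i j in e \<le> 2 * exp 2 * m \<or> e * ln (e / m) \<le> 80 * L)}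
     \<subseteq> (\<Union>x\<in>Xs. {\<omega>. real x \<le> (\<Sum>k\<in>J. of_bool (\<omega> k))})"
  proof
    fix \<omega> assume "\<omega> \<in> {\<omega>. \<not> (let e = \<Sum>i\<in>S. \<Sum>j\<in>T. adj \<omega> i j in e \<le> 2 * exp 2 * m \<or> e * ln (e / m) \<le> 80 * L)}"
    moreover define e where "e = (\<Sum>i\<in>S. \<Sum>j\<in>T. adj \<omega> i j)"
    ultimately have e: "2 * exp 2 * m < e" "80 * L < e * ln (e / m)" by (auto simp: Let_def not_le)
    define x where "x = real (e' \<omega>)"
    have ex: "e \<le> 2 * x" unfolding e_def x_def by (rule ee')
    have x1: "exp 2 * m \<le> x" using e ex by simp
    have e0: "0 < e" using e m by (smt (verit) exp_gt_zero mult_pos_pos)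
    have x0: "0 < x" using e0 ex by simp
    have xm2: "2 \<le> x / m"
    proof -
      have "1 + (2::real) \<le> exp 2" by (rule exp_ge_add_one_self)
      then have "2 * m \<le> exp 2 * m" using m by (intro mult_right_mono) auto
      then have "2 * m \<le> x" using x1 by linarith
      then show ?thesis using m by (simp add: pos_le_divide_eq)
    qed
    have "e * ln (e / m) \<le> e * ln (2 * x / m)"
      using e0 ex m by (intro mult_left_mono) (auto intro!: divide_right_mono)
    also have "\<dots> \<le> (2 * x) * ln (2 * x / m)"
      using ex xm2 by (intro mult_right_mono) auto
    also have "ln (2 * x / m) \<le> 2 * ln (x / m)"
    proof -
      have "ln (2 * (x / m)) = ln 2 + ln (x / m)" using xm2 by (subst ln_mult) auto
      moreover have "ln 2 \<le> ln (x / m)" using xm2 by simp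
      ultimately show ?thesis by simp
    qed
    finally have "e * ln (e / m) \<le> 2 * x * (2 * ln (x / m))" using x0 by (simp add: mult_left_mono)
    then have "20 * L \<le> x * ln (x / m)" using e by simp
    then have "e' \<omega> \<in> Xs" unfolding Xs_def using x1 e'n by (auto simp: x_def)
    moreover have "real (e' \<omega>) \<le> (\<Sum>k\<in>J. of_bool (\<omega> k))" using e' by simp
    ultimately show "\<omega> \<in> (\<Union>x\<in>Xs. {\<omega>. real x \<le> (\<Sum>k\<in>J. of_bool (\<omega> k))})" by blast
  qed
  have finX: "finite Xs" unfolding Xs_def by auto
  have "measure_pmf.prob ?M {\<omega>. \<not> (let e = \<Sum>i\<in>S. \<Sum>j\<in>T. adj \<omega> i j in e \<le> 2 * exp 2 * m \<or> e * ln (e / m) \<le> 80 *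
      L)}
    \<le> measure_pmf.prob ?M (\<Union>x\<in>Xs. {\<omega>. real x \<le> (\<Sum>k\<in>J. of_bool (\<omega> k))})"
    by (rule measure_pmf.finite_measure_mono[OF sub]) auto
  also have "\<dots> \<le> (\<Sum>x\<in>Xs. measure_pmf.prob ?M {\<omega>. real x \<le> (\<Sum>k\<in>J. of_bool (\<omega> k))})"
    by (rule measure_pmf.finite_measure_subadditive_finite[OF finX]) auto
  also have "\<dots> \<le> (\<Sum>x\<in>Xs. exp (- 10 * L))"
  proof (rule sum_mono)
    fix x assume x: "x \<in> Xs"
    have "measure_pmf.prob ?M {\<omega>. real x \<le> (\<Sum>k\<in>J. of_bool (\<omega> k))} \<le> exp (- (real x * ln (real x / m) / 2))"
      by (rule bern_prod_chernoff_upper[OF finite_upper_pairs _ JI mu m])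
        (use r p x in \<open>force simp: Xs_def\<close>)+
    also have "\<dots> \<le> exp (- 10 * L)" using x unfolding Xs_def by auto
    finally show "measure_pmf.prob ?M {\<omega>. real x \<le> (\<Sum>k\<in>J. of_bool (\<omega> k))} \<le> exp (- 10 * L)" .
  qed
  also have "\<dots> = real (card Xs) * exp (- 10 * L)" by simp
  also have "\<dots> \<le> real (n^2 + 1) * exp (- 10 * L)"
  proof -
    have "card Xs \<le> card {..n^2}" unfolding Xs_def by (intro card_mono) auto
    then have "card Xs \<le> n^2 + 1" by simp
    then show ?thesis by (intro mult_right_mono) (simp_all only: of_nat_mono exp_ge_zero)
  qed
  finally show ?thesis .
qed

text \<open>For each size \<open>t\<close> of the larger set there are at most
  \<open>exp (2 L)\<close> pairs, against the probability \<open>(n^2 + 1) * exp (- 10 L)\<close>.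
  The remaining \<open>exp (- 8 L)\<close> is at most \<open>exp (- 8) / n^8\<close>, enough for the
  factor \<open>n^2 + 1\<close> and for the sum over \<open>t\<close>.\<close>

lemma prob_disc_event:
  assumes r: "\<And>k. k \<in> upper_pairs n \<Longrightarrow> 0 \<le> r k \<and> r k \<le> p" and p: "0 < p" "p \<le> 1" and n: "0 < n"
  shows "measure_pmf.prob (bern_prod (upper_pairs n) r) (- disc_event n p (2 * exp 2) 80) \<le> 1 / real n"
proof -
  let ?M = "bern_prod (upper_pairs n) r"
  define L where "L t = real t * ln (exp 1 * real n / real t)" for t :: nat
  define bad where "bad S T = {\<omega>. \<not> (let e = \<Sum>i\<in>S. \<Sum>j\<in>T. adj \<omega> i j in
     e \<le> 2 * exp 2 * (p * real (card S) * real (card T)) \<or>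
     e * ln (e / (p * real (card S) * real (card T))) \<le> 80 * (real (card T) * ln (exp 1 * real n / real (card
         T))))}" for S T
  define As where "As t = {S. S \<subseteq> {..<n} \<and> card S \<le> t}" for t
  define P where "P t = {z \<in> As t \<times> As t. fst z \<noteq> {} \<and> card (snd z) = t \<and> card (fst z) \<le> t}" for t
  have finA: "finite (As t)" for t unfolding As_def by auto
  have finP: "finite (P t)" for t unfolding P_def using finA by auto
  have sub: "- disc_event n p (2 * exp 2) 80 \<subseteq> (\<Union>t\<in>{1..n}. \<Union>z\<in>P t. bad (fst z) (snd z))"
  proof
    fix \<omega> assume "\<omega> \<in> - disc_event n p (2 * exp 2) 80"
    then obtain S T where ST: "S \<subseteq> {..<n}" "T \<subseteq> {..<n}" "S \<noteq> {}" "card S \<le> card T" and b: "\<omega> \<in> bad S T"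
      unfolding disc_event_def bad_def Let_def by (auto simp del: de_Morgan_disj)
    have "finite S" using ST(1) finite_subset by blast
    then have "0 < card S" using ST(3) by (simp add: card_gt_0_iff)
    then have "1 \<le> card T" using ST(4) by linarith
    moreover have "card T \<le> n" using card_mono[OF _ ST(2)] by simp
    ultimately show "\<omega> \<in> (\<Union>t\<in>{1..n}. \<Union>z\<in>P t. bad (fst z) (snd z))"
      using ST b by (intro UN_I[of "card T"] UN_I[of "(S, T)"]) (auto simp: P_def As_def)
  qed
  have pt: "measure_pmf.prob ?M (\<Union>z\<in>P t. bad (fst z) (snd z)) \<le> 1 / real n ^ 2" if t: "t \<in> {1..n}" for t
  proof -
    have "measure_pmf.prob ?M (\<Union>z\<in>P t. bad (fst z) (snd z)) \<le> (\<Sum>z\<in>P t. measure_pmf.prob ?M (bad (fst z) (snd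
        z)))"
      by (rule measure_pmf.finite_measure_subadditive_finite[OF finP]) auto
    also have "\<dots> \<le> (\<Sum>z\<in>P t. real (n^2 + 1) * exp (- 10 * L t))"
    proof (rule sum_mono)
      fix z assume z: "z \<in> P t"
      then have zc: "card (snd z) = t" by (auto simp: P_def)
      show "measure_pmf.prob ?M (bad (fst z) (snd z)) \<le> real (n^2 + 1) * exp (- 10 * L t)"
        unfolding bad_def L_def zc[symmetric]
        by (rule prob_disc_pair[OF r p]) (use z in \<open>auto simp: P_def As_def\<close>)
    qed
    also have "\<dots> = real (card (P t)) * (real (n^2 + 1) * exp (- 10 * L t))" by simp
    also have "real (card (P t)) \<le> exp (L t) * exp (L t)"
    proof -
      have "card (P t) \<le> card (As t \<times> As t)" using finA unfolding P_def by (intro card_mono) auto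
      then have "real (card (P t)) \<le> real (card (As t)) * real (card (As t))"
        by (simp add: card_cartesian_product flip: of_nat_mult)
      also have "\<dots> \<le> exp (L t) * exp (L t)"
        unfolding As_def L_def using t by (intro mult_mono card_small_subsets_le) auto
      finally show ?thesis .
    qed
    also have "exp (L t) * exp (L t) * (real (n^2 + 1) * exp (- 10 * L t)) = real (n^2 + 1) * exp (- 8 * L t)"
      by (simp add: exp_add[symmetric])
    also have "\<dots> \<le> real (n^2 + 1) * exp (- 8 * (1 + ln (real n)))"
      using size_ln_ratio_ge[of t n] t unfolding L_def by (intro mult_left_mono) auto
    also have "exp (- 8 * (1 + ln (real n))) = exp (-8) * exp (- ln (real n)) ^ 8"
      by (simp add: exp_of_nat_mult[symmetric] exp_add[symmetric] algebra_simps)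
    also have "exp (- ln (real n)) = 1 / real n" using n by (simp add: exp_minus inverse_eq_divide)
    also have "real (n^2 + 1) * (exp (-8) * (1 / real n)^8) \<le> (2 * real n^2) * (1/2 * (1 / real n) ^ 8)"
    proof (intro mult_mono)
      have "2 \<le> exp (8::real)" using exp_ge_add_one_self[of 8] by linarith
      then show "exp (-8) \<le> (1/2::real)" by (simp add: exp_minus inverse_eq_divide field_simps)
      have "1 \<le> real n ^ 2" using n by simp
      then show "real (n^2 + 1) \<le> 2 * real n^2" by simp
    qed auto
    also have "\<dots> = 1 / real n ^ 6" using n by (simp add: field_simps power_divide eval_nat_numeral)
    also have "\<dots> \<le> 1 / real n^2" using n by (intro divide_left_mono power_increasing) auto
    finally show ?thesis by (simp add: mult_right_mono)
  qed
  have "measure_pmf.prob ?M (- disc_event n p (2 * exp 2) 80) \<le> measure_pmf.prob ?M (\<Union>t\<in>{1..n}. \<Union>z\<in>P t. bad (fst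
      z) (snd z))"
    by (rule measure_pmf.finite_measure_mono[OF sub]) auto
  also have "\<dots> \<le> (\<Sum>t\<in>{1..n}. measure_pmf.prob ?M (\<Union>z\<in>P t. bad (fst z) (snd z)))"
    by (rule measure_pmf.finite_measure_subadditive_finite) auto
  also have "\<dots> \<le> (\<Sum>t\<in>{1..n}. 1 / real n^2)" by (intro sum_mono pt)
  also have "\<dots> = 1 / real n" using n by (simp add: power2_eq_square)
  finally show ?thesis .
qed

section \<open>Light pairs and the spectral bound\<close>

text \<open>The point \<open>m\<close> stands for \<open>m / 4\<close>, so this is a net of mesh 1/4 (in each coordinate) of the
ball of radius \<open>sqrt n\<close>.\<close>

definition lattice_ball :: "nat \<Rightarrow> (nat \<Rightarrow> int) set" where
  "lattice_ball n = {m \<in> {..<n} \<rightarrow>\<^sub>E {- 16 * int n..16 * int n}. (\<Sum>i<n. (m i)^2) \<le> 16 * int n}"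

definition light_sum :: "nat \<Rightarrow> real \<Rightarrow> (nat \<times> nat \<Rightarrow> real) \<Rightarrow> (nat \<times> nat \<Rightarrow> bool) \<Rightarrow> (nat \<Rightarrow> real) \<Rightarrow> real" where
  "light_sum n d r \<omega> y = (\<Sum>i<n. \<Sum>j<n. if \<bar>y i * y j\<bar> < sqrt d then (adj \<omega> i j - adj_mean r i j) * (y i * y j)
      else 0)"

text \<open>With the exponent \<open>1 / (2 sqrt d)\<close> the variance term is at most
  \<open>n\<close> and a deviation of \<open>42 * sqrt d * n\<close> contributes
  \<open>21 n\<close>. The resulting \<open>exp (- 20 n)\<close> beats the size
  \<open>exp (18 n)\<close> of the lattice ball.\<close>

definition light_event :: "nat \<Rightarrow> real \<Rightarrow> (nat \<times> nat \<Rightarrow> real) \<Rightarrow> (nat \<times> nat \<Rightarrow> bool) set" where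
  "light_event n d r = {\<omega>. \<forall>m\<in>lattice_ball n. \<bar>light_sum n d r \<omega> (\<lambda>i. real_of_int (m i) / 4)\<bar> \<le> 42 * sqrt d *
      real n}"

lemma finite_lattice_ball: "finite (lattice_ball n)"
  unfolding lattice_ball_def by (rule finite_subset[OF _ finite_PiE[of "{..<n}" "\<lambda>_. {- 16 * int n..16 * int
      n}"]]) auto

lemma sum_exp_neg_square_le: "(\<Sum>k\<in>{- int L..int L}. exp (- ((real_of_int k)^2))) \<le> 3"
proof -
  \<comment> \<open>Strengthened for the induction: each step adds at most
    \<open>2 * (1/2)^(L + 1)\<close>, exactly what the subtracted term releases.\<close>
  have "(\<Sum>k\<in>{- int L..int L}. exp (- ((real_of_int k)^2))) \<le> 3 - 2 * (1/2)^L"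
  proof (induction L)
    case 0 then show ?case by simp
  next
    case (Suc L)
    have "{- int (Suc L)..int (Suc L)} = insert (- int (Suc L)) (insert (int (Suc L)) {- int L..int L})" by auto
    then have "(\<Sum>k\<in>{- int (Suc L)..int (Suc L)}. exp (- ((real_of_int k)^2))) = 2 * exp (- ((real (Suc L))^2)) +
        (\<Sum>k\<in>{- int L..int L}. exp (- ((real_of_int k)^2)))"
      by (simp del: of_nat_Suc)
    moreover have "exp (- ((real (Suc L))^2)) \<le> (1/2)^Suc L"
    proof -
      have "real (Suc L) * 1 \<le> real (Suc L) * real (Suc L)" by (intro mult_left_mono) auto
      then have "exp (- ((real (Suc L))^2)) \<le> exp (real (Suc L) * (-1))"
        unfolding power2_eq_square exp_le_cancel_iff by linarith
      also have "\<dots> = exp (-1) ^ Suc L" by (rule exp_of_nat_mult)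
      also have "\<dots> \<le> (1/2)^Suc L"
      proof (rule power_mono)
        have "2 \<le> exp (1::real)" using exp_ge_add_one_self[of 1] by simp
        then show "exp (-1) \<le> (1/2::real)" by (simp add: exp_minus inverse_eq_divide field_simps)
      qed simp
      finally show ?thesis .
    qed
    ultimately show ?case using Suc by simp
  qed
  also have "\<dots> \<le> 3" by simp
  finally show ?thesis .
qed

text \<open>Gaussian weights: a point of the ball has
  \<open>exp (16 n - sum of squares) >= 1\<close>, and the sum of these weights over the surrounding
  box factorizes over coordinates, with at most 3 per coordinate.\<close>

lemma card_lattice_ball: "real (card (lattice_ball n)) \<le> exp (18 * real n)"
proof -
  let ?B = "{..<n} \<rightarrow>\<^sub>E {- 16 * int n..16 * int n}"
  have finB: "finite ?B" by (intro finite_PiE) auto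
  have "real (card (lattice_ball n)) = (\<Sum>m\<in>lattice_ball n. 1)" by simp
  also have "\<dots> \<le> (\<Sum>m\<in>lattice_ball n. exp (16 * real n) * (\<Prod>i<n. exp (- ((real_of_int (m i))^2))))"
  proof (rule sum_mono)
    fix m assume "m \<in> lattice_ball n"
    then have "(\<Sum>i<n. (m i)^2) \<le> 16 * int n" by (simp add: lattice_ball_def)
    then have "real_of_int (\<Sum>i<n. (m i)^2) \<le> 16 * real n" by linarith
    then have h: "(\<Sum>i<n. (real_of_int (m i))^2) \<le> 16 * real n" by simp
    have "1 \<le> exp (16 * real n + (\<Sum>i<n. - ((real_of_int (m i))^2)))" using h by (simp add: sum_negf)
    also have "\<dots> = exp (16 * real n) * exp (\<Sum>i<n. - ((real_of_int (m i))^2))" by (rule exp_add)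
    also have "exp (\<Sum>i<n. - ((real_of_int (m i))^2)) = (\<Prod>i<n. exp (- ((real_of_int (m i))^2)))" by (rule
        exp_sum) simp
    finally show "1 \<le> exp (16 * real n) * (\<Prod>i<n. exp (- ((real_of_int (m i))^2)))" .
  qed
  also have "\<dots> \<le> (\<Sum>m\<in>?B. exp (16 * real n) * (\<Prod>i<n. exp (- ((real_of_int (m i))^2))))"
  proof (rule sum_mono2[OF finB])
    show "lattice_ball n \<subseteq> ?B" unfolding lattice_ball_def by blast
    show "0 \<le> exp (16 * real n) * (\<Prod>i<n. exp (- ((real_of_int (m i))^2)))" for m :: "nat \<Rightarrow> int"
      by (intro mult_nonneg_nonneg prod_nonneg) simp_all
  qed
  also have "\<dots> = exp (16 * real n) * (\<Sum>m\<in>?B. \<Prod>i<n. exp (- ((real_of_int (m i))^2)))"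
    by (rule sum_distrib_left[symmetric])
  also have "(\<Sum>m\<in>?B. \<Prod>i<n. exp (- ((real_of_int (m i))^2))) = (\<Prod>i<n. \<Sum>k\<in>{- 16 * int n..16 * int n}. exp (-
      ((real_of_int k)^2)))"
    by (rule prod_sum_PiE[symmetric]) auto
  also have "\<dots> = (\<Sum>k\<in>{- 16 * int n..16 * int n}. exp (- ((real_of_int k)^2))) ^ n" by simp
  also have "\<dots> \<le> 3 ^ n" using sum_exp_neg_square_le[of "16 * n"] by (intro power_mono sum_nonneg) auto
  also have "(3::real)^n \<le> exp 2 ^ n"
  proof (rule power_mono)
    show "3 \<le> exp (2::real)" using exp_ge_add_one_self[of 2] by simp
  qed simp
  also have "exp 2 ^ n = exp (2 * real n)" by (simp add: exp_of_nat_mult[symmetric] mult.commute)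
  finally show ?thesis by (simp add: exp_add[symmetric])
qed

text \<open>Truncation at \<open>sqrt d\<close> bounds each coefficient by
  \<open>2 * sqrt d\<close>, which is what makes the exponent \<open>1 / (2 sqrt d)\<close>
  admissible in the Bernstein bound. A union bound over the lattice and both signs finishes.\<close>

lemma prob_light_event:
  assumes r: "\<And>k. k \<in> upper_pairs n \<Longrightarrow> 0 \<le> r k \<and> r k \<le> p" and p: "0 < p" "p \<le> 1" and n: "0 < n"
    and d: "d = real n * p"
  shows "measure_pmf.prob (bern_prod (upper_pairs n) r) (- light_event n d r) \<le> 2 / real n"
proof -
  let ?M = "bern_prod (upper_pairs n) r" and ?I = "upper_pairs n"
  let ?y = "\<lambda>m i. real_of_int (m i) / 4"
  define q where "q = sqrt d"
  have q: "0 < q" "q * q = d" unfolding q_def using d n p by auto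
  define t where "t = 42 * q * real n"
  have tail: "measure_pmf.prob ?M {\<omega>. t \<le> \<epsilon> * light_sum n d r \<omega> (?y m)} \<le> exp (- (20 * real n))"
    if m: "m \<in> lattice_ball n" and eps: "\<epsilon> \<in> {-1, 1}" for m \<epsilon>
  proof -
    define y where "y = ?y m"
    have ysq: "(\<Sum>i<n. (y i)^2) \<le> real n"
    proof -
      have "(\<Sum>i<n. (m i)^2) \<le> 16 * int n" using m by (simp add: lattice_ball_def)
      then have "real_of_int (\<Sum>i<n. (m i)^2) \<le> 16 * real n" by linarith
      then have "(\<Sum>i<n. (real_of_int (m i))^2) \<le> 16 * real n" by simp
      then show ?thesis unfolding y_def by (simp add: power_divide sum_divide_distrib[symmetric])
    qed
    \<comment> \<open>The coefficients of the form in the independent upper pairs. The factor 2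
      accounts for the two symmetric positions, and the diagonal gets coefficient 0.\<close>
    define c where "c k = (if fst k \<noteq> snd k \<and> \<bar>y (fst k) * y (snd k)\<bar> < q then \<epsilon> * (2 * (y (fst k) * y (snd k)))
        else 0)" for k
    have ls: "\<epsilon> * light_sum n d r \<omega> y = (\<Sum>k\<in>?I. c k * (of_bool (\<omega> k) - r k))" for \<omega>
    proof -
      let ?g = "\<lambda>i j. if \<bar>y i * y j\<bar> < q then (adj \<omega> i j - adj_mean r i j) * (y i * y j) else 0"
      have "light_sum n d r \<omega> y = (\<Sum>k\<in>?I. 2 * ?g (fst k) (snd k))"
        unfolding light_sum_def q_def[symmetric]
        by (rule sum_symmetric_upper_pairs) (auto simp: adj_sym[of \<omega>] adj_mean_sym[of r] mult.commute adj_def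
            adj_mean_def min.commute max.commute)
      then show ?thesis unfolding sum_distrib_left
        by (simp add: sum_distrib_left, intro sum.cong refl)
          (auto simp: c_def adj_def adj_mean_def upper_pairs_def min_def max_def)
    qed
    define \<theta> where "\<theta> = 1 / (2 * q)"
    have "measure_pmf.prob ?M {\<omega>. t \<le> (\<Sum>k\<in>?I. c k * (of_bool (\<omega> k) - r k))} \<le> exp (\<theta>^2 * (4 * d * n) - \<theta> * t)"
    proof (rule bern_prod_chernoff_centered[OF finite_upper_pairs])
      show "0 \<le> r k \<and> r k \<le> 1" if "k \<in> ?I" for k using r[OF that] p by auto
      show "0 < \<theta>" unfolding \<theta>_def using q by simp
      show "\<bar>\<theta> * c k\<bar> \<le> 1" for k
      proof -
        have "\<bar>c k\<bar> \<le> 2 * q" unfolding c_def using eps q by (auto simp: abs_mult)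
        then show ?thesis unfolding \<theta>_def using q by (simp add: abs_mult pos_divide_le_eq)
      qed
      have "(\<Sum>k\<in>?I. r k * (c k)^2) \<le> (\<Sum>k\<in>?I. p * (4 * ((y (fst k))^2 * (y (snd k))^2)))"
      proof (rule sum_mono)
        fix k assume k: "k \<in> ?I"
        have "(c k)^2 \<le> 4 * ((y (fst k))^2 * (y (snd k))^2)"
          unfolding c_def using eps by (auto simp: power_mult_distrib)
        then show "r k * (c k)^2 \<le> p * (4 * ((y (fst k))^2 * (y (snd k))^2))"
          using r[OF k] by (intro mult_mono) auto
      qed
      also have "\<dots> \<le> (\<Sum>k\<in>{..<n}\<times>{..<n}. p * (4 * ((y (fst k))^2 * (y (snd k))^2)))"
        using p by (intro sum_mono2) (auto simp: upper_pairs_def)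
      also have "\<dots> = 4 * p * ((\<Sum>i<n. (y i)^2) * (\<Sum>i<n. (y i)^2))"
      proof -
        have "4 * p * ((\<Sum>i<n. (y i)^2) * (\<Sum>i<n. (y i)^2)) = (\<Sum>i<n. \<Sum>j<n. 4 * p * ((y i)^2 * (y j)^2))"
          unfolding sum_product by (simp only: sum_distrib_left)
        also have "\<dots> = (\<Sum>k\<in>{..<n}\<times>{..<n}. 4 * p * ((y (fst k))^2 * (y (snd k))^2))"
          unfolding sum.cartesian_product by (intro sum.cong) auto
        finally show ?thesis by (simp only: mult.assoc mult.left_commute[of p 4])
      qed
      also have "\<dots> \<le> 4 * p * (real n * real n)" using ysq p by (intro mult_left_mono mult_mono) (auto intro!:
          sum_nonneg)
      finally show "(\<Sum>k\<in>?I. r k * (c k)^2) \<le> 4 * d * n" unfolding d by (simp add: ac_simps)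
    qed
    also have "\<theta>^2 * (4 * d * n) - \<theta> * t = real n - 21 * real n"
      unfolding \<theta>_def t_def q(2)[symmetric] using q(1) by (simp add: power2_eq_square field_simps)
    finally show ?thesis unfolding y_def[symmetric] ls by simp
  qed
  have sub: "- light_event n d r \<subseteq> (\<Union>m\<in>lattice_ball n. {\<omega>. t \<le> 1 * light_sum n d r \<omega> (?y m)} \<union> {\<omega>. t \<le> (-1) *
      light_sum n d r \<omega> (?y m)})"
    unfolding light_event_def t_def q_def by (auto simp: not_le abs_if split: if_splits)
  have "measure_pmf.prob ?M (- light_event n d r) \<le> measure_pmf.prob ?M (\<Union>m\<in>lattice_ball n. {\<omega>. t \<le> 1 *
      light_sum n d r \<omega> (?y m)} \<union> {\<omega>. t \<le> (-1) * light_sum n d r \<omega> (?y m)})"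
    by (rule measure_pmf.finite_measure_mono[OF sub]) auto
  also have "\<dots> \<le> (\<Sum>m\<in>lattice_ball n. measure_pmf.prob ?M ({\<omega>. t \<le> 1 * light_sum n d r \<omega> (?y m)} \<union> {\<omega>. t \<le> (-1) *
      light_sum n d r \<omega> (?y m)}))"
    by (rule measure_pmf.finite_measure_subadditive_finite[OF finite_lattice_ball]) auto
  also have "\<dots> \<le> (\<Sum>m\<in>lattice_ball n. exp (- (20 * real n)) + exp (- (20 * real n)))"
    by (intro sum_mono order_trans[OF measure_Un_le] add_mono tail) auto
  also have "\<dots> = real (card (lattice_ball n)) * (2 * exp (- (20 * real n)))" by simp
  also have "\<dots> \<le> exp (18 * real n) * (2 * exp (- (20 * real n)))" by (intro mult_right_mono card_lattice_ball)
      auto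
  also have "\<dots> = 2 * exp (- (2 * real n))" by (simp add: exp_add[symmetric])
  also have "\<dots> \<le> 2 * (1 / real n)"
  proof -
    have "real n \<le> exp (2 * real n)" using exp_ge_add_one_self[of "2 * real n"] by linarith
    then show ?thesis using n by (simp add: exp_minus inverse_eq_divide field_simps)
  qed
  finally show ?thesis by simp
qed

text \<open>Rounding \<open>z\<close> towards 0 keeps its support and changes the form by at most half of its supremum,
by polarization.\<close>

lemma quad_form_lattice_bound:
  fixes M :: "nat \<Rightarrow> nat \<Rightarrow> real"
  assumes sym: "\<And>i j. M i j = M j i" and n: "0 < n"
    and lat: "\<And>m. m \<in> lattice_ball n \<Longrightarrow> (\<And>i. i < n \<Longrightarrow> m i \<noteq> 0 \<Longrightarrow> i \<in> G) \<Longrightarrow>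
       \<bar>\<Sum>i<n. \<Sum>j<n. M i j * ((real_of_int (m i) / 4) * (real_of_int (m j) / 4))\<bar> \<le> B * real n"
    and supp: "\<And>i. i < n \<Longrightarrow> z i \<noteq> 0 \<Longrightarrow> i \<in> G"
  shows "\<bar>\<Sum>i<n. \<Sum>j<n. M i j * (z i * z j)\<bar> \<le> 2 * B * (\<Sum>i<n. (z i)^2)"
proof -
  define Q where "Q z = (\<Sum>i<n. \<Sum>j<n. M i j * (z i * z j))" for z
  define sq where "sq z = (\<Sum>i<n. (z i)^2)" for z :: "nat \<Rightarrow> real"
  define Z where "Z = {z. (\<forall>i<n. z i \<noteq> 0 \<longrightarrow> i \<in> G) \<and> sq z \<le> real n}"
  \<comment> \<open>The supremum over real vectors, finite by crude entrywise estimates. Finiteness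
    is essential, because the argument ends by absorbing \<open>S / 2\<close> into
    \<open>S\<close>.\<close>
  define S where "S = (SUP z\<in>Z. \<bar>Q z\<bar>)"
  have sq0: "0 \<le> sq z" for z unfolding sq_def by (intro sum_nonneg) auto
  have comp: "(z i)^2 \<le> sq z" if "i < n" for z i
    unfolding sq_def using that by (intro member_le_sum) auto
  have bdd: "bdd_above ((\<lambda>z. \<bar>Q z\<bar>) ` Z)"
  proof (rule bdd_aboveI2)
    fix z assume z: "z \<in> Z"
    have zz: "\<bar>z i * z j\<bar> \<le> real n" if "i < n" "j < n" for i j
    proof -
      have "0 \<le> (\<bar>z i\<bar> - \<bar>z j\<bar>)^2" by simp
      then have "2 * \<bar>z i * z j\<bar> \<le> (z i)^2 + (z j)^2" by (simp add: power2_diff abs_mult)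
      then show ?thesis using comp[OF that(1), of z] comp[OF that(2), of z] z unfolding Z_def by auto
    qed
    have "\<bar>Q z\<bar> \<le> (\<Sum>i<n. \<bar>\<Sum>j<n. M i j * (z i * z j)\<bar>)" unfolding Q_def by (rule sum_abs)
    also have "\<dots> \<le> (\<Sum>i<n. \<Sum>j<n. \<bar>M i j * (z i * z j)\<bar>)" by (intro sum_mono sum_abs)
    also have "\<dots> \<le> (\<Sum>i<n. \<Sum>j<n. \<bar>M i j\<bar> * real n)"
      unfolding abs_mult[of "M _ _"] by (intro sum_mono mult_left_mono zz) auto
    finally show "\<bar>Q z\<bar> \<le> (\<Sum>i<n. \<Sum>j<n. \<bar>M i j\<bar> * real n)" .
  qed
  have zero: "(\<lambda>_. 0) \<in> Z" unfolding Z_def sq_def by auto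
  have leS: "\<bar>Q z\<bar> \<le> S" if "z \<in> Z" for z
    unfolding S_def using bdd that by (rule cSUP_upper2[of _ _ z]) auto
  have S0: "0 \<le> S" using leS[OF zero] by (smt (verit))
  have scale: "\<bar>Q z\<bar> \<le> S / n * sq z" if supp: "\<And>i. i < n \<Longrightarrow> z i \<noteq> 0 \<Longrightarrow> i \<in> G" for z
  proof (cases "sq z = 0")
    case True
    have "z i = 0" if "i < n" for i using comp[OF that, of z] True by simp
    then have "Q z = 0" unfolding Q_def by simp
    then show ?thesis using True by simp
  next
    case False
    then have pos: "0 < sq z" using sq0[of z] by simp
    define c where "c = sqrt (n / sq z)"
    have cc: "c * c = n / sq z" unfolding c_def using pos by simp
    have "sq (\<lambda>i. c * z i) = c * c * sq z"
      unfolding sq_def sum_distrib_left by (intro sum.cong) (auto simp: power2_eq_square)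
    then have "(\<lambda>i. c * z i) \<in> Z" unfolding Z_def using supp cc pos by auto
    from leS[OF this] have "\<bar>Q (\<lambda>i. c * z i)\<bar> \<le> S" .
    also have "Q (\<lambda>i. c * z i) = c * c * Q z"
      unfolding Q_def sum_distrib_left by (intro sum.cong) (auto simp: ac_simps)
    finally have "n / sq z * \<bar>Q z\<bar> \<le> S" unfolding cc using pos by (simp add: abs_mult)
    then show ?thesis using pos n by (simp add: field_simps)
  qed
  have "\<bar>Q z\<bar> \<le> B * n + S / 2" if z: "z \<in> Z" for z
  proof -
    define m where "m = (\<lambda>i\<in>{..<n}. if 0 \<le> z i then \<lfloor>4 * z i\<rfloor> else - \<lfloor>- 4 * z i\<rfloor>)"
    define y where "y i = real_of_int (m i) / 4" for i
    define w where "w i = z i - y i" for i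
    define v where "v i = z i + y i" for i
    have m1: "\<bar>real_of_int (m i)\<bar> \<le> \<bar>4 * z i\<bar>" "\<bar>4 * z i - real_of_int (m i)\<bar> \<le> 1" if "i < n" for i
    proof -
      have "\<bar>real_of_int (m i)\<bar> \<le> \<bar>4 * z i\<bar> \<and> \<bar>4 * z i - real_of_int (m i)\<bar> \<le> 1"
      proof (cases "0 \<le> z i")
        case True
        have "m i = \<lfloor>4 * z i\<rfloor>" unfolding m_def using that True by simp
        moreover have "0 \<le> \<lfloor>4 * z i\<rfloor>" using True by simp
        ultimately show ?thesis using floor_correct[of "4 * z i"] True by simp linarith
      next
        case False
        have "m i = - \<lfloor>- 4 * z i\<rfloor>" unfolding m_def using that False by simp
        moreover have "0 \<le> \<lfloor>- 4 * z i\<rfloor>" using False by simp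
        ultimately show ?thesis using floor_correct[of "- 4 * z i"] False by simp linarith
      qed
      then show "\<bar>real_of_int (m i)\<bar> \<le> \<bar>4 * z i\<bar>" "\<bar>4 * z i - real_of_int (m i)\<bar> \<le> 1" by auto
    qed
    have msq: "(\<Sum>i<n. (m i)^2) \<le> 16 * int n"
    proof -
      have "(\<Sum>i<n. (real_of_int (m i))^2) \<le> (\<Sum>i<n. (4 * z i)^2)"
        unfolding abs_le_square_iff[symmetric] by (intro sum_mono) (simp only: abs_le_square_iff[symmetric] m1
            lessThan_iff)
      also have "\<dots> = 16 * sq z" unfolding sq_def by (simp add: power_mult_distrib sum_distrib_left)
      also have "\<dots> \<le> 16 * n" using z unfolding Z_def by simp
      finally have "real_of_int (\<Sum>i<n. (m i)^2) \<le> real_of_int (16 * int n)" by simp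
      then show ?thesis by linarith
    qed
    have mb: "m \<in> lattice_ball n"
    proof -
      have "m i \<in> {- 16 * int n..16 * int n}" if "i < n" for i
      proof -
        have "(m i)^2 \<le> (\<Sum>i<n. (m i)^2)" using that by (intro member_le_sum) auto
        moreover have "\<bar>m i\<bar> \<le> (m i)^2" 
          by (metis abs_ge_zero power2_abs power2_eq_square mult_le_cancel_left1 abs_0 abs_not_less_zero
              int_one_le_iff_zero_less less_le not_le mult_zero_left order_refl)
        ultimately show ?thesis using msq by auto
      qed
      then show ?thesis unfolding lattice_ball_def using msq by (auto simp: m_def)
    qed
    have ms: "i \<in> G" if "i < n" "m i \<noteq> 0" for i
    proof -
      have "z i \<noteq> 0" using that by (auto simp: m_def split: if_splits)
      then show ?thesis using z that unfolding Z_def by auto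
    qed
    have Qy: "\<bar>Q y\<bar> \<le> B * n" unfolding Q_def y_def by (rule lat[OF mb ms])
    have wsq: "sq w \<le> n / 16"
    proof -
      have "sq w \<le> (\<Sum>i<n. (1/4)^2)"
        unfolding sq_def
      proof (intro sum_mono)
        fix i assume "i \<in> {..<n}"
        then have "\<bar>w i\<bar> \<le> \<bar>1/4\<bar>" unfolding w_def y_def using m1(2)[of i] by (simp add: abs_if split: if_splits)
        then show "(w i)^2 \<le> (1/4)^2" by (simp only: abs_le_square_iff)
      qed
      then show ?thesis by (simp add: power2_eq_square)
    qed
    have vsq: "sq v \<le> 4 * n"
    proof -
      have "sq v \<le> (\<Sum>i<n. (2 * z i)^2)"
        unfolding sq_def
      proof (intro sum_mono)
        fix i assume "i \<in> {..<n}"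
        then have "\<bar>v i\<bar> \<le> \<bar>2 * z i\<bar>" unfolding v_def y_def using m1(1)[of i] by (simp add: abs_if split:
            if_splits)
        then show "(v i)^2 \<le> (2 * z i)^2" by (simp only: abs_le_square_iff)
      qed
      also have "\<dots> = 4 * sq z" unfolding sq_def by (simp add: power_mult_distrib sum_distrib_left)
      finally show ?thesis using z unfolding Z_def by simp
    qed
    \<comment> \<open>The difference \<open>Q z - Q y\<close> pairs \<open>w = z - y\<close> with
      \<open>v = z + y\<close>, whose squared norms are at most \<open>n / 16\<close> and
      \<open>4 n\<close>. Scaling by \<open>t\<close> and \<open>1 / t\<close> with
      \<open>t^2 = 8\<close> brings both to \<open>n / 2\<close>, so the squared norms of
      \<open>f\<close> and \<open>g\<close> add up to at most \<open>2 n\<close>.\<close>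
    define t where "t = sqrt 8"
    have t: "t * t = 8" "0 < t" unfolding t_def by auto
    define f where "f i = t * w i + v i / t" for i
    define g where "g i = t * w i - v i / t" for i
    have "f i * f j - g i * g j = 2 * (w i * v j + v i * w j)" for i j
      unfolding f_def g_def using t(2) by (simp add: field_simps)
    moreover have "w i * v j + v i * w j = 2 * (z i * z j - y i * y j)" for i j
      unfolding w_def v_def by (simp add: algebra_simps)
    ultimately have fg: "f i * f j - g i * g j = 4 * (z i * z j - y i * y j)" for i j by simp
    have "Q f - Q g = (\<Sum>i<n. \<Sum>j<n. M i j * (f i * f j - g i * g j))"
      unfolding Q_def by (simp only: sum_subtractf[symmetric] right_diff_distrib)
    also have "\<dots> = 4 * (Q z - Q y)"
      unfolding fg Q_def by (simp only: sum_subtractf[symmetric] right_diff_distrib sum_distrib_left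
          mult.left_commute[of 4])
    finally have Qfg: "Q z - Q y = (Q f - Q g) / 4" by simp
    have zw: "i \<in> G" if "i < n" "w i \<noteq> 0 \<or> v i \<noteq> 0" for i
    proof -
      have "z i \<noteq> 0" using that by (auto simp: w_def v_def y_def m_def split: if_splits)
      then show ?thesis using z that unfolding Z_def by auto
    qed
    have "\<bar>Q f\<bar> \<le> S / n * sq f" 
    proof (rule scale)
      show "i \<in> G" if "i < n" "f i \<noteq> 0" for i
        using that(2) by (intro zw[OF that(1)]) (auto simp: f_def)
    qed
    moreover have "\<bar>Q g\<bar> \<le> S / n * sq g" 
    proof (rule scale)
      show "i \<in> G" if "i < n" "g i \<noteq> 0" for i
        using that(2) by (intro zw[OF that(1)]) (auto simp: g_def)
    qed
    ultimately have "\<bar>Q f\<bar> + \<bar>Q g\<bar> \<le> S / n * (sq f + sq g)" by (simp add: distrib_left)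
    also have "\<dots> \<le> S / n * (2 * n)"
    proof (rule mult_left_mono)
      have "sq f + sq g = (\<Sum>i<n. 16 * (w i)^2 + (v i)^2 / 4)"
        unfolding sq_def sum.distrib[symmetric]
      proof (intro sum.cong refl)
        fix i
        have "(f i)^2 + (g i)^2 = 2 * (t * t) * (w i)^2 + 2 * (v i)^2 / (t * t)"
          unfolding f_def g_def using t(2) by (simp add: field_simps power2_eq_square)
        then show "(f i)^2 + (g i)^2 = 16 * (w i)^2 + (v i)^2 / 4" unfolding t by simp
      qed
      also have "\<dots> = 16 * sq w + sq v / 4" unfolding sq_def by (simp add: sum.distrib sum_distrib_left
          sum_divide_distrib)
      finally show "sq f + sq g \<le> 2 * n" using wsq vsq by simp
    qed (use S0 in auto)
    finally have "\<bar>Q f\<bar> + \<bar>Q g\<bar> \<le> 2 * S" using n by simp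
    then have "\<bar>Q z - Q y\<bar> \<le> S / 2" unfolding Qfg using abs_triangle_ineq4[of "Q f" "Q g"] by simp
    then show ?thesis using Qy by linarith
  qed
  \<comment> \<open>The lattice controls \<open>Q y\<close> by \<open>B n\<close>, and the rounding
    error is at most half of the supremum itself.\<close>
  then have "S \<le> B * n + S / 2" unfolding S_def[of ] using zero by (intro cSUP_least) auto
  then have "S \<le> 2 * B * n" by simp
  then have "S / n * sq z \<le> 2 * B * n / n * sq z" using sq0 by (intro mult_right_mono divide_right_mono) auto
  moreover have "\<bar>Q z\<bar> \<le> S / n * sq z" by (rule scale) (rule supp)
  ultimately have "\<bar>Q z\<bar> \<le> 2 * B * sq z" using n by simp
  then show ?thesis unfolding Q_def sq_def .
qed

text \<open>The constant 43 is 42 from the light pairs plus 1 from the mean on heavy pairs. The rest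
  is the constant of \<open>heavy_pairs_bound\<close> with \<open>C1 = 2 * exp 2\<close> and
  \<open>C2 = 80\<close>, the values in the discrepancy event.\<close>

definition ks_const :: "real \<Rightarrow> real" where
  "ks_const K = 43 + (2 * K + 8 * (4 * (2 * exp 2) + 24 * 80 + 16))"

text \<open>On lattice points the light pairs are controlled by the light event. Heavy pairs lose
  their cancellation: the adjacency part is bounded through discrepancy and truncated degrees, the
  mean part by its size. The passage to real vectors keeps the support, so lattice points inherit
  the degree bound.\<close>

lemma centered_adj_quad_bound:
  assumes r: "\<And>k. k \<in> upper_pairs n \<Longrightarrow> 0 \<le> r k \<and> r k \<le> p" and p: "0 < p" and n: "0 < n"
    and d: "d = real n * p" "1 \<le> d" and K: "0 \<le> K"
    and disc: "\<omega> \<in> disc_event n p (2 * exp 2) 80" and light: "\<omega> \<in> light_event n d r"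
    and supp: "\<And>i. i < n \<Longrightarrow> z i \<noteq> 0 \<Longrightarrow> (\<Sum>j<n. adj \<omega> i j) \<le> K * d"
  shows "\<bar>\<Sum>i<n. \<Sum>j<n. (adj \<omega> i j - adj_mean r i j) * (z i * z j)\<bar> \<le> 2 * (ks_const K * sqrt d) * (\<Sum>i<n. (z i)^2)"
proof (rule quad_form_lattice_bound[where G = "{i. (\<Sum>j<n. adj \<omega> i j) \<le> K * d}"])
  fix m assume m: "m \<in> lattice_ball n" and ms: "\<And>i. i < n \<Longrightarrow> m i \<noteq> 0 \<Longrightarrow> i \<in> {i. (\<Sum>j<n. adj \<omega> i j) \<le> K * d}"
  define y where "y i = real_of_int (m i) / 4" for i
  define y' where "y' i = (if i < n then \<bar>y i\<bar> else 0)" for i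
  define q where "q = sqrt d"
  have q: "1 \<le> q" "q * q = d" unfolding q_def using d by auto
  have pd: "p = d / n" using d n by simp
  have ysq: "(\<Sum>i<n. (y i)^2) \<le> real n"
  proof -
    have "(\<Sum>i<n. (m i)^2) \<le> 16 * int n" using m by (simp add: lattice_ball_def)
    then have "real_of_int (\<Sum>i<n. (m i)^2) \<le> 16 * real n" by linarith
    then have "(\<Sum>i<n. (real_of_int (m i))^2) \<le> 16 * real n" by simp
    then show ?thesis unfolding y_def by (simp add: power_divide sum_divide_distrib[symmetric])
  qed
  let ?C = "2 * K + 8 * (4 * (2 * exp 2) + 24 * 80 + 16)"
  have hv: "(\<Sum>i<n. \<Sum>j<n. if sqrt d \<le> y' i * y' j then adj \<omega> i j * (y' i * y' j) else 0) \<le> ?C * sqrt d * real n"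
  proof (rule heavy_pairs_bound[OF n d(2) _ _ K])
    show "3 \<le> 2 * exp (2::real)" using exp_ge_add_one_self[of 2] by simp
    show "adj \<omega> i j = adj \<omega> j i" for i j by (rule adj_sym)
    show "0 \<le> y' i" for i unfolding y'_def by simp
    show "(\<Sum>i<n. (y' i)^2) \<le> n" using ysq unfolding y'_def by simp
    show "(\<Sum>j<n. adj \<omega> i j) \<le> K * d" if "i < n" "y' i \<noteq> 0" for i
      using ms[of i] that by (auto simp: y'_def y_def)
    fix S T :: "nat set"
    assume "S \<subseteq> {..<n}" "T \<subseteq> {..<n}" "S \<noteq> {}" "card S \<le> card T"
    then show "(\<Sum>i\<in>S. \<Sum>j\<in>T. adj \<omega> i j) \<le> 2 * exp 2 * (d/real n) * real (card S) * real (card T) \<or>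
       (\<Sum>i\<in>S. \<Sum>j\<in>T. adj \<omega> i j) * ln ((\<Sum>i\<in>S. \<Sum>j\<in>T. adj \<omega> i j) / ((d/real n) * real (card S) * real (card T)))
         \<le> 80 * real (card T) * ln (exp 1 * real n / real (card T))"
      using disc unfolding disc_event_def Let_def pd by (simp only: mem_Collect_eq mult.assoc) blast
  qed auto
  have mean0: "0 \<le> adj_mean r i j" "adj_mean r i j \<le> p" if "i < n" "j < n" for i j
    using r[of "(min i j, max i j)"] that p unfolding adj_mean_def by (auto simp: upper_pairs_def min_def
        max_def)
  define h where "h i j = (if q \<le> \<bar>y i * y j\<bar> then (adj \<omega> i j - adj_mean r i j) * (y i * y j) else 0)" for i j
  have split: "(\<Sum>i<n. \<Sum>j<n. (adj \<omega> i j - adj_mean r i j) * (y i * y j)) = light_sum n d r \<omega> y + (\<Sum>i<n. \<Sum>j<n. h i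
      j)"
    unfolding light_sum_def h_def q_def sum.distrib[symmetric] by (intro sum.cong refl) auto
  have "\<bar>\<Sum>i<n. \<Sum>j<n. h i j\<bar> \<le> (\<Sum>i<n. \<Sum>j<n. \<bar>h i j\<bar>)"
    by (intro order_trans[OF sum_abs] sum_mono sum_abs)
  also have "\<dots> \<le> (\<Sum>i<n. \<Sum>j<n. (if sqrt d \<le> y' i * y' j then adj \<omega> i j * (y' i * y' j) else 0) + p / q * ((y i)^2
      * (y j)^2))"
  proof (intro sum_mono)
    fix i j assume ij: "i \<in> {..<n}" "j \<in> {..<n}"
    have yy: "y' i * y' j = \<bar>y i * y j\<bar>" using ij by (simp add: y'_def abs_mult)
    have nn: "0 \<le> p / q * ((y i)^2 * (y j)^2)" using p q by auto
    show "\<bar>h i j\<bar> \<le> (if sqrt d \<le> y' i * y' j then adj \<omega> i j * (y' i * y' j) else 0) + p / q * ((y i)^2 * (y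
        j)^2)"
    proof (cases "q \<le> \<bar>y i * y j\<bar>")
      case True
      define Y where "Y = \<bar>y i * y j\<bar>"
      have "\<bar>h i j\<bar> = \<bar>adj \<omega> i j - adj_mean r i j\<bar> * Y" using True unfolding h_def Y_def by (simp add: abs_mult)
      also have "\<dots> \<le> (adj \<omega> i j + p) * Y"
      proof (rule mult_right_mono)
        have "0 \<le> adj \<omega> i j" by simp
        then show "\<bar>adj \<omega> i j - adj_mean r i j\<bar> \<le> adj \<omega> i j + p"
          using mean0[of i j] ij unfolding lessThan_iff by linarith
      qed (simp add: Y_def)
      \<comment> \<open>On heavy pairs \<open>Y >= q\<close>, so \<open>Y <= Y^2 / q\<close>. Summed
        over all pairs, the mean contributes at most \<open>p * n^2 / q = q * n\<close>.\<close>
      also have "p * Y \<le> p / q * (Y * Y)"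
      proof -
        have "p * Y * q \<le> p * Y * Y" using True p unfolding Y_def[symmetric] by (intro mult_left_mono) (auto
            simp: Y_def)
        then show ?thesis using q by (simp add: field_simps)
      qed
      then have "(adj \<omega> i j + p) * Y \<le> adj \<omega> i j * Y + p / q * (Y * Y)" by (simp add: distrib_right)
      also have "Y * Y = (y i)^2 * (y j)^2" unfolding Y_def by (simp add: abs_mult_self_eq power2_eq_square
          ac_simps)
      finally show ?thesis using True yy unfolding Y_def q_def by simp
    next
      case False
      then show ?thesis using nn yy unfolding h_def q_def by simp
    qed
  qed
  also have "\<dots> = (\<Sum>i<n. \<Sum>j<n. if sqrt d \<le> y' i * y' j then adj \<omega> i j * (y' i * y' j) else 0) + p / q * ((\<Sum>i<n.
      (y i)^2) * (\<Sum>j<n. (y j)^2))"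
    unfolding sum_product by (simp only: sum.distrib sum_distrib_left)
  also have "\<dots> \<le> ?C * sqrt d * real n + p / q * (real n * real n)"
    using ysq p q by (intro add_mono hv mult_left_mono mult_mono) (auto intro!: sum_nonneg)
  also have "p / q * (real n * real n) = q * n" unfolding pd using n q by (simp add: field_simps)
  finally have hb: "\<bar>\<Sum>i<n. \<Sum>j<n. h i j\<bar> \<le> ?C * q * n + q * n" unfolding q_def .
  have "\<bar>light_sum n d r \<omega> y\<bar> \<le> 42 * q * n"
    using light m unfolding light_event_def y_def q_def by auto
  then have "\<bar>\<Sum>i<n. \<Sum>j<n. (adj \<omega> i j - adj_mean r i j) * (y i * y j)\<bar> \<le> 42 * q * n + (?C * q * n + q * n)"
    unfolding split using hb by linarith
  also have "\<dots> = ks_const K * sqrt d * n" unfolding ks_const_def q_def by (simp add: algebra_simps)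
  finally show "\<bar>\<Sum>i<n. \<Sum>j<n. (adj \<omega> i j - adj_mean r i j) * ((real_of_int (m i) / 4) * (real_of_int (m j) / 4))\<bar>
      \<le> ks_const K * sqrt d * real n"
    unfolding y_def .
qed (use supp n in \<open>auto simp: adj_sym[of \<omega>] adj_mean_sym[of r]\<close>)

section \<open>Positive semidefinite forms and the basic inequality\<close>

definition bil :: "nat \<Rightarrow> (nat \<Rightarrow> nat \<Rightarrow> real) \<Rightarrow> (nat \<Rightarrow> real) \<Rightarrow> (nat \<Rightarrow> real) \<Rightarrow> real" where
  "bil n V x y = (\<Sum>i<n. \<Sum>j<n. V i j * (x i * y j))"

text \<open>Index functions in place of matrices make restriction to a vertex set, Schur complements
  and rank-one subtractions pointwise formulas; symmetry is demanded only below
  \<open>n\<close>.\<close>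

definition psd_form :: "nat \<Rightarrow> (nat \<Rightarrow> nat \<Rightarrow> real) \<Rightarrow> bool" where
  "psd_form n V \<longleftrightarrow> (\<forall>i<n. \<forall>j<n. V i j = V j i) \<and> (\<forall>x. 0 \<le> bil n V x x)"

abbreviation unit_at :: "nat \<Rightarrow> nat \<Rightarrow> real" where
  "unit_at i \<equiv> (\<lambda>k. if k = i then 1 else 0)"

lemma bil_add_scale_left: "bil n V (\<lambda>i. x i + t * x' i) y = bil n V x y + t * bil n V x' y"
  unfolding bil_def sum_distrib_left sum.distrib[symmetric] by (intro sum.cong refl) (simp add: algebra_simps)

lemma bil_add_scale_right: "bil n V x (\<lambda>i. y i + t * y' i) = bil n V x y + t * bil n V x y'"
  unfolding bil_def sum_distrib_left sum.distrib[symmetric] by (intro sum.cong refl) (simp add: algebra_simps)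

lemma bil_sym:
  assumes "\<And>i j. i < n \<Longrightarrow> j < n \<Longrightarrow> V i j = V j i"
  shows "bil n V x y = bil n V y x"
  unfolding bil_def by (subst sum.swap, intro sum.cong refl) (use assms in \<open>auto simp: ac_simps\<close>)

lemma bil_unit_left:
  assumes "k < n"
  shows "bil n V (unit_at k) y = (\<Sum>j<n. V k j * y j)"
proof -
  have "bil n V (unit_at k) y = (\<Sum>i<n. if i = k then (\<Sum>j<n. V k j * y j) else 0)"
    unfolding bil_def by (intro sum.cong refl) auto
  then show ?thesis using assms by simp
qed

lemma bil_unit_unit:
  assumes "k < n" "l < n"
  shows "bil n V (unit_at k) (unit_at l) = V k l"
proof -
  have "(\<Sum>j<n. V k j * unit_at l j) = (\<Sum>j<n. if j = l then V k l else 0)"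
    by (intro sum.cong) auto
  then show ?thesis using assms by (simp add: bil_unit_left[OF assms(1)])
qed

lemma bil_add_square:
  assumes "\<And>i j. i < n \<Longrightarrow> j < n \<Longrightarrow> V i j = V j i"
  shows "bil n V (\<lambda>i. x i + t * y i) (\<lambda>i. x i + t * y i) = bil n V x x + 2 * t * bil n V x y + t^2 * bil n V y
      y"
  using bil_sym[of n V y x, OF assms] by (simp add: bil_add_scale_left bil_add_scale_right algebra_simps
      power2_eq_square)

lemma psd_form_sym: "psd_form n V \<Longrightarrow> i < n \<Longrightarrow> j < n \<Longrightarrow> V i j = V j i"
  unfolding psd_form_def by auto

lemma psd_form_diag: "psd_form n V \<Longrightarrow> i < n \<Longrightarrow> 0 \<le> V i i"
  using bil_unit_unit[of i n i V] unfolding psd_form_def by metis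

lemma psd_form_two:
  assumes V: "psd_form n V" and ij: "i < n" "j < n"
  shows "0 \<le> V i i + 2 * t * V i j + t^2 * V j j"
proof -
  have "0 \<le> bil n V (\<lambda>k. unit_at i k + t * unit_at j k) (\<lambda>k. unit_at i k + t * unit_at j k)"
    using V unfolding psd_form_def by blast
  also have "\<dots> = bil n V (unit_at i) (unit_at i) + 2 * t * bil n V (unit_at i) (unit_at j) + t^2 * bil n V
      (unit_at j) (unit_at j)"
    by (rule bil_add_square[OF psd_form_sym[OF V]])
  finally show ?thesis by (simp only: bil_unit_unit ij)
qed

lemma psd_form_entry_le:
  assumes V: "psd_form n V" and ij: "i < n" "j < n"
  shows "2 * \<bar>V i j\<bar> \<le> V i i + V j j"
proof -
  show ?thesis using psd_form_two[OF V ij, of 1] psd_form_two[OF V ij, of "-1"] by simp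
qed

lemma psd_form_zero_diag:
  assumes V: "psd_form n V" and ij: "i < n" "j < n" and z: "V j j = 0"
  shows "V i j = 0"
proof (rule ccontr)
  assume nz: "V i j \<noteq> 0"
  \<comment> \<open>With \<open>V j j = 0\<close> the two-point form is affine in \<open>t\<close>;
    this \<open>t\<close> gives it the value -1.\<close>
  show False using psd_form_two[OF V ij, of "- (V i i + 1) / (2 * V i j)"] z nz by (simp add: field_simps)
qed

text \<open>Schur complements peel rank-one terms off \<open>V\<close>, one nonzero diagonal entry at a time.\<close>

lemma psd_form_pairing_nonneg:
  fixes V Q :: "nat \<Rightarrow> nat \<Rightarrow> real"
  assumes "psd_form n V" and "\<And>i. i < n \<Longrightarrow> V i i \<noteq> 0 \<Longrightarrow> i \<in> G"
    and Q: "\<And>x. (\<And>i. i < n \<Longrightarrow> x i \<noteq> 0 \<Longrightarrow> i \<in> G) \<Longrightarrow> 0 \<le> bil n Q x x"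
  shows "0 \<le> (\<Sum>i<n. \<Sum>j<n. Q i j * V i j)"
  using assms(1,2)
proof (induction "card {i. i < n \<and> V i i \<noteq> 0}" arbitrary: V rule: less_induct)
  case less
  note V = less.prems(1) and supp = less.prems(2)
  show ?case
  proof (cases "\<exists>k<n. V k k \<noteq> 0")
    case False
    then have "V i j = 0" if "i < n" "j < n" for i j using psd_form_zero_diag[OF V that] that by auto
    then show ?thesis by simp
  next
    case True
    then obtain k where k: "k < n" "V k k \<noteq> 0" by auto
    have kp: "0 < V k k" using psd_form_diag[OF V k(1)] k(2) by simp
    define V' where "V' i j = V i j - V i k * V j k / V k k" for i j
    have psd': "psd_form n V'"
      unfolding psd_form_def
    proof (intro conjI allI impI)
      fix i j assume "i < n" "j < n"
      then show "V' i j = V' j i" unfolding V'_def using psd_form_sym[OF V] by simp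
    next
      fix x
      define b where "b = (\<Sum>j<n. V k j * x j)"
      have b2: "b = (\<Sum>j<n. V j k * x j)" unfolding b_def using psd_form_sym[OF V _ k(1)] by simp
      \<comment> \<open>The minimizer of the form along \<open>x + t * unit_at k\<close>; the
        minimum is the value of the Schur complement \<open>V'\<close> at \<open>x\<close>.\<close>
      define t where "t = - b / V k k"
      have "0 \<le> bil n V (\<lambda>i. x i + t * unit_at k i) (\<lambda>i. x i + t * unit_at k i)"
        using V unfolding psd_form_def by auto
      also have "\<dots> = bil n V x x + 2 * t * bil n V x (unit_at k) + t^2 * bil n V (unit_at k) (unit_at k)"
        by (rule bil_add_square[OF psd_form_sym[OF V]])
      also have "bil n V x (unit_at k) = b"
        using bil_sym[of n V x "unit_at k", OF psd_form_sym[OF V]] bil_unit_left[OF k(1), of V x] unfolding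
            b_def by simp
      also have "bil n V (unit_at k) (unit_at k) = V k k" by (rule bil_unit_unit[OF k(1) k(1)])
      also have "bil n V x x + 2 * t * b + t^2 * V k k = bil n V x x - b * b / V k k"
        unfolding t_def using kp by (simp add: power2_eq_square field_simps)
      also have "b * b / V k k = (\<Sum>i<n. \<Sum>j<n. V i k * V j k / V k k * (x i * x j))"
        unfolding b2 sum_product sum_divide_distrib by (intro sum.cong refl) simp
      finally show "0 \<le> bil n V' x x"
        unfolding bil_def V'_def by (simp only: left_diff_distrib sum_subtractf)
    qed
    have zero': "V' i i = 0" if "i < n" "V i i = 0" for i
      using psd_form_zero_diag[OF V k(1) that(1) that(2)] psd_form_sym[OF V k(1) that(1)] that unfolding V'_def
          by simp
    have "V' k k = 0" unfolding V'_def using kp by simp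
    then have "{i. i < n \<and> V' i i \<noteq> 0} \<subset> {i. i < n \<and> V i i \<noteq> 0}" using zero' k by auto
    then have "card {i. i < n \<and> V' i i \<noteq> 0} < card {i. i < n \<and> V i i \<noteq> 0}" by (intro psubset_card_mono) auto
    then have IH: "0 \<le> (\<Sum>i<n. \<Sum>j<n. Q i j * V' i j)"
      using psd' zero' supp by (intro less.hyps) blast+
    \<comment> \<open>The removed rank-one term is the square of column \<open>k\<close>. A nonzero
      entry in row \<open>i\<close> forces \<open>V i i\<close> to be nonzero, so this column is
      supported in \<open>G\<close>, where \<open>Q\<close> is known to be nonnegative.\<close>
    have "0 \<le> bil n Q (\<lambda>i. V i k) (\<lambda>i. V i k)"
    proof (rule Q)
      fix i assume i: "i < n" "V i k \<noteq> 0"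
      then have "V i i \<noteq> 0" using psd_form_zero_diag[OF V k(1) i(1)] psd_form_sym[OF V k(1) i(1)] by auto
      then show "i \<in> G" using supp i by auto
    qed
    then have "0 \<le> bil n Q (\<lambda>i. V i k) (\<lambda>i. V i k) / V k k" using kp by simp
    also have "bil n Q (\<lambda>i. V i k) (\<lambda>i. V i k) / V k k = (\<Sum>i<n. \<Sum>j<n. Q i j * (V i k * V j k / V k k))"
      unfolding bil_def sum_divide_distrib by (intro sum.cong refl) simp
    finally have "0 \<le> (\<Sum>i<n. \<Sum>j<n. Q i j * V' i j) + (\<Sum>i<n. \<Sum>j<n. Q i j * (V i k * V j k / V k k))"
      using IH by linarith
    also have "\<dots> = (\<Sum>i<n. \<Sum>j<n. Q i j * V i j)"
      unfolding sum.distrib[symmetric] V'_def by (intro sum.cong refl) (simp add: algebra_simps)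
    finally show ?thesis .
  qed
qed

section \<open>Feasible matrices projected orthogonally to the labels\<close>

definition sdp_form :: "nat \<Rightarrow> (nat \<Rightarrow> nat \<Rightarrow> real) \<Rightarrow> bool" where
  "sdp_form n Y \<longleftrightarrow> psd_form n Y \<and> (\<forall>i<n. Y i i = 1) \<and> (\<Sum>i<n. \<Sum>j<n. Y i j) = 0"

text \<open>This is \<open>P Y P\<close> for the projection \<open>P = 1 - s s\<^sup>T / n\<close> orthogonal to the labels.\<close>

definition deflate :: "nat \<Rightarrow> (nat \<Rightarrow> real) \<Rightarrow> (nat \<Rightarrow> nat \<Rightarrow> real) \<Rightarrow> nat \<Rightarrow> nat \<Rightarrow> real" where
  "deflate n s Y i j = Y i j - s i * (\<Sum>k<n. Y j k * s k) / n - (\<Sum>k<n. Y i k * s k) * s j / n + s i * s j * bil n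
      Y s s / n^2"

context
  fixes n :: nat and s :: "nat \<Rightarrow> real" and Y :: "nat \<Rightarrow> nat \<Rightarrow> real"
  assumes n: "0 < n" and s: "\<And>i. i < n \<Longrightarrow> s i \<in> {-1, 1}" and s0: "(\<Sum>i<n. s i) = 0" and Y: "sdp_form n Y"
begin

lemma labels_square: "i < n \<Longrightarrow> s i * s i = 1"
  using s[of i] by auto

lemma sdp_psd: "psd_form n Y" and sdp_diag: "i < n \<Longrightarrow> Y i i = 1" and sdp_sum: "(\<Sum>i<n. \<Sum>j<n. Y i j) = 0"
  using Y unfolding sdp_form_def by auto

lemma sdp_entry: "i < n \<Longrightarrow> j < n \<Longrightarrow> \<bar>Y i j\<bar> \<le> 1"
  using psd_form_entry_le[OF sdp_psd, of i j] sdp_diag by simp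

lemma deflate_psd: "psd_form n (deflate n s Y)"
  unfolding psd_form_def
proof (intro conjI allI impI)
  fix i j assume "i < n" "j < n"
  then show "deflate n s Y i j = deflate n s Y j i"
    using psd_form_sym[OF sdp_psd] unfolding deflate_def by (simp add: ac_simps)
next
  fix x
  \<comment> \<open>With this \<open>c\<close>, the vector \<open>x + c s\<close> is the projection
    of \<open>x\<close> orthogonal to \<open>s\<close>, so the deflated form at \<open>x\<close> is
    the form of \<open>Y\<close> at the projection.\<close>
  define c where "c = - (\<Sum>i<n. s i * x i) / n"
  have "0 \<le> bil n Y (\<lambda>i. x i + c * s i) (\<lambda>i. x i + c * s i)" using sdp_psd unfolding psd_form_def by auto
  also have "\<dots> = bil n Y x x + 2 * c * bil n Y x s + c^2 * bil n Y s s"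
    by (rule bil_add_square[OF psd_form_sym[OF sdp_psd]])
  also have "\<dots> = bil n (deflate n s Y) x x"
  proof -
    define g where "g i = (\<Sum>k<n. Y i k * s k)" for i
    have e1: "bil n Y x s = (\<Sum>i<n. g i * x i)"
      unfolding bil_def g_def sum_distrib_right by (intro sum.cong refl) simp
    define b where "b = bil n Y s s"
    have "bil n (deflate n s Y) x x = (\<Sum>i<n. \<Sum>j<n. Y i j * (x i * x j) - (s i * x i) * (g j * x j) / n - (g i *
        x i) * (s j * x j) / n + (s i * x i) * (s j * x j) * (b / n^2))"
      unfolding bil_def[of n "deflate n s Y"] deflate_def g_def[symmetric] b_def[symmetric] by (intro sum.cong
          refl) (simp add: algebra_simps)
    also have "\<dots> = bil n Y x x - (\<Sum>i<n. s i * x i) * (\<Sum>j<n. g j * x j) / n - (\<Sum>i<n. g i * x i) * (\<Sum>j<n. s j * x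
        j) / n
        + (\<Sum>i<n. s i * x i) * (\<Sum>j<n. s j * x j) * (b / n^2)"
      unfolding sum_product unfolding bil_def[of n Y] sum_divide_distrib sum_distrib_right
      by (simp only: sum.distrib sum_subtractf)
    also have "\<dots> = bil n Y x x + 2 * c * bil n Y x s + c^2 * bil n Y s s"
      unfolding e1 b_def[symmetric] c_def by (simp add: power2_eq_square)
    finally show ?thesis by simp
  qed
  finally show "0 \<le> bil n (deflate n s Y) x x" .
qed

lemma sdp_bil_labels: "bil n Y s s = (\<Sum>i<n. s i * (\<Sum>k<n. Y i k * s k))"
  unfolding bil_def sum_distrib_left by (intro sum.cong refl) simp

lemma deflate_diag:
  "i < n \<Longrightarrow> deflate n s Y i i = 1 - 2 * (s i * (\<Sum>k<n. Y i k * s k)) / n + bil n Y s s / n^2"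
  using sdp_diag[of i] labels_square[of i] unfolding deflate_def by simp

lemma deflate_trace: "(\<Sum>i<n. deflate n s Y i i) = n - bil n Y s s / n"
proof -
  have "(\<Sum>i<n. deflate n s Y i i) = (\<Sum>i<n. 1 - 2 * (s i * (\<Sum>k<n. Y i k * s k)) / n + bil n Y s s / n^2)"
    by (intro sum.cong refl deflate_diag) auto
  also have "\<dots> = n - 2 * bil n Y s s / n + n * (bil n Y s s / n^2)"
    unfolding sdp_bil_labels by (simp add: sum.distrib sum_subtractf sum_divide_distrib sum_distrib_left)
  also have "\<dots> = n - bil n Y s s / n" using n by (simp add: power2_eq_square field_simps)
  finally show ?thesis .
qed

lemma sdp_row_le: "i < n \<Longrightarrow> \<bar>s i * (\<Sum>k<n. Y i k * s k)\<bar> \<le> n"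
proof -
  assume i: "i < n"
  have abss: "\<bar>s k\<bar> = 1" if "k < n" for k using s[OF that] by auto
  have "\<bar>s i * (\<Sum>k<n. Y i k * s k)\<bar> = \<bar>\<Sum>k<n. Y i k * s k\<bar>" using abss[OF i] by (simp add: abs_mult)
  also have "\<dots> \<le> (\<Sum>k<n. \<bar>Y i k * s k\<bar>)" by (rule sum_abs)
  also have "\<dots> \<le> (\<Sum>k<n. 1)" using sdp_entry[OF i] abss by (intro sum_mono) (auto simp: abs_mult)
  finally show ?thesis by simp
qed

lemma deflate_diag_le: "i < n \<Longrightarrow> deflate n s Y i i \<le> 4"
proof -
  assume i: "i < n"
  have "bil n Y s s \<le> (\<Sum>i<n. real n)" unfolding sdp_bil_labels
    using sdp_row_le by (intro sum_mono) (auto simp: abs_le_iff)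
  then have "bil n Y s s / n^2 \<le> 1" using n by (simp add: power2_eq_square pos_divide_le_eq)
  moreover have "- (s i * (\<Sum>k<n. Y i k * s k)) / n \<le> 1" using sdp_row_le[OF i] n by (simp add: pos_divide_le_eq
      pos_le_divide_eq abs_le_iff)
  ultimately show ?thesis using deflate_diag[OF i] by simp
qed

lemma deflate_entry_le: "i < n \<Longrightarrow> j < n \<Longrightarrow> \<bar>deflate n s Y i j\<bar> \<le> 4"
  using psd_form_entry_le[OF deflate_psd, of i j] deflate_diag_le[of i] deflate_diag_le[of j] by simp

text \<open>Since entries of \<open>Y\<close> lie between -1 and 1, the sign of
  \<open>Y i j - s i * s j\<close> is opposite to that of \<open>s i * s j\<close>. The norm is
  therefore linear in \<open>Y\<close>, equal to \<open>n^2\<close> minus the pairing with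
  \<open>s s\<^sup>T\<close>, and this is \<open>n\<close> times the trace after deflation.\<close>

lemma sdp_l1: "(\<Sum>i<n. \<Sum>j<n. \<bar>Y i j - s i * s j\<bar>) = n * (\<Sum>i<n. deflate n s Y i i)"
proof -
  have "(\<Sum>i<n. \<Sum>j<n. \<bar>Y i j - s i * s j\<bar>) = (\<Sum>i<n. \<Sum>j<n. 1 - Y i j * (s i * s j))"
  proof (intro sum.cong refl)
    fix i j assume ij: "i \<in> {..<n}" "j \<in> {..<n}"
    have "s i * s j = 1 \<or> s i * s j = -1" using s[of i] s[of j] ij by auto
    then show "\<bar>Y i j - s i * s j\<bar> = 1 - Y i j * (s i * s j)" using sdp_entry[of i j] ij by auto
  qed
  also have "\<dots> = n * n - bil n Y s s" unfolding bil_def by (simp add: sum_subtractf)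
  also have "\<dots> = n * (\<Sum>i<n. deflate n s Y i i)" unfolding deflate_trace using n by (simp add: field_simps)
  finally show ?thesis .
qed

lemma deflate_labels: "(\<Sum>i<n. \<Sum>j<n. deflate n s Y i j * (s i * s j)) = 0"
proof -
  define g where "g i = (\<Sum>k<n. Y i k * s k)" for i
  define b where "b = bil n Y s s"
  have "(\<Sum>i<n. \<Sum>j<n. deflate n s Y i j * (s i * s j)) = (\<Sum>i<n. \<Sum>j<n. Y i j * (s i * s j) - (s j * g j) / n - (s
      i * g i) / n + b / n^2)"
  proof (intro sum.cong refl)
    fix i j assume ij: "i \<in> {..<n}" "j \<in> {..<n}"
    have "deflate n s Y i j * (s i * s j) = Y i j * (s i * s j) - (s i * s i) * (s j * g j) / n - (s i * g i) *
        (s j * s j) / n + (s i * s i) * (s j * s j) * b / n^2"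
      unfolding deflate_def g_def b_def by (simp add: algebra_simps)
    then show "deflate n s Y i j * (s i * s j) = Y i j * (s i * s j) - (s j * g j) / n - (s i * g i) / n + b /
        n^2"
      using ij labels_square by simp
  qed
  also have "\<dots> = b - (\<Sum>i<n. \<Sum>j<n. s j * g j) / n - (\<Sum>i<n. \<Sum>j<n. s i * g i) / n + (\<Sum>i<n. \<Sum>j<n. b / n^2)"
    unfolding b_def bil_def by (simp only: sum.distrib sum_subtractf sum_divide_distrib)
  also have "\<dots> = 0" using n sdp_bil_labels unfolding b_def g_def
    by (simp add: sum_distrib_left[symmetric] power2_eq_square)
  finally show ?thesis .
qed

text \<open>The zero-sum constraint on \<open>Y\<close> and the balance of the labels combine here:
  the constant vector is orthogonal to \<open>s\<close>, so projecting leaves its value of the form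
  at 0.\<close>

lemma deflate_sum: "(\<Sum>i<n. \<Sum>j<n. deflate n s Y i j) = 0"
proof -
  define g where "g i = (\<Sum>k<n. Y i k * s k)" for i
  define b where "b = bil n Y s s"
  have "(\<Sum>i<n. \<Sum>j<n. deflate n s Y i j) = (\<Sum>i<n. \<Sum>j<n. Y i j) - (\<Sum>i<n. s i) * (\<Sum>j<n. g j) / n - (\<Sum>i<n. g i) *
      (\<Sum>j<n. s j) / n + (\<Sum>i<n. s i) * (\<Sum>j<n. s j) * b / n^2"
    unfolding deflate_def g_def[symmetric] b_def[symmetric] sum_product unfolding sum_divide_distrib
        sum_distrib_right
    by (simp only: sum.distrib sum_subtractf)
  then show ?thesis using sdp_sum s0 by simp
qed

text \<open>The link between optimality and degrees is the diagonal: because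
  \<open>Y i i = 1\<close>, the signed degrees pair with \<open>Y\<close> to the objective at the
  true labels. Deflation in the direction \<open>s\<close> leaves the pairing with
  \<open>D - A\<close> unchanged.\<close>

lemma sdp_degree_inequality:
  assumes a: "\<And>i j. a i j = a j i"
    and opt: "(\<Sum>i<n. \<Sum>j<n. a i j * (s i * s j)) \<le> (\<Sum>i<n. \<Sum>j<n. a i j * Y i j)"
  shows "(\<Sum>i<n. deflate n s Y i i * (\<Sum>j<n. a i j * (s i * s j))) \<le> (\<Sum>i<n. \<Sum>j<n. a i j * deflate n s Y i j)"
proof -
  define g where "g i = (\<Sum>k<n. Y i k * s k)" for i
  define b where "b = bil n Y s s"
  define h where "h i = (\<Sum>j<n. a i j * s j)" for i
  have row: "(\<Sum>j<n. a i j * (s i * s j)) = s i * h i" for i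
    unfolding h_def sum_distrib_left by (simp add: ac_simps)
  have "(\<Sum>i<n. \<Sum>j<n. a i j * deflate n s Y i j) = (\<Sum>i<n. \<Sum>j<n. a i j * Y i j - a i j * (s i * g j) / n - a i j *
      (g i * s j) / n + a i j * (s i * s j) * b / n^2)"
    unfolding deflate_def g_def[symmetric] b_def[symmetric] by (intro sum.cong refl) (simp add: algebra_simps)
  also have "\<dots> = (\<Sum>i<n. \<Sum>j<n. a i j * Y i j) - (\<Sum>i<n. \<Sum>j<n. a i j * (s i * g j)) / n - (\<Sum>i<n. \<Sum>j<n. a i j * (g i
      * s j)) / n + (\<Sum>i<n. \<Sum>j<n. a i j * (s i * s j)) * b / n^2"
    by (simp only: sum.distrib sum_subtractf sum_divide_distrib sum_distrib_right)
  also have "(\<Sum>i<n. \<Sum>j<n. a i j * (s i * g j)) = (\<Sum>i<n. \<Sum>j<n. a i j * (g i * s j))"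
    by (subst sum.swap, intro sum.cong refl) (simp add: a ac_simps)
  also have "(\<Sum>i<n. \<Sum>j<n. a i j * (g i * s j)) = (\<Sum>i<n. g i * h i)"
    unfolding h_def sum_distrib_left by (intro sum.cong refl) (simp add: ac_simps)
  also have "(\<Sum>i<n. \<Sum>j<n. a i j * (s i * s j)) = (\<Sum>i<n. s i * h i)" by (simp only: row)
  finally have R: "(\<Sum>i<n. \<Sum>j<n. a i j * deflate n s Y i j) = (\<Sum>i<n. \<Sum>j<n. a i j * Y i j) - 2 * (\<Sum>i<n. g i * h i)
      / n + (\<Sum>i<n. s i * h i) * b / n^2"
    by simp
  have "(\<Sum>i<n. deflate n s Y i i * (\<Sum>j<n. a i j * (s i * s j))) = (\<Sum>i<n. s i * h i - 2 * (g i * h i) / n + s i *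
      h i * b / n^2)"
  proof (intro sum.cong refl)
    fix i assume i: "i \<in> {..<n}"
    have D: "deflate n s Y i i = 1 - 2 * (s i * g i) / n + b / n^2"
      using deflate_diag[of i] i unfolding g_def b_def by simp
    have "deflate n s Y i i * (s i * h i) = s i * h i - 2 * ((s i * s i) * (g i * h i)) / n + s i * h i * b /
        n^2"
      unfolding D by (simp add: algebra_simps)
    then show "deflate n s Y i i * (\<Sum>j<n. a i j * (s i * s j)) = s i * h i - 2 * (g i * h i) / n + s i * h i * b
        / n^2"
      unfolding row using labels_square[of i] i by simp
  qed
  also have "\<dots> = (\<Sum>i<n. s i * h i) - 2 * (\<Sum>i<n. g i * h i) / n + (\<Sum>i<n. s i * h i) * b / n^2"
    by (simp only: sum.distrib sum_subtractf sum_divide_distrib sum_distrib_right sum_distrib_left)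
  finally have L: "(\<Sum>i<n. deflate n s Y i i * (\<Sum>j<n. a i j * (s i * s j))) = (\<Sum>i<n. s i * h i) - 2 * (\<Sum>i<n. g i
      * h i) / n + (\<Sum>i<n. s i * h i) * b / n^2" .
  have "(\<Sum>i<n. s i * h i) \<le> (\<Sum>i<n. \<Sum>j<n. a i j * Y i j)"
    using opt by (simp only: row)
  then show ?thesis unfolding R L by simp
qed

end

section \<open>Spectral noise against weighted signed degrees\<close>

definition block_prob :: "(nat \<Rightarrow> real) \<Rightarrow> real \<Rightarrow> real \<Rightarrow> nat \<times> nat \<Rightarrow> real" where
  "block_prob s p q k = (if s (fst k) * s (snd k) = 1 then p else q)"

definition deg :: "nat \<Rightarrow> (nat \<times> nat \<Rightarrow> bool) \<Rightarrow> nat \<Rightarrow> real" where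
  "deg n \<omega> i = (\<Sum>j<n. adj \<omega> i j)"

definition signed_deg :: "nat \<Rightarrow> (nat \<Rightarrow> real) \<Rightarrow> (nat \<times> nat \<Rightarrow> bool) \<Rightarrow> nat \<Rightarrow> real" where
  "signed_deg n s \<omega> i = (\<Sum>j<n. adj \<omega> i j * (s i * s j))"

lemma psd_form_restrict:
  assumes V: "psd_form n V"
  shows "psd_form n (\<lambda>i j. if i \<in> G \<and> j \<in> G then V i j else 0)"
  unfolding psd_form_def
proof (intro conjI allI impI)
  fix x :: "nat \<Rightarrow> real"
  have "bil n (\<lambda>i j. if i \<in> G \<and> j \<in> G then V i j else 0) x x
    = bil n V (\<lambda>i. if i \<in> G then x i else 0) (\<lambda>i. if i \<in> G then x i else 0)"
    unfolding bil_def by (intro sum.cong refl) auto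
  then show "0 \<le> bil n (\<lambda>i j. if i \<in> G \<and> j \<in> G then V i j else 0) x x"
    using V unfolding psd_form_def by simp
qed (use psd_form_sym[OF V] in auto)

text \<open>The mean of the adjacency matrix pairs nonpositively with \<open>P Y P\<close>, because both the labels and
the constant vector are in its kernel; what remains is noise.\<close>

lemma sdp_spectral_inequality:
  fixes s :: "nat \<Rightarrow> real" and K d p q \<tau> :: real
  assumes n: "0 < n" and s: "\<And>i. i < n \<Longrightarrow> s i \<in> {-1, 1}" and s0: "(\<Sum>i<n. s i) = 0" and Y: "sdp_form n Y"
    and pq: "0 \<le> q" "q \<le> p" and d: "d = n * p" and K: "1 \<le> K" and tau: "0 \<le> \<tau>"
    and opt: "(\<Sum>i<n. \<Sum>j<n. adj \<omega> i j * (s i * s j)) \<le> (\<Sum>i<n. \<Sum>j<n. adj \<omega> i j * Y i j)"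
    and spec: "\<And>z. (\<And>i. i < n \<Longrightarrow> z i \<noteq> 0 \<Longrightarrow> deg n \<omega> i \<le> K * d) \<Longrightarrow>
       \<bar>\<Sum>i<n. \<Sum>j<n. (adj \<omega> i j - adj_mean (block_prob s p q) i j) * (z i * z j)\<bar> \<le> \<tau> * (\<Sum>i<n. (z i)^2)"
  shows "(\<Sum>i<n. deflate n s Y i i * signed_deg n s \<omega> i) \<le> \<tau> * (\<Sum>i<n. deflate n s Y i i)
      + 16 * (\<Sum>i<n. if K * d < deg n \<omega> i then deg n \<omega> i else 0)"
proof -
  note ctx = n s s0 Y
  define V where "V = deflate n s Y"
  have Vpsd: "psd_form n V" unfolding V_def by (rule deflate_psd[OF ctx])
  define E where "E = adj_mean (block_prob s p q)"
  let ?a = "adj \<omega>"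
  define G where "G = {i. deg n \<omega> i \<le> K * d}"
  have V0: "0 \<le> V i i" if "i < n" for i using psd_form_diag[OF Vpsd that] .
  have E0: "0 \<le> E i j" "E i j \<le> p" for i j unfolding E_def adj_mean_def block_prob_def using pq by auto
  have Esym: "E i j = E j i" for i j unfolding E_def by (rule adj_mean_sym)
  have EV: "(\<Sum>i<n. \<Sum>j<n. E i j * V i j) \<le> 0"
  proof -
    \<comment> \<open>Off the diagonal the mean is \<open>(p - q)/2\<close> times the label product
      plus \<open>(p + q)/2\<close>. Extending this formula to the diagonal, where it equals
      \<open>p\<close>, is corrected by the last term, which has the favourable sign.\<close>
    have "(\<Sum>i<n. \<Sum>j<n. E i j * V i j) = (\<Sum>i<n. \<Sum>j<n. (p - q)/2 * (V i j * (s i * s j)) + (p + q)/2 * V i j - (if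
        j = i then p * V i i else 0))"
    proof (intro sum.cong refl)
      fix i j assume ij: "i \<in> {..<n}" "j \<in> {..<n}"
      show "E i j * V i j = (p - q)/2 * (V i j * (s i * s j)) + (p + q)/2 * V i j - (if j = i then p * V i i
          else 0)"
        using s[of i] s[of j] ij unfolding E_def adj_mean_def block_prob_def
        by (auto simp: min_def max_def field_simps split: if_splits)
    qed
    also have "\<dots> = (p - q)/2 * (\<Sum>i<n. \<Sum>j<n. V i j * (s i * s j)) + (p + q)/2 * (\<Sum>i<n. \<Sum>j<n. V i j) - (\<Sum>i<n. p *
        V i i)"
      by (simp add: sum.distrib sum_subtractf sum_distrib_left)
    also have "\<dots> = - (\<Sum>i<n. p * V i i)"
      using deflate_labels[OF ctx] deflate_sum[OF ctx] unfolding V_def by simp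
    also have "\<dots> \<le> 0"
    proof -
      have "0 \<le> (\<Sum>i<n. p * V i i)" using V0 pq by (intro sum_nonneg mult_nonneg_nonneg) auto
      then show ?thesis by simp
    qed
    finally show ?thesis .
  qed
  have "(\<Sum>i<n. V i i * signed_deg n s \<omega> i) \<le> (\<Sum>i<n. \<Sum>j<n. ?a i j * V i j)"
    unfolding V_def signed_deg_def by (rule sdp_degree_inequality[OF ctx adj_sym opt])
  also have "\<dots> \<le> (\<Sum>i<n. \<Sum>j<n. ?a i j * V i j) - (\<Sum>i<n. \<Sum>j<n. E i j * V i j)" using EV by simp
  also have "\<dots> = (\<Sum>i<n. \<Sum>j<n. (?a i j - E i j) * V i j)"
    by (simp only: sum_subtractf[symmetric] left_diff_distrib)
  also have "\<dots> = (\<Sum>i<n. \<Sum>j<n. (?a i j - E i j) * (if i \<in> G \<and> j \<in> G then V i j else 0))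
      + (\<Sum>i<n. \<Sum>j<n. if i \<in> G \<and> j \<in> G then 0 else (?a i j - E i j) * V i j)"
    unfolding sum.distrib[symmetric] by (intro sum.cong refl) auto
  also have "\<dots> \<le> \<tau> * (\<Sum>i<n. V i i) + 16 * (\<Sum>i<n. if K * d < deg n \<omega> i then deg n \<omega> i else 0)"
  proof (rule add_mono)
    define W where "W i j = (if i \<in> G \<and> j \<in> G then V i j else 0)" for i j
    have Wpsd: "psd_form n W" unfolding W_def by (rule psd_form_restrict[OF Vpsd])
    \<comment> \<open>\<open>Q\<close> is \<open>\<tau>\<close> times the identity minus the noise:
      nonnegative on vectors supported in \<open>G\<close>, though perhaps not on all vectors.
      Pairing it with the restriction of \<open>V\<close> to \<open>G\<close> needs only
      that.\<close>
    define Q where "Q i j = (if j = i then \<tau> else 0) - (?a i j - E i j)" for i j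
    have "0 \<le> (\<Sum>i<n. \<Sum>j<n. Q i j * W i j)"
    proof (rule psd_form_pairing_nonneg[OF Wpsd, where G = G])
      show "i \<in> G" if "i < n" "W i i \<noteq> 0" for i using that unfolding W_def by (auto split: if_splits)
      fix x :: "nat \<Rightarrow> real" assume x: "\<And>i. i < n \<Longrightarrow> x i \<noteq> 0 \<Longrightarrow> i \<in> G"
      have "bil n Q x x = (\<Sum>i<n. \<Sum>j<n. (if j = i then \<tau> * (x i)^2 else 0) - (?a i j - E i j) * (x i * x j))"
        unfolding bil_def Q_def by (intro sum.cong refl) (auto simp: left_diff_distrib power2_eq_square)
      also have "\<dots> = \<tau> * (\<Sum>i<n. (x i)^2) - (\<Sum>i<n. \<Sum>j<n. (?a i j - E i j) * (x i * x j))"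
        by (simp add: sum_subtractf sum_distrib_left)
      finally show "0 \<le> bil n Q x x" using spec[of x] x unfolding G_def E_def by (auto simp: abs_le_iff)
    qed
    also have "\<dots> = (\<Sum>i<n. \<Sum>j<n. (if j = i then \<tau> * W i i else 0) - (?a i j - E i j) * W i j)"
      unfolding Q_def by (intro sum.cong refl) (auto simp: left_diff_distrib)
    also have "\<dots> = \<tau> * (\<Sum>i<n. W i i) - (\<Sum>i<n. \<Sum>j<n. (?a i j - E i j) * W i j)"
      by (simp add: sum_subtractf sum_distrib_left)
    finally have "(\<Sum>i<n. \<Sum>j<n. (?a i j - E i j) * W i j) \<le> \<tau> * (\<Sum>i<n. W i i)" by simp
    also have "\<dots> \<le> \<tau> * (\<Sum>i<n. V i i)"
      using tau V0 unfolding W_def by (intro mult_left_mono sum_mono) auto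
    finally show "(\<Sum>i<n. \<Sum>j<n. (?a i j - E i j) * (if i \<in> G \<and> j \<in> G then V i j else 0)) \<le> \<tau> * (\<Sum>i<n. V i i)"
      unfolding W_def .
  next
    \<comment> \<open>Outside the block of low-degree vertices absolute values suffice. The factor
      16 is 4 for the entries of \<open>V\<close>, 2 for rows and columns, and 2 because the mean
      row sum is at most \<open>n p\<close>, hence at most the degree of a vertex with
      \<open>K d < deg n \<omega> i\<close>.\<close>
    have pt: "(if i \<in> G \<and> j \<in> G then 0 else (?a i j - E i j) * V i j)
      \<le> (if i \<in> G then 0 else 4 * (?a i j + E i j)) + (if j \<in> G then 0 else 4 * (?a i j + E i j))" if "i < n" "j
          < n" for i j
    proof -
      have a0: "0 \<le> ?a i j" by simp
      have "\<bar>(?a i j - E i j) * V i j\<bar> \<le> (?a i j + E i j) * 4"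
        unfolding abs_mult using deflate_entry_le[OF ctx that] E0[of i j] a0 unfolding V_def
        by (intro mult_mono) (auto simp: abs_le_iff)
      then show ?thesis using a0 E0[of i j] by (auto simp: abs_le_iff)
    qed
    have "(\<Sum>i<n. \<Sum>j<n. if i \<in> G \<and> j \<in> G then 0 else (?a i j - E i j) * V i j)
      \<le> (\<Sum>i<n. \<Sum>j<n. (if i \<in> G then 0 else 4 * (?a i j + E i j)) + (if j \<in> G then 0 else 4 * (?a i j + E i j)))"
      by (intro sum_mono pt) auto
    also have "\<dots> = (\<Sum>i<n. \<Sum>j<n. if i \<in> G then 0 else 4 * (?a i j + E i j)) + (\<Sum>i<n. \<Sum>j<n. if j \<in> G then 0 else 4
        * (?a i j + E i j))"
      by (simp only: sum.distrib)
    also have "(\<Sum>i<n. \<Sum>j<n. if j \<in> G then 0 else 4 * (?a i j + E i j)) = (\<Sum>i<n. \<Sum>j<n. if i \<in> G then 0 else 4 *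
        (?a i j + E i j))"
      by (subst sum.swap, intro sum.cong refl) (simp add: adj_sym[of \<omega>] Esym)
    also have "(\<Sum>i<n. \<Sum>j<n. if i \<in> G then 0 else 4 * (?a i j + E i j)) \<le> (\<Sum>i<n. 8 * (if K * d < deg n \<omega> i then
        deg n \<omega> i else 0))"
    proof (rule sum_mono)
      fix i
      show "(\<Sum>j<n. if i \<in> G then 0 else 4 * (?a i j + E i j)) \<le> 8 * (if K * d < deg n \<omega> i then deg n \<omega> i else
          0)"
      proof (cases "i \<in> G")
        case False
        then have big: "K * d < deg n \<omega> i" unfolding G_def by simp
        have "1 * d \<le> K * d" using K d pq n by (intro mult_right_mono) auto
        then have dd: "n * p \<le> deg n \<omega> i" using big d by simp
        have "(\<Sum>j<n. E i j) \<le> (\<Sum>j<n. p)" using E0 by (intro sum_mono) auto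
        then have "(\<Sum>j<n. E i j) \<le> deg n \<omega> i" using dd by simp
        then show ?thesis using False big unfolding deg_def by (simp add: sum.distrib
            sum_distrib_left[symmetric])
      qed (simp add: G_def)
    qed
    finally show "(\<Sum>i<n. \<Sum>j<n. if i \<in> G \<and> j \<in> G then 0 else (?a i j - E i j) * V i j)
      \<le> 16 * (\<Sum>i<n. if K * d < deg n \<omega> i then deg n \<omega> i else 0)"
      by (simp add: sum_distrib_left[symmetric])
  qed
  finally show ?thesis unfolding V_def .
qed

text \<open>Vertices with \<open>x i >= 2 \<tau>\<close> satisfy
  \<open>w i * \<tau> <= w i * (x i - \<tau>)\<close> and are paid for by the inequality. The others
  are charged to \<open>exp (l * (2 \<tau> - x i))\<close>, a smooth substitute for counting them.
  If \<open>Z < 1\<close>, every exponential is below 1, so each vertex lies above the threshold and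
  no \<open>D i\<close> exceeds \<open>c\<close>; the inequality then forces all weights to
  vanish.\<close>

lemma weighted_threshold_bound:
  fixes w x D :: "nat \<Rightarrow> real" and l \<tau> c :: real
  assumes w: "\<And>i. i < n \<Longrightarrow> 0 \<le> w i \<and> w i \<le> 4" and lam: "0 < l" "1 \<le> l * \<tau>" and tau: "1 \<le> \<tau>" and c: "0 \<le> c"
    and ineq: "(\<Sum>i<n. w i * x i) \<le> \<tau> * (\<Sum>i<n. w i) + 16 * (\<Sum>i<n. if c < D i then D i else 0)"
  defines "Z \<equiv> exp (2 * l * \<tau>) * (\<Sum>i<n. exp (- l * x i)) + (\<Sum>i<n. exp (2 * D i - c))"
  shows "(\<Sum>i<n. w i) \<le> 16 * Z" and "Z < 1 \<Longrightarrow> (\<Sum>i<n. w i) = 0"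
proof -
  define R where "R = 16 * (\<Sum>i<n. if c < D i then D i else 0)"
  define h where "h i = exp (l * (2 * \<tau> - x i))" for i
  have Zeq: "Z = (\<Sum>i<n. h i) + (\<Sum>i<n. exp (2 * D i - c))"
    unfolding Z_def h_def sum_distrib_left by (simp add: exp_add[symmetric] algebra_simps)
  have Rle: "R \<le> 16 * (\<Sum>i<n. exp (2 * D i - c))"
    unfolding R_def
  proof (intro mult_left_mono sum_mono)
    fix i
    show "(if c < D i then D i else 0) \<le> exp (2 * D i - c)"
    proof (cases "c < D i")
      case True
      have "D i \<le> exp (D i)" using exp_ge_add_one_self[of "D i"] by linarith
      also have "\<dots> \<le> exp (2 * D i - c)" using True by simp
      finally show ?thesis using True by simp
    qed simp
  qed simp
  have h0: "0 < h i" for i unfolding h_def by simp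
  have pt: "w i \<le> w i * (x i - \<tau>) / \<tau> + 8 * h i" if i: "i < n" for i
  proof (cases "2 * \<tau> \<le> x i")
    case True
    have "w i * \<tau> \<le> w i * (x i - \<tau>)" using True w[OF i] by (intro mult_left_mono) auto
    then have "w i \<le> w i * (x i - \<tau>) / \<tau>" using tau by (simp add: pos_le_divide_eq)
    then show ?thesis using h0[of i] by simp
  next
    case False
    have u: "1 + l * (2 * \<tau> - x i) \<le> h i" unfolding h_def by (rule exp_ge_add_one_self)
    \<comment> \<open>The hypothesis \<open>1 <= l * \<tau>\<close> converts a deficit measured in
      units of \<open>\<tau>\<close> into an exponent measured by \<open>l\<close>, so the linear
      term of the exponential suffices.\<close>
    have "(2 * \<tau> - x i) / \<tau> \<le> l * (2 * \<tau> - x i)"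
    proof -
      have "(2 * \<tau> - x i) * 1 \<le> (2 * \<tau> - x i) * (l * \<tau>)" using lam False by (intro mult_left_mono) auto
      then show ?thesis using tau by (simp add: pos_divide_le_eq ac_simps)
    qed
    then have "(2 * \<tau> - x i) / \<tau> \<le> h i" using u by linarith
    then have B: "w i * ((2 * \<tau> - x i) / \<tau>) \<le> 4 * h i" using w[OF i] h0[of i] False tau by (intro mult_mono)
        auto
    have "w i * (x i - \<tau>) / \<tau> = w i - w i * ((2 * \<tau> - x i) / \<tau>)" using tau by (simp add: field_simps)
    then show ?thesis using h0[of i] B by (simp only:)
  qed
  have key: "(\<Sum>i<n. w i * (x i - \<tau>)) \<le> R"
    using ineq unfolding R_def by (simp add: right_diff_distrib sum_subtractf sum_distrib_left mult.commute)
  have R0: "0 \<le> R" unfolding R_def using c by (intro mult_nonneg_nonneg sum_nonneg) auto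
  have "(\<Sum>i<n. w i) \<le> (\<Sum>i<n. w i * (x i - \<tau>) / \<tau> + 8 * h i)" by (intro sum_mono pt) auto
  also have "\<dots> = (\<Sum>i<n. w i * (x i - \<tau>)) / \<tau> + 8 * (\<Sum>i<n. h i)"
    by (simp add: sum.distrib sum_divide_distrib sum_distrib_left)
  also have "\<dots> \<le> R + 8 * (\<Sum>i<n. h i)"
  proof -
    have "(\<Sum>i<n. w i * (x i - \<tau>)) / \<tau> \<le> R / \<tau>" using key tau by (intro divide_right_mono) auto
    also have "\<dots> \<le> R / 1" using R0 tau by (intro divide_left_mono) auto
    finally show ?thesis by simp
  qed
  also have "\<dots> \<le> 16 * Z"
  proof -
    have "0 \<le> (\<Sum>i<n. h i)" using h0 by (intro sum_nonneg) (simp add: less_imp_le)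
    then show ?thesis using Rle unfolding Zeq by simp
  qed
  finally show "(\<Sum>i<n. w i) \<le> 16 * Z" .
  assume Z1: "Z < 1"
  have sh: "(\<Sum>i<n. h i) < 1" "(\<Sum>i<n. exp (2 * D i - c)) < 1"
    using Z1 h0 sum_nonneg[of "{..<n}" h] sum_nonneg[of "{..<n}" "\<lambda>i. exp (2 * D i - c)"] unfolding Zeq
    by (auto simp: less_imp_le)
  have xb: "2 * \<tau> < x i" if "i < n" for i
  proof -
    have "h i \<le> (\<Sum>i<n. h i)" using that h0 by (intro member_le_sum) (auto simp: less_imp_le)
    then have "h i < 1" using sh by linarith
    then have "l * (2 * \<tau> - x i) < 0" unfolding h_def by simp
    then show ?thesis using lam by (simp add: mult_less_0_iff)
  qed
  have Db: "\<not> c < D i" if "i < n" for i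
  proof -
    have "exp (2 * D i - c) \<le> (\<Sum>i<n. exp (2 * D i - c))" using that by (intro member_le_sum) auto
    then have "exp (2 * D i - c) < 1" using sh by linarith
    then show ?thesis using c by simp
  qed
  have "R = 0" unfolding R_def using Db by (auto intro!: sum.neutral)
  then have "(\<Sum>i<n. w i * \<tau>) \<le> (\<Sum>i<n. w i * (x i - \<tau>))" 
    using w xb by (intro sum_mono mult_left_mono) (force simp: less_imp_le)+
  then have "(\<Sum>i<n. w i) * \<tau> \<le> 0" using key \<open>R = 0\<close> by (simp add: sum_distrib_right)
  then have "(\<Sum>i<n. w i) \<le> 0" using tau by (simp add: mult_le_0_iff)
  moreover have "0 \<le> (\<Sum>i<n. w i)" using w by (intro sum_nonneg) auto
  ultimately show "(\<Sum>i<n. w i) = 0" by simp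
qed

section \<open>Top eigenvectors\<close>

lemma continuous_on_bil:
  "continuous_on S (\<lambda>x. bil n V x x)"
  unfolding bil_def by (intro continuous_intros continuous_on_product_coordinates continuous_on_subset[OF _
      subset_UNIV])

text \<open>Coordinates from \<open>n\<close> on are pinned to 0, so the set lies in a product of
  compact intervals and Tychonoff's theorem applies to the space of functions.\<close>

lemma compact_unit_sphere_fun:
  "compact {x :: nat \<Rightarrow> real. (\<forall>i. i \<notin> {..<n} \<longrightarrow> x i = 0) \<and> (\<Sum>i<n. (x i)^2) = 1}"
proof -
  let ?B = "PiE UNIV (\<lambda>i. if i < n then {-1..1} else {0::real})"
  have "compactin (product_topology (\<lambda>_. euclidean) UNIV) ?B"
    unfolding compactin_PiE by auto
  then have comp: "compact ?B" by (simp add: euclidean_product_topology)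
  have closed: "closed {x :: nat \<Rightarrow> real. (\<Sum>i<n. (x i)^2) = 1}"
    by (intro closed_Collect_eq continuous_intros continuous_on_product_coordinates)
  have "{x :: nat \<Rightarrow> real. (\<forall>i. i \<notin> {..<n} \<longrightarrow> x i = 0) \<and> (\<Sum>i<n. (x i)^2) = 1} = ?B \<inter> {x. (\<Sum>i<n. (x i)^2) = 1}"
  proof (intro equalityI subsetI)
    fix x :: "nat \<Rightarrow> real"
    assume x: "x \<in> {x. (\<forall>i. i \<notin> {..<n} \<longrightarrow> x i = 0) \<and> (\<Sum>i<n. (x i)^2) = 1}"
    have "x i \<in> {-1..1}" if "i < n" for i
    proof -
      have "(x i)^2 \<le> (\<Sum>i<n. (x i)^2)" using that by (intro member_le_sum) auto
      then have "\<bar>x i\<bar> \<le> 1" using x by (simp add: abs_square_le_1)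
      then show ?thesis by auto
    qed
    then show "x \<in> ?B \<inter> {x. (\<Sum>i<n. (x i)^2) = 1}" using x by auto
  qed (auto simp: PiE_def Pi_def split: if_splits)
  then show ?thesis using compact_Int_closed[OF comp closed] by simp
qed

lemma psd_form_kernel:
  assumes V: "psd_form n V" and z: "bil n V x x = 0"
  shows "bil n V x y = 0"
proof (rule ccontr)
  assume nz: "bil n V x y \<noteq> 0"
  define b where "b = bil n V x y"
  define c where "c = bil n V y y"
  have c0: "0 \<le> c" unfolding c_def using V unfolding psd_form_def by auto
  have q: "0 \<le> 2 * t * b + t^2 * c" for t
  proof -
    have "0 \<le> bil n V (\<lambda>i. x i + t * y i) (\<lambda>i. x i + t * y i)" using V unfolding psd_form_def by blast
    also have "\<dots> = bil n V x x + 2 * t * b + t^2 * c"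
      unfolding b_def c_def by (rule bil_add_square[OF psd_form_sym[OF V]])
    finally show ?thesis using z by simp
  qed
  \<comment> \<open>The denominator \<open>c + 1\<close> replaces the \<open>c\<close> of the exact
    minimizer \<open>- b / c\<close>, so that \<open>c = 0\<close> is covered as well.\<close>
  define e where "e = c + 1"
  have e: "0 < e" "c < e" unfolding e_def using c0 by auto
  have "0 \<le> 2 * (- b / e) * b + (- b / e)^2 * c" by (rule q)
  also have "\<dots> = - (b^2 * (2 * e - c)) / e^2"
    using e(1) by (simp add: field_simps power2_eq_square)
  also have "\<dots> < 0"
  proof -
    have "0 < b^2 * (2 * e - c)" using nz e unfolding b_def by auto
    then show ?thesis using e by (simp add: divide_less_0_iff)
  qed
  finally show False by simp
qed

text \<open>\<open>top_eigenvector\<close> only compares eigenvalues with one another. The maximizer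
  of the Rayleigh quotient supplies an eigenvalue that dominates the form: \<open>m\<close> times
  the identity minus \<open>Y\<close> is positive semidefinite and vanishes at the maximizer, which
  therefore lies in its kernel.\<close>

lemma rayleigh_max_exists:
  assumes sym: "\<And>i j. i < n \<Longrightarrow> j < n \<Longrightarrow> Y i j = Y j i" and n: "0 < n"
  obtains x m where "(\<Sum>i<n. (x i)^2) = 1" "\<And>i. i < n \<Longrightarrow> (\<Sum>j<n. Y i j * x j) = m * x i"
    "\<And>y. bil n Y y y \<le> m * (\<Sum>i<n. (y i)^2)"
proof -
  define K where "K = {x :: nat \<Rightarrow> real. (\<forall>i. i \<notin> {..<n} \<longrightarrow> x i = 0) \<and> (\<Sum>i<n. (x i)^2) = 1}"
  have "unit_at 0 \<in> K"
  proof -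
    have "(\<Sum>i<n. (unit_at 0 i)^2) = (\<Sum>i<n. unit_at 0 i)" by (intro sum.cong) auto
    then show ?thesis using n by (auto simp: K_def)
  qed
  then have ne: "K \<noteq> {}" by blast
  obtain x where x: "x \<in> K" and max: "\<And>y. y \<in> K \<Longrightarrow> bil n Y y y \<le> bil n Y x x"
    using continuous_attains_sup[OF compact_unit_sphere_fun[of n, folded K_def] ne continuous_on_bil] by blast
  define m where "m = bil n Y x x"
  have ray: "bil n Y y y \<le> m * (\<Sum>i<n. (y i)^2)" for y
  proof (cases "(\<Sum>i<n. (y i)^2) = 0")
    case True
    have "(y i)^2 \<le> (\<Sum>i<n. (y i)^2)" if "i < n" for i using that by (intro member_le_sum) auto
    then have "y i = 0" if "i < n" for i using that True by fastforce
    then have "bil n Y y y = 0" unfolding bil_def by simp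
    then show ?thesis using True by simp
  next
    case False
    define N where "N = (\<Sum>i<n. (y i)^2)"
    have N: "0 < N" using False sum_nonneg[of "{..<n}" "\<lambda>i. (y i)^2"] unfolding N_def by simp
    define z where "z i = (if i < n then y i / sqrt N else 0)" for i
    have "(\<Sum>i<n. (z i)^2) = (\<Sum>i<n. (y i)^2) / N"
      unfolding sum_divide_distrib using N by (intro sum.cong) (auto simp: z_def power_divide)
    then have "z \<in> K" using N unfolding N_def[symmetric] K_def by (auto simp: z_def)
    from max[OF this] have "bil n Y z z \<le> m" unfolding m_def .
    also have "bil n Y z z = bil n Y y y / N"
      unfolding bil_def sum_divide_distrib using N by (intro sum.cong refl) (auto simp: z_def)
    finally show ?thesis using N unfolding N_def[symmetric] by (simp add: pos_divide_le_eq)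
  qed
  define P where "P i j = (if j = i then m else 0) - Y i j" for i j
  have Pbil: "bil n P y z = m * (\<Sum>i<n. y i * z i) - bil n Y y z" for y z
  proof -
    have "bil n P y z = (\<Sum>i<n. \<Sum>j<n. (if j = i then m * (y i * z i) else 0) - Y i j * (y i * z j))"
      unfolding bil_def P_def by (intro sum.cong refl) (auto simp: left_diff_distrib)
    then show ?thesis unfolding bil_def by (simp add: sum_subtractf sum_distrib_left)
  qed
  have Ppsd: "psd_form n P"
    unfolding psd_form_def using ray sym by (auto simp: Pbil P_def power2_eq_square)
  have "bil n P x x = 0" using x unfolding Pbil m_def K_def by (simp add: power2_eq_square)
  then have ker: "bil n P x y = 0" for y by (rule psd_form_kernel[OF Ppsd])
  show ?thesis
  proof (rule that[of x m])
    show "(\<Sum>i<n. (x i)^2) = 1" using x by (simp add: K_def)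
    fix i assume i: "i < n"
    have "0 = bil n P (unit_at i) x" using ker[of "unit_at i"] bil_sym[of n P x "unit_at i", OF psd_form_sym[OF
        Ppsd]] by simp
    also have "\<dots> = m * (\<Sum>j<n. unit_at i j * x j) - bil n Y (unit_at i) x" by (rule Pbil)
    also have "(\<Sum>j<n. unit_at i j * x j) = (\<Sum>j<n. if j = i then x i else 0)" by (intro sum.cong) auto
    also have "\<dots> = x i" using i by simp
    also have "bil n Y (unit_at i) x = (\<Sum>j<n. Y i j * x j)" by (rule bil_unit_left[OF i])
    finally show "(\<Sum>j<n. Y i j * x j) = m * x i" by simp
  qed (rule ray)
qed

text \<open>By Cauchy-Schwarz, the squared norm of \<open>y\<close> times the identity minus
  \<open>y y\<^sup>T\<close> is positive semidefinite; pairing it with \<open>V\<close> gives the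
  claim.\<close>

lemma psd_form_le_trace:
  assumes V: "psd_form n V"
  shows "bil n V y y \<le> (\<Sum>i<n. V i i) * (\<Sum>i<n. (y i)^2)"
proof -
  define N where "N = (\<Sum>i<n. (y i)^2)"
  define Q where "Q i j = (if j = i then N else 0) - y i * y j" for i j
  have "0 \<le> (\<Sum>i<n. \<Sum>j<n. Q i j * V i j)"
  proof (rule psd_form_pairing_nonneg[OF V, where G = UNIV])
    fix x :: "nat \<Rightarrow> real"
    have "bil n Q x x = (\<Sum>i<n. \<Sum>j<n. (if j = i then N * (x i)^2 else 0) - (x i * y i) * (x j * y j))"
      unfolding bil_def Q_def by (intro sum.cong refl) (auto simp: left_diff_distrib power2_eq_square)
    also have "\<dots> = N * (\<Sum>i<n. (x i)^2) - (\<Sum>i<n. x i * y i) * (\<Sum>j<n. x j * y j)"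
      unfolding sum_product by (simp add: sum_subtractf sum_distrib_left)
    also have "\<dots> \<ge> 0"
      using Cauchy_Schwarz_ineq_sum[of x y "{..<n}"] unfolding N_def by (simp add: power2_eq_square
          mult.commute)
    finally show "0 \<le> bil n Q x x" .
  qed auto
  also have "\<dots> = (\<Sum>i<n. \<Sum>j<n. (if j = i then N * V i i else 0) - V i j * (y i * y j))"
    unfolding Q_def by (intro sum.cong refl) (auto simp: left_diff_distrib)
  also have "\<dots> = N * (\<Sum>i<n. V i i) - bil n V y y"
    unfolding bil_def by (simp add: sum_subtractf sum_distrib_left)
  finally show ?thesis unfolding N_def by (simp add: mult.commute)
qed

text \<open>Scale the eigenvector to squared norm \<open>n\<close>, like \<open>s\<close>, and call
  it \<open>u\<close>. Testing with \<open>s\<close> gives \<open>l >= n - N\<close>, so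
  \<open>Y - (l/n) u u\<^sup>T\<close>, which is positive semidefinite, has trace
  \<open>n - l <= N\<close>. Evaluated at \<open>s\<close> it forces \<open>u\<close> to align with
  \<open>s\<close> up to sign, with squared distance at most \<open>4 N\<close>, and each wrong sign
  costs at least 1 in that distance.\<close>

lemma top_eigenvector_mismatch:
  fixes s v :: "nat \<Rightarrow> real"
  assumes n: "0 < n" and s: "\<And>i. i < n \<Longrightarrow> s i \<in> {-1, 1}" and s0: "(\<Sum>i<n. s i) = 0" and Y: "sdp_form n Y"
    and eig: "\<And>i. i < n \<Longrightarrow> (\<Sum>j<n. Y i j * v j) = l * v i" and v: "\<exists>i<n. v i \<noteq> 0"
    and ray: "bil n Y s s \<le> l * (\<Sum>i<n. (s i)^2)"
  shows "\<exists>g\<in>{-1, 1}. real (card {i. i < n \<and> g * (if 0 \<le> v i then 1 else -1) \<noteq> s i}) \<le> 4 * (\<Sum>i<n. deflate n s Y i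
      i)"
proof -
  note ctx = n s s0 Y
  define N where "N = (\<Sum>i<n. deflate n s Y i i)"
  have "N = n - bil n Y s s / n" unfolding N_def by (rule deflate_trace[OF ctx])
  then have Neq: "bil n Y s s = n * (n - N)" using n by (simp add: field_simps)
  have ss: "(\<Sum>i<n. (s i)^2) = n" using labels_square[OF ctx] by (simp add: power2_eq_square)
  show ?thesis
  \<comment> \<open>If \<open>N\<close> exceeds \<open>n / 2\<close>, the claimed bound is larger
    than \<open>n\<close>. Otherwise \<open>l >= n / 2\<close> is available below.\<close>
  proof (cases "n < 2 * N")
    case True
    have "card {i. i < n \<and> 1 * (if 0 \<le> v i then 1 else -1) \<noteq> s i} \<le> card {..<n}" by (intro card_mono) auto
    then have "real (card {i. i < n \<and> 1 * (if 0 \<le> v i then 1 else -1) \<noteq> s i}) \<le> 4 * N" using True by simp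
    then show ?thesis unfolding N_def by blast
  next
    case False
    have psd: "psd_form n Y" by (rule sdp_psd[OF ctx])
    define \<nu> where "\<nu> = (\<Sum>i<n. (v i)^2)"
    have nu: "0 < \<nu>" using v unfolding \<nu>_def by (auto intro!: sum_pos2)
    define a where "a = sqrt (n / \<nu>)"
    have a: "0 < a" "a * a = n / \<nu>" unfolding a_def using n nu by auto
    define u where "u i = a * v i" for i
    have uu: "(\<Sum>i<n. u i * u i) = n"
    proof -
      have "(\<Sum>i<n. u i * u i) = a * a * \<nu>" unfolding u_def \<nu>_def sum_distrib_left by (intro sum.cong) (auto
          simp: power2_eq_square)
      then show ?thesis using a nu by simp
    qed
    have ueig: "(\<Sum>j<n. Y i j * u j) = l * u i" if "i < n" for i
      unfolding u_def using eig[OF that] by (simp add: sum_distrib_left[symmetric] mult.left_commute[of _ a])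
    have bu: "bil n Y u y = l * (\<Sum>i<n. u i * y i)" for y
    proof -
      have "bil n Y u y = bil n Y y u" by (rule bil_sym[OF psd_form_sym[OF psd]])
      also have "\<dots> = (\<Sum>i<n. y i * (\<Sum>j<n. Y i j * u j))"
        unfolding bil_def sum_distrib_left by (intro sum.cong refl) simp
      also have "\<dots> = (\<Sum>i<n. y i * (l * u i))" using ueig by (intro sum.cong) auto
      also have "\<dots> = l * (\<Sum>i<n. u i * y i)" by (simp add: sum_distrib_left ac_simps)
      finally show ?thesis .
    qed
    define V where "V i j = Y i j - l / n * (u i * u j)" for i j
    have Vbil: "bil n V x x = bil n Y x x - l / n * (\<Sum>i<n. u i * x i)^2" for x
    proof -
      have "bil n V x x = (\<Sum>i<n. \<Sum>j<n. Y i j * (x i * x j) - l / n * ((u i * x i) * (u j * x j)))"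
        unfolding bil_def V_def by (intro sum.cong refl) (simp add: algebra_simps)
      also have "\<dots> = bil n Y x x - l / n * (\<Sum>i<n. \<Sum>j<n. (u i * x i) * (u j * x j))"
        unfolding bil_def by (simp only: sum_subtractf sum_distrib_left)
      finally show ?thesis unfolding power2_eq_square sum_product .
    qed
    have Vpsd: "psd_form n V"
      unfolding psd_form_def
    proof (intro conjI allI impI)
      fix x
      define b where "b = (\<Sum>i<n. u i * x i) / n"
      have ux: "(\<Sum>i<n. u i * x i) = b * n" unfolding b_def using n by simp
      have "0 \<le> bil n Y (\<lambda>i. x i + (-b) * u i) (\<lambda>i. x i + (-b) * u i)" using psd unfolding psd_form_def by blast
      also have "\<dots> = bil n Y x x + 2 * (-b) * bil n Y x u + (-b)^2 * bil n Y u u"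
        by (rule bil_add_square[OF psd_form_sym[OF psd]])
      also have "bil n Y x u = l * (b * n)" using bu[of x] bil_sym[of n Y x u, OF psd_form_sym[OF psd]] ux by
          simp
      also have "bil n Y u u = l * n" using bu[of u] uu by simp
      also have "bil n Y x x + 2 * (-b) * (l * (b * n)) + (-b)^2 * (l * n) = bil n V x x"
        unfolding Vbil ux using n by (simp add: power2_eq_square field_simps)
      finally show "0 \<le> bil n V x x" .
    qed (use psd_form_sym[OF psd] in \<open>auto simp: V_def\<close>)
    have trV: "(\<Sum>i<n. V i i) = n - l"
    proof -
      have "(\<Sum>i<n. V i i) = (\<Sum>i<n. Y i i) - l / n * (\<Sum>i<n. u i * u i)"
        unfolding V_def by (simp only: sum_subtractf sum_distrib_left)
      also have "(\<Sum>i<n. Y i i) = n" using sdp_diag[OF ctx] by simp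
      finally show ?thesis using n uu by simp
    qed
    define c where "c = (\<Sum>i<n. u i * s i)"
    have "bil n V s s \<le> (n - l) * n" using psd_form_le_trace[OF Vpsd, of s] unfolding trV ss .
    then have "n * (n - N) - l / n * c^2 \<le> (n - l) * n" unfolding Vbil Neq c_def .
    then have h1: "n * (l - N) \<le> l / n * c^2" by (simp add: algebra_simps)
    have lN: "n - N \<le> l" using ray n unfolding Neq ss by (simp add: mult.commute)
    have N0: "0 \<le> N" unfolding N_def using psd_form_diag[OF deflate_psd[OF ctx]] by (intro sum_nonneg) auto
    have l0: "0 < l" using lN False n by simp
    \<comment> \<open>Replacing \<open>N\<close> by the larger \<open>(2 N / n) * l\<close> makes
      both sides proportional to \<open>l\<close>, which can then be cancelled.\<close>
    have "n * (l - 2 * N / n * l) \<le> n * (l - N)"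
    proof -
      have "N * (n / 2) \<le> N * l" using N0 lN False by (intro mult_left_mono) auto
      then have "N \<le> 2 * N / n * l" using n by (simp add: field_simps)
      then show ?thesis by (intro mult_left_mono) auto
    qed
    with h1 have "n * (l - 2 * N / n * l) \<le> l / n * c^2" by linarith
    then have "n * (n * (l - 2 * N / n * l)) \<le> n * (l / n * c^2)" by (rule mult_left_mono) simp
    also have "n * (l / n * c^2) = l * c^2" using n by simp
    also have "n * (n * (l - 2 * N / n * l)) = l * (n * (n - 2 * N))" using n by (simp add: field_simps)
    finally have "l * (n * (n - 2 * N)) \<le> l * c^2" .
    then have "n * (n - 2 * N) \<le> c^2" using l0 by simp
    moreover have "(n - 2 * N)^2 \<le> n * (n - 2 * N)"
      unfolding power2_eq_square using False N0 by (intro mult_right_mono) auto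
    ultimately have "\<bar>n - 2 * N\<bar> \<le> \<bar>c\<bar>" by (simp only: abs_le_square_iff)
    then have cN: "n - 2 * N \<le> \<bar>c\<bar>" by linarith
    define g :: real where "g = (if 0 \<le> c then 1 else -1)"
    have g: "g \<in> {-1, 1}" "g * c = \<bar>c\<bar>" "g * g = 1" unfolding g_def by auto
    have "(\<Sum>i<n. (s i - g * u i)^2) = (\<Sum>i<n. (s i)^2 - 2 * g * (u i * s i) + (g * g) * (u i * u i))"
      by (intro sum.cong refl) (simp add: power2_eq_square algebra_simps)
    also have "\<dots> = (\<Sum>i<n. (s i)^2) - 2 * g * c + (g * g) * (\<Sum>i<n. u i * u i)"
      unfolding c_def by (simp only: sum.distrib sum_subtractf sum_distrib_left)
    also have "\<dots> = 2 * n - 2 * \<bar>c\<bar>" unfolding ss uu g(3) using g(2) by simp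
    finally have tot: "(\<Sum>i<n. (s i - g * u i)^2) \<le> 4 * N" using cN by simp
    let ?M = "{i. i < n \<and> g * (if 0 \<le> v i then 1 else -1) \<noteq> s i}"
    have "real (card ?M) = (\<Sum>i\<in>?M. 1)" by simp
    also have "\<dots> \<le> (\<Sum>i\<in>?M. (s i - g * u i)^2)"
    proof (rule sum_mono)
      fix i assume i: "i \<in> ?M"
      have "s i * (g * v i) \<le> 0" using i s[of i] g(1) by (auto split: if_splits)
      then have "a * (s i * (g * v i)) \<le> 0" using a by (simp add: mult_le_0_iff)
      then have sgu: "s i * (g * u i) \<le> 0" unfolding u_def by (simp add: ac_simps)
      have "(s i - g * u i)^2 = s i * s i - 2 * (s i * (g * u i)) + (g * u i)^2" by (simp add: power2_eq_square
          algebra_simps)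
      moreover have "s i * s i = 1" using labels_square[OF ctx, of i] i by simp
      moreover have "0 \<le> (g * u i)^2" by simp
      ultimately show "1 \<le> (s i - g * u i)^2" using sgu by linarith
    qed
    also have "\<dots> \<le> (\<Sum>i<n. (s i - g * u i)^2)" by (intro sum_mono2) auto
    finally have "real (card ?M) \<le> 4 * N" using tot by linarith
    then show ?thesis using g(1) unfolding N_def by blast
  qed
qed

section \<open>Chernoff bounds for signed degrees\<close>

text \<open>Extends weights on the edges at vertex \<open>i\<close> by 0 to all upper pairs, so that
  degrees and signed degrees become linear forms in the common independent variables.\<close>

definition star_coeff :: "nat \<Rightarrow> (nat \<times> nat \<Rightarrow> real) \<Rightarrow> nat \<times> nat \<Rightarrow> real" where
  "star_coeff i b k = (if fst k < snd k \<and> (i = fst k \<or> i = snd k) then b k else 0)"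

lemma bij_betw_star:
  assumes "i < n"
  shows "bij_betw (\<lambda>j. (min i j, max i j)) ({..<n} - {i}) {k\<in>upper_pairs n. fst k < snd k \<and> (i = fst k \<or> i = snd
      k)}"
proof (rule bij_betwI[where g = "\<lambda>k. if i = fst k then snd k else fst k"])
  show "(\<lambda>j. (min i j, max i j)) \<in> {..<n} - {i} \<rightarrow> {k\<in>upper_pairs n. fst k < snd k \<and> (i = fst k \<or> i = snd k)}"
    using assms by (auto simp: upper_pairs_def min_def max_def)
qed (use assms in \<open>auto simp: upper_pairs_def min_def max_def\<close>)

lemma sum_adj_row:
  assumes i: "i < n"
  shows "(\<Sum>j<n. adj \<omega> i j * b (min i j, max i j)) = (\<Sum>k\<in>upper_pairs n. star_coeff i b k * of_bool (\<omega> k))"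
proof -
  let ?I = "{k\<in>upper_pairs n. fst k < snd k \<and> (i = fst k \<or> i = snd k)}"
  have "(\<Sum>j<n. adj \<omega> i j * b (min i j, max i j)) = (\<Sum>j\<in>{..<n} - {i}. b (min i j, max i j) * of_bool (\<omega> (min i j,
      max i j)))"
    using i by (subst sum.remove[of _ i]) (auto simp: adj_def intro!: sum.cong)
  also have "\<dots> = (\<Sum>k\<in>?I. b k * of_bool (\<omega> k))"
    by (rule sum.reindex_bij_betw[OF bij_betw_star[OF i]])
  also have "\<dots> = (\<Sum>k\<in>?I. star_coeff i b k * of_bool (\<omega> k))" by (intro sum.cong) (auto simp: star_coeff_def)
  also have "\<dots> = (\<Sum>k\<in>upper_pairs n. star_coeff i b k * of_bool (\<omega> k))"
    by (rule sum.mono_neutral_left) (auto simp: star_coeff_def finite_upper_pairs)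
  finally show ?thesis .
qed

lemma expectation_star_exp:
  assumes i: "i < n" and r: "\<And>k. k \<in> upper_pairs n \<Longrightarrow> 0 \<le> r k \<and> r k \<le> 1"
  shows "measure_pmf.expectation (bern_prod (upper_pairs n) r) (\<lambda>\<omega>. exp (\<Sum>k\<in>upper_pairs n. star_coeff i b k *
      of_bool (\<omega> k)))
    = (\<Prod>j\<in>{..<n} - {i}. 1 - r (min i j, max i j) + r (min i j, max i j) * exp (b (min i j, max i j)))"
proof -
  let ?I = "{k\<in>upper_pairs n. fst k < snd k \<and> (i = fst k \<or> i = snd k)}"
  have "(\<Prod>j\<in>{..<n} - {i}. 1 - r (min i j, max i j) + r (min i j, max i j) * exp (b (min i j, max i j)))
    = (\<Prod>k\<in>?I. 1 - r k + r k * exp (b k))"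
    by (rule prod.reindex_bij_betw[OF bij_betw_star[OF i]])
  also have "\<dots> = (\<Prod>k\<in>?I. 1 - r k + r k * exp (star_coeff i b k))" by (intro prod.cong) (auto simp:
      star_coeff_def)
  also have "\<dots> = (\<Prod>k\<in>upper_pairs n. 1 - r k + r k * exp (star_coeff i b k))"
    by (rule prod.mono_neutral_left) (auto simp: star_coeff_def finite_upper_pairs)
  finally show ?thesis using expectation_bern_prod_exp[OF finite_upper_pairs r, where c = "star_coeff i b"] by
      simp
qed

text \<open>Stars at distinct vertices meet in one edge. For a Bernoulli variable of mean
  \<open>R\<close> and \<open>x = exp b\<close> the second moment exceeds the squared mean by
  \<open>R (1 - R) (x - 1)^2\<close>, which the hypothesis bounds relative to the squared
  mean.\<close>

lemma expectation_star_pair: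
  assumes ij: "i < n" "j < n" "i \<noteq> j" and r: "\<And>k. k \<in> upper_pairs n \<Longrightarrow> 0 \<le> r k \<and> r k \<le> 1"
    and kap: "\<And>k. k \<in> upper_pairs n \<Longrightarrow> fst k < snd k \<Longrightarrow> r k * (exp (b k) - 1)^2 \<le> \<kappa> * (1 - r k + r k * exp (b
        k))^2"
  shows "measure_pmf.expectation (bern_prod (upper_pairs n) r)
      (\<lambda>\<omega>. exp (\<Sum>k\<in>upper_pairs n. star_coeff i b k * of_bool (\<omega> k)) * exp (\<Sum>k\<in>upper_pairs n. star_coeff j b k *
          of_bool (\<omega> k)))
    \<le> (1 + \<kappa>) * (measure_pmf.expectation (bern_prod (upper_pairs n) r) (\<lambda>\<omega>. exp (\<Sum>k\<in>upper_pairs n. star_coeff i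
        b k * of_bool (\<omega> k)))
      * measure_pmf.expectation (bern_prod (upper_pairs n) r) (\<lambda>\<omega>. exp (\<Sum>k\<in>upper_pairs n. star_coeff j b k *
          of_bool (\<omega> k))))"
proof (rule bern_prod_exp_pair[OF finite_upper_pairs r])
  let ?k = "(min i j, max i j)"
  show k: "?k \<in> upper_pairs n" using ij by (auto simp: upper_pairs_def min_def max_def)
  have lt: "fst ?k < snd ?k" using ij by (auto simp: min_def max_def)
  show "star_coeff i b k = 0 \<or> star_coeff j b k = 0" if "k \<in> upper_pairs n" "k \<noteq> ?k" for k
    using that ij unfolding star_coeff_def by (cases k) (auto simp: min_def max_def split: if_splits)
  have sc: "star_coeff i b ?k = b ?k" "star_coeff j b ?k = b ?k"
    using ij unfolding star_coeff_def by (auto simp: min_def max_def)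
  define x where "x = exp (b ?k)"
  define R where "R = r ?k"
  have R: "0 \<le> R" "R \<le> 1" using r[OF k] unfolding R_def by auto
  have "1 - R + R * (x * x) = (1 - R + R * x)^2 + R * (1 - R) * (x - 1)^2" by (simp add: algebra_simps
      power2_eq_square)
  also have "R * (1 - R) * (x - 1)^2 \<le> R * (x - 1)^2"
    using R by (intro mult_right_mono) (auto simp: mult_left_le)
  also have "\<dots> \<le> \<kappa> * (1 - R + R * x)^2" using kap[OF k lt] unfolding R_def x_def .
  finally show "1 - r ?k + r ?k * exp (star_coeff i b ?k + star_coeff j b ?k)
    \<le> (1 + \<kappa>) * ((1 - r ?k + r ?k * exp (star_coeff i b ?k)) * (1 - r ?k + r ?k * exp (star_coeff j b ?k)))"
    unfolding sc exp_add x_def[symmetric] R_def[symmetric] by (simp add: power2_eq_square algebra_simps)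
qed

text \<open>Of the \<open>h\<close> vertices in the cluster of \<open>i\<close> only
  \<open>h - 1\<close> are neighbours, since \<open>i\<close> itself is excluded. This off-by-one
  produces the denominator in \<open>signed_deg_mgf\<close>.\<close>

lemma balanced_split:
  fixes s :: "nat \<Rightarrow> real"
  assumes s: "\<And>i. i < n \<Longrightarrow> s i \<in> {-1, 1}" and s0: "(\<Sum>i<n. s i) = 0" and i: "i < n"
  obtains h where "n = 2 * h" "0 < h" "card {j\<in>{..<n} - {i}. s i * s j = 1} = h - 1" "card {j\<in>{..<n} - {i}. s i
      * s j \<noteq> 1} = h"
proof -
  let ?S = "{j\<in>{..<n}. s i * s j = 1}" and ?D = "{j\<in>{..<n}. s i * s j \<noteq> 1}"
  have "(\<Sum>j<n. s i * s j) = 0" using s0 by (simp add: sum_distrib_left[symmetric])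
  moreover have "(\<Sum>j<n. s i * s j) = (\<Sum>j<n. if s i * s j = 1 then 1 else -1)"
  proof (intro sum.cong refl)
    fix j assume "j \<in> {..<n}"
    then have "s i * s j = 1 \<or> s i * s j = -1" using s[OF i] s[of j] by auto
    then show "s i * s j = (if s i * s j = 1 then 1 else -1)" by auto
  qed
  moreover have "(\<Sum>j<n. if s i * s j = 1 then 1 else -1) = real (card ?S) - real (card ?D)"
    by (simp add: sum.If_cases Int_def)
  ultimately have eq: "card ?S = card ?D" by simp
  have un: "?S \<union> ?D = {..<n}" by auto
  have "card ?S + card ?D = card (?S \<union> ?D)" by (rule card_Un_disjoint[symmetric]) auto
  then have nn: "n = 2 * card ?D" using eq unfolding un by simp
  have iS: "i \<in> ?S" using i s[OF i] by auto
  have "{j\<in>{..<n} - {i}. s i * s j = 1} = ?S - {i}" by auto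
  then have c1: "card {j\<in>{..<n} - {i}. s i * s j = 1} = card ?D - 1" using iS eq by simp
  have "{j\<in>{..<n} - {i}. s i * s j \<noteq> 1} = ?D" using iS by auto
  then have c2: "card {j\<in>{..<n} - {i}. s i * s j \<noteq> 1} = card ?D" by simp
  show ?thesis using that[of "card ?D"] nn c1 c2 i by auto
qed

lemma prod_two_values:
  fixes A B :: real
  assumes "finite T"
  shows "(\<Prod>j\<in>T. if P j then A else B) = A ^ card {j\<in>T. P j} * B ^ card {j\<in>T. \<not> P j}"
  using assms by (simp add: prod.If_cases Int_def)

text \<open>The \<open>h - 1\<close> factors inside and \<open>h\<close> factors across would form
  \<open>h\<close> complete pairs but for one missing inside factor, hence the division. The
  exponent \<open>a\<close> is free so that the formula serves both at \<open>t\<close>, with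
  \<open>a\<close> the Renyi divergence, and at \<open>2 t\<close>, with
  \<open>a = 0\<close>.\<close>

lemma signed_deg_mgf:
  fixes s :: "nat \<Rightarrow> real"
  assumes s: "\<And>i. i < n \<Longrightarrow> s i \<in> {-1, 1}" and s0: "(\<Sum>i<n. s i) = 0" and i: "i < n"
    and pq: "0 \<le> p" "p \<le> 1" "0 \<le> q" "q \<le> 1" and A: "0 < 1 - p + p * exp (- t)"
    and e: "(1 - p + p * exp (- t)) * (1 - q + q * exp t) = exp (- a)"
  shows "measure_pmf.expectation (bern_prod (upper_pairs n) (block_prob s p q)) (\<lambda>\<omega>. exp (- t * signed_deg n s \<omega>
      i))
    = exp (- (real n / 2 * a)) / (1 - p + p * exp (- t))"
proof -
  let ?r = "block_prob s p q" and ?b = "\<lambda>k. - t * (s (fst k) * s (snd k))"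
  obtain h where h: "n = 2 * h" "0 < h" "card {j\<in>{..<n} - {i}. s i * s j = 1} = h - 1" "card {j\<in>{..<n} - {i}. s
      i * s j \<noteq> 1} = h"
    by (rule balanced_split[OF s s0 i])
  have mm: "s (min i j) * s (max i j) = s i * s j" for j by (simp add: min_def max_def)
  have "- t * signed_deg n s \<omega> i = (\<Sum>j<n. adj \<omega> i j * ?b (min i j, max i j))" for \<omega>
    unfolding signed_deg_def sum_distrib_left by (intro sum.cong refl) (simp add: mm)
  then have X: "- t * signed_deg n s \<omega> i = (\<Sum>k\<in>upper_pairs n. star_coeff i ?b k * of_bool (\<omega> k))" for \<omega>
    using sum_adj_row[OF i, of \<omega> ?b] by simp
  have "measure_pmf.expectation (bern_prod (upper_pairs n) ?r) (\<lambda>\<omega>. exp (- t * signed_deg n s \<omega> i))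
    = (\<Prod>j\<in>{..<n} - {i}. 1 - ?r (min i j, max i j) + ?r (min i j, max i j) * exp (?b (min i j, max i j)))"
    unfolding X by (rule expectation_star_exp[OF i]) (use pq in \<open>auto simp: block_prob_def\<close>)
  also have "\<dots> = (\<Prod>j\<in>{..<n} - {i}. if s i * s j = 1 then 1 - p + p * exp (- t) else 1 - q + q * exp t)"
  proof (intro prod.cong refl)
    fix j assume "j \<in> {..<n} - {i}"
    then have "s i * s j = 1 \<or> s i * s j = -1" using s[OF i] s[of j] by auto
    then show "1 - ?r (min i j, max i j) + ?r (min i j, max i j) * exp (?b (min i j, max i j)) = (if s i * s j =
        1 then 1 - p + p * exp (- t) else 1 - q + q * exp t)"
      unfolding block_prob_def by (auto simp: mm)
  qed
  also have "\<dots> = (1 - p + p * exp (- t)) ^ (h - 1) * (1 - q + q * exp t) ^ h"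
    by (simp only: prod_two_values[OF finite_Diff[OF finite_lessThan]] h(3,4))
  also have "\<dots> = ((1 - p + p * exp (- t)) * (1 - q + q * exp t)) ^ h / (1 - p + p * exp (- t))"
    using A h(2) by (cases h) (auto simp: power_mult_distrib)
  also have "\<dots> = exp (- (real n / 2 * a)) / (1 - p + p * exp (- t))"
    unfolding e using h(1) by (simp add: exp_of_nat_mult[symmetric])
  finally show ?thesis .
qed

section \<open>The optimal exponent and the Renyi divergence\<close>

text \<open>The minimizer of the moment generating function of the signed degree. At twice this value the
two factors cancel exactly, so that the second moment in Chebyshev's inequality stays bounded.\<close>

definition chernoff_tilt :: "real \<Rightarrow> real \<Rightarrow> real" where
  "chernoff_tilt p q = ln (p * (1 - q) / (q * (1 - p))) / 2"

lemma bhattacharyya_bounds: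
  assumes "0 < q" "q < p" "p < 1"
  shows "0 < sqrt (p * q) + sqrt ((1 - p) * (1 - q))" "1 - p \<le> sqrt (p * q) + sqrt ((1 - p) * (1 - q))"
proof -
  have "(1 - p)^2 \<le> (1 - p) * (1 - q)" using assms unfolding power2_eq_square by (intro mult_left_mono) auto
  then have "1 - p \<le> sqrt ((1 - p) * (1 - q))" by (rule real_le_rsqrt)
  moreover have "0 < sqrt (p * q)" using assms by simp
  ultimately show "0 < sqrt (p * q) + sqrt ((1 - p) * (1 - q))" "1 - p \<le> sqrt (p * q) + sqrt ((1 - p) * (1 -
      q))"
    using assms by linarith+
qed

text \<open>At \<open>t\<close> the two cross terms \<open>(1 - p) q exp t\<close> and
  \<open>p (1 - q) exp (- t)\<close> coincide, so the product is the square of the Bhattacharyya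
  coefficient. At \<open>2 t\<close> the factors are \<open>(1 - p) / (1 - q)\<close> and its
  reciprocal.\<close>

lemma chernoff_tilt_products:
  assumes pq: "0 < q" "q < p" "p < 1"
  defines "t \<equiv> chernoff_tilt p q"
  shows "(1 - p + p * exp (- t)) * (1 - q + q * exp t) = exp (- renyi_info p q)"
    and "(1 - p + p * exp (- (2 * t))) * (1 - q + q * exp (2 * t)) = 1"
    and "q * exp (2 * t) = p * (1 - q) / (1 - p)"
proof -
  have pos: "0 < p" "0 < 1 - p" "0 < 1 - q" using pq by auto
  define x where "x = exp t"
  have x: "0 < x" unfolding x_def by simp
  have rp: "0 < p * (1 - q) / (q * (1 - p))" using pos pq by simp
  have x2: "x * x = p * (1 - q) / (q * (1 - p))"
  proof -
    have "x * x = exp (2 * t)" unfolding x_def by (simp add: exp_add[symmetric])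
    also have "\<dots> = p * (1 - q) / (q * (1 - p))" unfolding t_def chernoff_tilt_def using rp by simp
    finally show ?thesis .
  qed
  have e2: "exp (2 * t) = x * x" unfolding x_def by (simp add: exp_add[symmetric])
  have em: "exp (- t) = 1 / x" unfolding x_def by (simp add: exp_minus inverse_eq_divide)
  have em2: "exp (- (2 * t)) = 1 / (x * x)" using e2 by (simp add: exp_minus inverse_eq_divide)
  show "q * exp (2 * t) = p * (1 - q) / (1 - p)" unfolding e2 x2 using pq pos by simp
  show "(1 - p + p * exp (- (2 * t))) * (1 - q + q * exp (2 * t)) = 1"
    unfolding em2 e2 x2 using pq pos by (simp add: divide_simps) (simp add: algebra_simps)
  define y where "y = sqrt (p * q) * sqrt ((1 - p) * (1 - q))"
  have y0: "0 \<le> y" unfolding y_def using pq pos by auto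
  have yy: "y^2 = p * q * ((1 - p) * (1 - q))" unfolding y_def power_mult_distrib using pq pos by simp
  have y1: "(1 - p) * q * x = y"
  proof (rule power2_eq_imp_eq)
    have "((1 - p) * q * x)^2 = ((1 - p) * q)^2 * (x * x)" by (simp add: power2_eq_square)
    also have "\<dots> = y^2" unfolding x2 yy using pq pos by (simp add: field_simps power2_eq_square)
    finally show "((1 - p) * q * x)^2 = y^2" .
  qed (use y0 x pq pos in auto)
  have y2: "p * (1 - q) * (1 / x) = y"
  proof (rule power2_eq_imp_eq)
    have "(p * (1 - q) * (1 / x))^2 = (p * (1 - q))^2 / (x * x)" by (simp add: power2_eq_square)
    also have "\<dots> = y^2" unfolding x2 yy using pq pos by (simp add: field_simps power2_eq_square)
    finally show "(p * (1 - q) * (1 / x))^2 = y^2" .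
  qed (use y0 x pq pos in auto)
  define S where "S = sqrt (p * q) + sqrt ((1 - p) * (1 - q))"
  have S: "0 < S" unfolding S_def by (rule bhattacharyya_bounds(1)[OF pq])
  have "(1 - p + p * exp (- t)) * (1 - q + q * exp t) = (1 - p) * (1 - q) + p * q * (1 / x * x) + (1 - p) * q *
      x + p * (1 - q) * (1 / x)"
    unfolding em x_def[symmetric] by (simp add: algebra_simps)
  also have "\<dots> = (1 - p) * (1 - q) + p * q + y + y" unfolding y1 y2 using x by simp
  also have "\<dots> = S^2" unfolding S_def y_def using pq pos by (simp add: power2_sum)
  also have "\<dots> = exp (- renyi_info p q)"
  proof -
    have "exp (- renyi_info p q) = exp (2 * ln S)" unfolding renyi_info_def S_def[symmetric] by simp
    also have "\<dots> = exp (ln S) ^ 2" by (simp only: exp_double)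
    finally show ?thesis using S by simp
  qed
  finally show "(1 - p + p * exp (- t)) * (1 - q + q * exp t) = exp (- renyi_info p q)" .
qed

text \<open>Both bounds come from \<open>ln x <= x - 1\<close>, applied to \<open>p / q\<close> or
  its reciprocal and to \<open>(1 - q) / (1 - p)\<close>. The upper one depends on \<open>q\<close>
  being comparable to \<open>p\<close> and on \<open>1 - p\<close> staying away from 0.\<close>

lemma chernoff_tilt_bounds:
  assumes pq: "0 < c0" "0 < c1" "c0 * p \<le> q" "0 < q" "q < p" "p \<le> 1 - c1"
  shows "(p - q) / (2 * p) \<le> chernoff_tilt p q" "chernoff_tilt p q \<le> (1 / c0 + 1 / c1) / 2 * ((p - q) / p)"
proof -
  have pos: "0 < p" "0 < 1 - p" "0 < 1 - q" "p < 1" using pq by auto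
  have t: "chernoff_tilt p q = (ln (p / q) + ln ((1 - q) / (1 - p))) / 2"
  proof -
    have "p * (1 - q) / (q * (1 - p)) = (p / q) * ((1 - q) / (1 - p))" by simp
    then show ?thesis unfolding chernoff_tilt_def using pq pos by (simp only: ln_mult_pos[OF divide_pos_pos
        divide_pos_pos] pos)
  qed
  have "ln (q / p) \<le> q / p - 1" using pq pos by (intro ln_le_minus_one) auto
  then have "(p - q) / p \<le> ln (p / q)" using pq pos by (simp add: ln_div diff_divide_distrib)
  moreover have "0 \<le> ln ((1 - q) / (1 - p))" using pq pos by (intro ln_ge_zero) (simp add: pos_le_divide_eq)
  ultimately have "(p - q) / p / 2 \<le> chernoff_tilt p q" unfolding t by (intro divide_right_mono) auto
  then show "(p - q) / (2 * p) \<le> chernoff_tilt p q" by (simp add: mult.commute)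
  have "ln (p / q) \<le> p / q - 1" using pq pos by (intro ln_le_minus_one) auto
  also have "\<dots> = (p - q) / q" using pq by (simp add: diff_divide_distrib)
  also have "\<dots> \<le> (p - q) / (c0 * p)" using pq pos by (intro divide_left_mono) auto
  finally have a: "ln (p / q) \<le> 1 / c0 * ((p - q) / p)" by simp
  have "ln ((1 - q) / (1 - p)) \<le> (1 - q) / (1 - p) - 1" using pq pos by (intro ln_le_minus_one) auto
  also have "\<dots> = (p - q) / (1 - p)" using pos by (simp add: field_simps)
  also have "\<dots> \<le> (p - q) / (c1 * p)"
  proof (rule divide_left_mono)
    have "c1 * p \<le> c1 * 1" using pq pos by (intro mult_left_mono) auto
    then show "c1 * p \<le> 1 - p" using pq by linarith
  qed (use pq pos in auto)
  finally have b: "ln ((1 - q) / (1 - p)) \<le> 1 / c1 * ((p - q) / p)" by simp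
  have "(ln (p / q) + ln ((1 - q) / (1 - p))) / 2 \<le> (1 / c0 * ((p - q) / p) + 1 / c1 * ((p - q) / p)) / 2"
    by (intro divide_right_mono add_mono a b) simp
  also have "\<dots> = (1 / c0 + 1 / c1) / 2 * ((p - q) / p)" by (simp only: distrib_right times_divide_eq_left)
  finally show "chernoff_tilt p q \<le> (1 / c0 + 1 / c1) / 2 * ((p - q) / p)" unfolding t .
qed

lemma sqrt_diff_square:
  fixes a b :: real
  assumes "0 < a" "0 < b"
  shows "(sqrt a - sqrt b)^2 = (a - b)^2 / (sqrt a + sqrt b)^2"
proof -
  have "(sqrt a - sqrt b) * (sqrt a + sqrt b) = a - b" using assms by (simp add: algebra_simps)
  then have "(sqrt a - sqrt b)^2 * (sqrt a + sqrt b)^2 = (a - b)^2" by (metis power_mult_distrib)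
  moreover have "0 < sqrt a + sqrt b" using assms by (simp add: add_pos_pos)
  ultimately show ?thesis by (simp add: eq_divide_eq)
qed

lemma renyi_info_bounds:
  assumes pq: "0 < c1" "0 < q" "q < p" "p \<le> 1 - c1"
  shows "(p - q)^2 / p / 4 \<le> renyi_info p q" "renyi_info p q \<le> (1 + 1 / c1) / c1 * ((p - q)^2 / p)"
proof -
  have pos: "0 < p" "0 < 1 - p" "0 < 1 - q" "p < 1" using pq by auto
  define S where "S = sqrt (p * q) + sqrt ((1 - p) * (1 - q))"
  \<comment> \<open>A squared Hellinger distance: the Bhattacharyya coefficient is
    \<open>1 - h / 2\<close>, so \<open>-2 ln S\<close> lies between \<open>h\<close> and
    \<open>h / S\<close>, and \<open>S >= c1\<close>.\<close>
  define h where "h = (sqrt p - sqrt q)^2 + (sqrt (1 - p) - sqrt (1 - q))^2"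
  have "h = p + q - 2 * (sqrt p * sqrt q) + (1 - p) + (1 - q) - 2 * (sqrt (1 - p) * sqrt (1 - q))"
    unfolding h_def power2_diff using pq pos by simp
  then have Sh: "S = 1 - h / 2" unfolding S_def real_sqrt_mult by (simp add: field_simps)
  have S: "0 < S" "1 - p \<le> S" unfolding S_def using bhattacharyya_bounds[OF pq(2,3)] pos by auto
  have I: "renyi_info p q = - 2 * ln S" unfolding renyi_info_def S_def ..
  have "ln S \<le> S - 1" by (rule ln_le_minus_one[OF S(1)])
  then have hI: "h \<le> renyi_info p q" unfolding I Sh by simp
  have "ln (1 / S) \<le> 1 / S - 1" using S by (intro ln_le_minus_one) auto
  then have "- ln S \<le> (1 - S) / S" using S by (simp add: ln_div diff_divide_distrib)
  also have "\<dots> = h / 2 / S" unfolding Sh by simp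
  also have "\<dots> \<le> h / 2 / c1" using S pq unfolding h_def by (intro divide_left_mono) auto
  finally have Ih: "renyi_info p q \<le> h / c1" unfolding I by simp
  have sq: "sqrt q \<le> sqrt p" using pq by simp
  have "(p - q)^2 / (4 * p) \<le> (p - q)^2 / (sqrt p + sqrt q)^2"
  proof (rule divide_left_mono)
    have "(sqrt p + sqrt q)^2 \<le> (2 * sqrt p)^2" using sq pq pos by (intro power_mono) auto
    then show "(sqrt p + sqrt q)^2 \<le> 4 * p" using pos by (simp add: power_mult_distrib)
    have "0 < sqrt p + sqrt q" using pq pos by (simp add: add_pos_pos)
    then show "0 < 4 * p * (sqrt p + sqrt q)\<^sup>2" using pos by simp
  qed simp
  also have "\<dots> = (sqrt p - sqrt q)^2" using sqrt_diff_square[of p q] pq pos by simp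
  also have "\<dots> \<le> h" unfolding h_def by simp
  finally show "(p - q)^2 / p / 4 \<le> renyi_info p q" using hI by (simp add: mult.commute)
  have "(sqrt p - sqrt q)^2 = (p - q)^2 / (sqrt p + sqrt q)^2" using sqrt_diff_square[of p q] pq pos by simp
  also have "\<dots> \<le> (p - q)^2 / p"
  proof (rule divide_left_mono)
    have "(sqrt p)^2 \<le> (sqrt p + sqrt q)^2" using pq pos by (intro power_mono) auto
    then show "p \<le> (sqrt p + sqrt q)^2" using pos by simp
    have "0 < sqrt p + sqrt q" using pq pos by (simp add: add_pos_pos)
    then show "0 < (sqrt p + sqrt q)\<^sup>2 * p" using pos by simp
  qed simp
  finally have h1: "(sqrt p - sqrt q)^2 \<le> (p - q)^2 / p" .
  have "(sqrt (1 - p) - sqrt (1 - q))^2 = ((1 - p) - (1 - q))^2 / (sqrt (1 - p) + sqrt (1 - q))^2"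
    using sqrt_diff_square[of "1 - p" "1 - q"] pos by simp
  also have "\<dots> = (p - q)^2 / (sqrt (1 - p) + sqrt (1 - q))^2" by (simp add: power2_commute)
  also have "\<dots> \<le> (p - q)^2 / (c1 * p)"
  proof (rule divide_left_mono)
    have "(sqrt (1 - p))^2 \<le> (sqrt (1 - p) + sqrt (1 - q))^2" using pos by (intro power_mono) auto
    moreover have "c1 * p \<le> c1 * 1" using pq pos by (intro mult_left_mono) auto
    moreover have "(sqrt (1 - p))^2 = 1 - p" using pos by simp
    ultimately show "c1 * p \<le> (sqrt (1 - p) + sqrt (1 - q))^2" using pq by linarith
    have "0 < sqrt (1 - p) + sqrt (1 - q)" using pos by (simp add: add_pos_pos)
    then show "0 < (sqrt (1 - p) + sqrt (1 - q))\<^sup>2 * (c1 * p)" using pos pq by simp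
  qed simp
  finally have h2: "(sqrt (1 - p) - sqrt (1 - q))^2 \<le> 1 / c1 * ((p - q)^2 / p)" by simp
  have "h \<le> (p - q)^2 / p + 1 / c1 * ((p - q)^2 / p)" unfolding h_def by (intro add_mono h1 h2)
  then have "h \<le> (1 + 1 / c1) * ((p - q)^2 / p)" by (simp only: distrib_right mult_1_left)
  then have "h / c1 \<le> (1 + 1 / c1) * ((p - q)^2 / p) / c1" using pq by (intro divide_right_mono) auto
  with Ih show "renyi_info p q \<le> (1 + 1 / c1) / c1 * ((p - q)^2 / p)" by (simp add: mult.commute)
qed

text \<open>Markov's inequality suffices when \<open>n I\<close> exceeds \<open>ln n / 2\<close>. For smaller \<open>n I\<close> it cannot reach
the required probability, but then the summands are nearly uncorrelated and Chebyshev's inequality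
does.\<close>

lemma prob_signed_deg_sum:
  fixes s :: "nat \<Rightarrow> real" and p q c0 c1 :: real
  assumes n: "0 < n" and s: "\<And>i. i < n \<Longrightarrow> s i \<in> {-1, 1}" and s0: "(\<Sum>i<n. s i) = 0"
    and pq: "0 < c0" "0 < c1" "c0 * p \<le> q" "0 < q" "q < p" "p \<le> 1 - c1"
    and big: "1 / (c1 * sqrt n) + 2 * ((1 / c0 + 1 / c1) / 2)^2 / c1^2 * (ln n / n) \<le> exp (- sqrt (ln n))"
  defines "t \<equiv> chernoff_tilt p q" and "I \<equiv> renyi_info p q"
  shows "measure_pmf.prob (bern_prod (upper_pairs n) (block_prob s p q))
     {\<omega>. n * (2 / c1) * exp (2 * sqrt (n * I)) * exp (- (n / 2 * I)) \<le> (\<Sum>i<n. exp (- t * signed_deg n s \<omega> i))} \<le>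
         exp (- sqrt (ln n))"
proof -
  let ?M = "bern_prod (upper_pairs n) (block_prob s p q)"
  define L where "L = (1 / c0 + 1 / c1) / 2"
  have p01: "0 < p" "p < 1" "q < 1" "c1 < 1" "0 < 1 - p" using pq by auto
  define F where "F i \<omega> = exp (- t * signed_deg n s \<omega> i)" for i \<omega>
  define A where "A = 1 - p + p * exp (- t)"
  define \<mu> where "\<mu> = exp (- (n / 2 * I)) / A"
  have I0: "0 \<le> I"
    using renyi_info_bounds(1)[OF pq(2,4,5,6)] p01 unfolding I_def by (smt (verit) divide_nonneg_nonneg
        zero_le_power2)
  have tb: "0 \<le> t" "t \<le> L * ((p - q) / p)"
  proof -
    have "0 \<le> (p - q) / (2 * p)" using pq p01 by simp
    also have "\<dots> \<le> t" unfolding t_def by (rule chernoff_tilt_bounds(1)[OF pq])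
    finally show "0 \<le> t" .
    show "t \<le> L * ((p - q) / p)" unfolding t_def L_def by (rule chernoff_tilt_bounds(2)[OF pq])
  qed
  note prods = chernoff_tilt_products[OF pq(4,5) p01(2)]
  have A: "c1 \<le> A" "A \<le> 1"
  proof -
    have "0 \<le> p * exp (- t)" using p01 by simp
    then show "c1 \<le> A" unfolding A_def using pq by linarith
    have "p * exp (- t) \<le> p * 1" using tb p01 by (intro mult_left_mono) auto
    then show "A \<le> 1" unfolding A_def by simp
  qed
  have A0: "0 < A" using A pq by linarith
  have fin: "finite (set_pmf ?M)" by (rule finite_set_bern_prod[OF finite_upper_pairs])
  have EF: "measure_pmf.expectation ?M (F i) = \<mu>" if "i < n" for i
    unfolding F_def \<mu>_def A_def
    by (rule signed_deg_mgf[OF s s0 that]) (use A0 pq p01 prods(1) in \<open>auto simp: A_def t_def I_def\<close>)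
  have EF2: "measure_pmf.expectation ?M (\<lambda>\<omega>. (F i \<omega>)^2) \<le> 1 / c1" if "i < n" for i
  proof -
    have A2: "c1 \<le> 1 - p + p * exp (- (2 * t))"
    proof -
      have "0 \<le> p * exp (- (2 * t))" using p01 by simp
      then show ?thesis using pq by linarith
    qed
    have "measure_pmf.expectation ?M (\<lambda>\<omega>. (F i \<omega>)^2) = measure_pmf.expectation ?M (\<lambda>\<omega>. exp (- (2 * t) *
        signed_deg n s \<omega> i))"
      unfolding F_def by (simp add: exp_double[symmetric] mult.assoc)
    also have "\<dots> = exp (- (real n / 2 * 0)) / (1 - p + p * exp (- (2 * t)))"
      by (rule signed_deg_mgf[OF s s0 that]) (use A2 pq p01 prods(2) in \<open>auto simp: t_def\<close>)
    also have "\<dots> = 1 / (1 - p + p * exp (- (2 * t)))" by simp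
    also have "\<dots> \<le> 1 / c1" using A2 pq by (intro divide_left_mono) auto
    finally show ?thesis .
  qed
  \<comment> \<open>The relative covariance caused by the shared edge. It is small because
    \<open>p * t^2\<close> is of order \<open>I\<close>, and in the Chebyshev case \<open>I\<close>
    is at most \<open>ln n / (2 n)\<close>.\<close>
  define \<kappa> where "\<kappa> = p * t^2 / c1^2"
  have kap0: "0 \<le> \<kappa>" unfolding \<kappa>_def using p01 by simp
  have EFF: "measure_pmf.expectation ?M (\<lambda>\<omega>. F i \<omega> * F j \<omega>) \<le> \<mu> * \<mu> + \<kappa> * \<mu>^2" if ij: "i < n" "j < n" "i \<noteq> j"
      for i j
  proof -
    let ?b = "\<lambda>k. - t * (s (fst k) * s (snd k))"
    have mm: "s (min i j) * s (max i j) = s i * s j" for i j by (simp add: min_def max_def)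
    have X: "- t * signed_deg n s \<omega> i = (\<Sum>k\<in>upper_pairs n. star_coeff i ?b k * of_bool (\<omega> k))" if "i < n" for i
        \<omega>
    proof -
      have "- t * signed_deg n s \<omega> i = (\<Sum>j<n. adj \<omega> i j * ?b (min i j, max i j))"
        unfolding signed_deg_def sum_distrib_left by (intro sum.cong refl) (simp add: mm)
      then show ?thesis using sum_adj_row[OF that, of \<omega> ?b] by simp
    qed
    have "measure_pmf.expectation ?M (\<lambda>\<omega>. F i \<omega> * F j \<omega>)
      \<le> (1 + \<kappa>) * (measure_pmf.expectation ?M (F i) * measure_pmf.expectation ?M (F j))"
      unfolding F_def X[OF ij(1)] X[OF ij(2)]
    proof (rule expectation_star_pair[OF ij])
      show "0 \<le> block_prob s p q k \<and> block_prob s p q k \<le> 1" for k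
        using pq p01 unfolding block_prob_def by auto
      fix k assume k: "k \<in> upper_pairs n"
      have kn: "fst k < n" "snd k < n" using k unfolding upper_pairs_def by auto
      consider (same) "s (fst k) * s (snd k) = 1" | (diff) "s (fst k) * s (snd k) = -1"
        using s[OF kn(1)] s[OF kn(2)] by auto
      then show "block_prob s p q k * (exp (?b k) - 1)^2 \<le> \<kappa> * (1 - block_prob s p q k + block_prob s p q k *
          exp (?b k))^2"
      proof cases
        case same
        have "1 + - t \<le> exp (- t)" by (rule exp_ge_add_one_self)
        moreover have "exp (- t) \<le> 1" using tb by simp
        ultimately have "(exp (- t) - 1)^2 \<le> t^2" using tb by (simp add: abs_le_square_iff[symmetric])
        then have "p * (exp (- t) - 1)^2 \<le> p * t^2" using p01 by (intro mult_left_mono) auto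
        also have "\<dots> = \<kappa> * c1^2" unfolding \<kappa>_def using pq by simp
        also have "\<dots> \<le> \<kappa> * A^2" using A pq kap0 by (intro mult_left_mono power_mono) auto
        finally show ?thesis using same unfolding block_prob_def A_def by simp
      next
        case diff
        \<comment> \<open>For a cross-cluster edge \<open>exp t - 1 <= t * exp t\<close>, and the
          identity for \<open>q * exp (2 t)\<close> then turns the bound into one of order
          \<open>p * t^2\<close>, as for the other edges.\<close>
        have "1 + - t \<le> exp (- t)" by (rule exp_ge_add_one_self)
        then have "(1 - t) * exp t \<le> exp (- t) * exp t" by (intro mult_right_mono) auto
        then have "exp t - 1 \<le> t * exp t" by (simp add: exp_add[symmetric] algebra_simps)
        then have "(exp t - 1)^2 \<le> (t * exp t)^2" using tb by (intro power_mono) auto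
        then have "q * (exp t - 1)^2 \<le> q * (t * exp t)^2" using pq by (intro mult_left_mono) auto
        also have "\<dots> = t^2 * (q * exp (2 * t))" by (simp add: power_mult_distrib exp_double)
        also have "\<dots> = t^2 * (p * (1 - q) / (1 - p))" using prods(3) unfolding t_def by simp
        also have "\<dots> \<le> t^2 * (p * 1 / (c1 * c1))"
        proof (rule mult_left_mono, rule frac_le)
          have "c1 * c1 \<le> c1 * 1" using p01 pq by (intro mult_left_mono) auto
          then show "c1 * c1 \<le> 1 - p" using pq by linarith
          show "p * (1 - q) \<le> p * 1" using p01 pq by (intro mult_left_mono) auto
        qed (use pq p01 in auto)
        also have "\<dots> = \<kappa> * 1^2" unfolding \<kappa>_def by (simp add: power2_eq_square)
        also have "\<dots> \<le> \<kappa> * (1 - q + q * exp t)^2"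
        proof (intro mult_left_mono power_mono)
          have "q * 1 \<le> q * exp t" using tb pq by (intro mult_left_mono) auto
          then show "1 \<le> 1 - q + q * exp t" by simp
        qed (use kap0 in auto)
        finally show ?thesis using diff unfolding block_prob_def by simp
      qed
    qed
    then show ?thesis using EF ij by (simp add: power2_eq_square algebra_simps)
  qed
  have mu: "exp (- (n / 2 * I)) \<le> \<mu>" "\<mu> \<le> exp (- (n / 2 * I)) / c1" "0 < \<mu>"
  proof -
    show "exp (- (n / 2 * I)) \<le> \<mu>" "0 < \<mu>"
      unfolding \<mu>_def using A A0 by (auto simp: pos_le_divide_eq mult_left_le)
    show "\<mu> \<le> exp (- (n / 2 * I)) / c1"
      unfolding \<mu>_def using A A0 pq by (intro divide_left_mono) auto
  qed
  let ?T = "n * (2 / c1) * exp (2 * sqrt (n * I)) * exp (- (n / 2 * I))"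
  \<comment> \<open>One threshold serves both methods: it exceeds twice the mean, as Chebyshev
    requires, and also \<open>exp (2 sqrt (n I))\<close> times the mean, as Markov requires.\<close>
  have Tge: "n * \<mu> * x \<le> ?T" if "x \<le> 2 * exp (2 * sqrt (n * I))" "0 \<le> x" for x
  proof -
    have "n * \<mu> * x \<le> n * (exp (- (n / 2 * I)) / c1) * (2 * exp (2 * sqrt (n * I)))"
      using that mu pq by (intro mult_mono) auto
    then show ?thesis by (simp add: ac_simps)
  qed
  have Fpos: "0 \<le> F i \<omega>" for i \<omega> unfolding F_def by simp
  show ?thesis
  proof (cases "n * I \<le> ln n / 2")
    case True
    have "measure_pmf.prob ?M {\<omega>. ?T \<le> (\<Sum>i<n. F i \<omega>)} \<le> measure_pmf.prob ?M {\<omega>. (\<Sum>i<n. \<mu>) + n * \<mu> \<le> (\<Sum>i<n. F i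
        \<omega>)}"
    proof (rule measure_pmf.finite_measure_mono)
      have "0 \<le> sqrt (n * I)" using I0 by simp
      then have "1 \<le> exp (2 * sqrt (n * I))" by simp
      then have "n * \<mu> * 2 \<le> ?T" by (intro Tge) auto
      then show "{\<omega>. ?T \<le> (\<Sum>i<n. F i \<omega>)} \<subseteq> {\<omega>. (\<Sum>i<n. \<mu>) + n * \<mu> \<le> (\<Sum>i<n. F i \<omega>)}" by (auto simp: mult.commute)
    qed simp
    also have "\<dots> \<le> (real n * (1 / c1) + (real n)^2 * (\<kappa> * \<mu>^2)) / (real n * \<mu>)^2"
      using EF EF2 EFF kap0 pq mu n by (intro pmf_chebyshev_sum[OF fin]) auto
    also have "\<dots> = 1 / c1 / (n * \<mu>^2) + \<kappa>"
      using n mu pq by (simp add: field_simps power2_eq_square)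
    also have "1 / c1 / (n * \<mu>^2) \<le> 1 / (c1 * sqrt n)"
    proof -
      have "exp (- (ln n / 2)) \<le> exp (- (n * I))" using True by simp
      also have "\<dots> = (exp (- (n / 2 * I)))^2" by (simp add: exp_double[symmetric])
      also have "\<dots> \<le> \<mu>^2" using mu by (intro power_mono) auto
      finally have m2: "exp (- (ln n / 2)) \<le> \<mu>^2" .
      have "exp (ln (sqrt n)) = sqrt n" using n by (intro exp_ln) simp
      then have "sqrt n = exp (ln n / 2)" using n by (simp add: ln_sqrt)
      then have es: "exp (- (ln n / 2)) = 1 / sqrt n" by (simp add: exp_minus inverse_eq_divide)
      have "sqrt n = n * (1 / sqrt n)" using n by (simp add: real_div_sqrt)
      also have "\<dots> \<le> n * \<mu>^2" using m2 unfolding es by (intro mult_left_mono) auto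
      finally have "c1 * sqrt n \<le> c1 * (n * \<mu>^2)" using pq by (intro mult_left_mono) auto
      then show ?thesis using n pq mu by (simp add: frac_le)
    qed
    also have "\<kappa> \<le> 2 * L^2 / c1^2 * (ln n / n)"
    proof -
      have "t^2 \<le> (L * ((p - q) / p))^2" using tb by (intro power_mono) auto
      then have "p * t^2 \<le> p * (L * ((p - q) / p))^2" using p01 by (intro mult_left_mono) auto
      also have "\<dots> = L^2 * ((p - q)^2 / p)" using p01 by (simp add: power2_eq_square)
      also have "\<dots> \<le> L^2 * (4 * I)" using renyi_info_bounds(1)[OF pq(2,4,5,6)] unfolding I_def by (intro
          mult_left_mono) auto
      also have "\<dots> \<le> L^2 * (2 * (ln n / n))" using True n by (intro mult_left_mono) (auto simp: field_simps)
      finally have "p * t^2 / c1^2 \<le> L^2 * (2 * (ln n / n)) / c1^2" by (rule divide_right_mono) simp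
      then show ?thesis unfolding \<kappa>_def by (simp add: ac_simps)
    qed
    finally have "measure_pmf.prob ?M {\<omega>. ?T \<le> (\<Sum>i<n. F i \<omega>)} \<le> 1 / (c1 * sqrt n) + 2 * L^2 / c1^2 * (ln n / n)"
        by simp
    then show ?thesis using big unfolding F_def L_def by linarith
  next
    case False
    let ?w = "2 * sqrt (n * I)"
    have "measure_pmf.prob ?M {\<omega>. ?T \<le> (\<Sum>i<n. F i \<omega>)} \<le> measure_pmf.prob ?M {\<omega>. n * \<mu> * exp ?w \<le> (\<Sum>i<n. F i \<omega>)}"
    proof (rule measure_pmf.finite_measure_mono)
      have "n * \<mu> * exp ?w \<le> ?T" by (intro Tge) auto
      then show "{\<omega>. ?T \<le> (\<Sum>i<n. F i \<omega>)} \<subseteq> {\<omega>. n * \<mu> * exp ?w \<le> (\<Sum>i<n. F i \<omega>)}" by auto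
    qed simp
    also have "\<dots> \<le> measure_pmf.expectation ?M (\<lambda>\<omega>. \<Sum>i<n. F i \<omega>) / (n * \<mu> * exp ?w)"
      using Fpos mu n by (intro prob_ge_Markov[OF fin] sum_nonneg) auto
    also have "measure_pmf.expectation ?M (\<lambda>\<omega>. \<Sum>i<n. F i \<omega>) = n * \<mu>"
      using EF by (subst Bochner_Integration.integral_sum) (auto intro!: integrable_bern_prod
          finite_upper_pairs)
    also have "n * \<mu> / (n * \<mu> * exp ?w) = exp (- ?w)" using mu n by (simp add: exp_minus inverse_eq_divide)
    also have "\<dots> \<le> exp (- sqrt (ln n))"
    proof -
      have "0 \<le> n * I" using I0 by simp
      then have "sqrt (ln n) \<le> sqrt (4 * (n * I))" using False by (intro real_sqrt_le_mono) linarith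
      also have "\<dots> = ?w" by (simp add: real_sqrt_mult)
      finally show ?thesis by simp
    qed
    finally show ?thesis unfolding F_def .
  qed
qed

section \<open>Exponential moments of the degrees\<close>

lemma deg_mgf_le:
  assumes i: "i < n" and r: "\<And>k. k \<in> upper_pairs n \<Longrightarrow> 0 \<le> r k \<and> r k \<le> p" and p: "0 \<le> p" "p \<le> 1" and u: "0 \<le> u"
  shows "measure_pmf.expectation (bern_prod (upper_pairs n) r) (\<lambda>\<omega>. exp (u * deg n \<omega> i)) \<le> exp (n * p * (exp u -
      1))"
proof -
  have X: "u * deg n \<omega> i = (\<Sum>k\<in>upper_pairs n. star_coeff i (\<lambda>_. u) k * of_bool (\<omega> k))" for \<omega>
    using sum_adj_row[OF i, of \<omega> "\<lambda>_. u"] unfolding deg_def by (simp add: sum_distrib_left mult.commute)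
  have r1: "0 \<le> r k \<and> r k \<le> 1" if "k \<in> upper_pairs n" for k using r[OF that] p by auto
  have "measure_pmf.expectation (bern_prod (upper_pairs n) r) (\<lambda>\<omega>. exp (u * deg n \<omega> i))
    = (\<Prod>j\<in>{..<n} - {i}. 1 - r (min i j, max i j) + r (min i j, max i j) * exp u)"
    unfolding X by (rule expectation_star_exp[OF i r1])
  also have "\<dots> \<le> (\<Prod>j\<in>{..<n} - {i}. exp (p * (exp u - 1)))"
  proof (intro prod_mono conjI)
    fix j assume j: "j \<in> {..<n} - {i}"
    define R where "R = r (min i j, max i j)"
    have "(min i j, max i j) \<in> upper_pairs n" using j i by (auto simp: upper_pairs_def min_def max_def)
    then have R: "0 \<le> R" "R \<le> p" using r unfolding R_def by auto
    have e: "0 \<le> exp u - 1" using u by simp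
    have "1 - R + R * exp u = 1 + R * (exp u - 1)" by (simp add: algebra_simps)
    also have "\<dots> \<le> exp (R * (exp u - 1))" by (rule exp_ge_add_one_self)
    also have "\<dots> \<le> exp (p * (exp u - 1))" using R e by (simp add: mult_right_mono)
    finally show "1 - r (min i j, max i j) + r (min i j, max i j) * exp u \<le> exp (p * (exp u - 1))" unfolding
        R_def .
    show "0 \<le> 1 - r (min i j, max i j) + r (min i j, max i j) * exp u"
      unfolding R_def[symmetric] using R p by (intro add_nonneg_nonneg mult_nonneg_nonneg) auto
  qed
  also have "\<dots> = exp (real (n - 1) * (p * (exp u - 1)))" using i by (simp add: exp_of_nat_mult[symmetric])
  also have "\<dots> \<le> exp (n * p * (exp u - 1))"
    unfolding exp_le_cancel_iff mult.assoc using p u by (intro mult_right_mono mult_nonneg_nonneg) auto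
  finally show ?thesis .
qed

text \<open>The means are at most \<open>exp (8 d)\<close> and the second moments at most
  \<open>exp (80 d)\<close>, from \<open>exp 2 <= 9\<close> and \<open>exp 4 <= 81\<close>. The
  threshold \<open>exp (9 d)\<close> leaves Markov the gain \<open>exp (- d)\<close>, enough once
  \<open>d >= sqrt (ln n)\<close>. For smaller \<open>d\<close> the second moments are dominated by
  \<open>n\<close> and Chebyshev applies.\<close>

lemma prob_exp_deg_sum:
  fixes d :: real
  assumes n: "0 < n" and r: "\<And>k. k \<in> upper_pairs n \<Longrightarrow> 0 \<le> r k \<and> r k \<le> p" and p: "0 \<le> p" "p \<le> 1"
    and d: "d = n * p" "1 \<le> d"
    and big: "exp (80 * sqrt (ln n)) / n + 64 * sqrt (ln n) * exp (16 * sqrt (ln n)) / n \<le> exp (- sqrt (ln n))"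
  shows "measure_pmf.prob (bern_prod (upper_pairs n) r) {\<omega>. n * exp (9 * d) \<le> (\<Sum>i<n. exp (2 * deg n \<omega> i))} \<le> exp
      (- sqrt (ln n))"
proof -
  let ?M = "bern_prod (upper_pairs n) r"
  have e1: "exp (1::real) \<le> 3" by (rule exp_le)
  have e2: "exp (2::real) \<le> 9"
    using power_mono[OF e1, of 2] by (simp add: exp_double[symmetric])
  have e4: "exp (4::real) \<le> 81"
    using power_mono[OF e2, of 2] by (simp add: exp_double[symmetric])
  have r1: "0 \<le> r k \<and> r k \<le> 1" if "k \<in> upper_pairs n" for k using r[OF that] p by auto
  have fin: "finite (set_pmf ?M)" by (rule finite_set_bern_prod[OF finite_upper_pairs])
  define F where "F i \<omega> = exp (2 * deg n \<omega> i)" for i \<omega>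
  define m where "m i = measure_pmf.expectation ?M (F i)" for i
  have m0: "0 \<le> m i" for i unfolding m_def F_def by simp
  have m: "m i \<le> exp (8 * d)" if "i < n" for i
  proof -
    have "m i \<le> exp (n * p * (exp 2 - 1))" unfolding m_def F_def by (rule deg_mgf_le[OF that r p]) auto
    also have "n * p * (exp 2 - 1) \<le> n * p * 8" using e2 p by (intro mult_left_mono) auto
    finally show ?thesis unfolding d by (simp add: mult.commute)
  qed
  have sq: "measure_pmf.expectation ?M (\<lambda>\<omega>. (F i \<omega>)^2) \<le> exp (80 * d)" if "i < n" for i
  proof -
    have "measure_pmf.expectation ?M (\<lambda>\<omega>. (F i \<omega>)^2) = measure_pmf.expectation ?M (\<lambda>\<omega>. exp (4 * deg n \<omega> i))"
      unfolding F_def by (simp add: exp_double[symmetric])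
    also have "\<dots> \<le> exp (n * p * (exp 4 - 1))" by (rule deg_mgf_le[OF that r p]) auto
    also have "n * p * (exp 4 - 1) \<le> n * p * 80" using e4 p by (intro mult_left_mono) auto
    finally show ?thesis unfolding d by (simp add: mult.commute)
  qed
  have cr: "measure_pmf.expectation ?M (\<lambda>\<omega>. F i \<omega> * F j \<omega>) \<le> m i * m j + 64 * p * exp (16 * d)" if ij: "i < n"
      "j < n" "i \<noteq> j" for i j
  proof -
    have X: "2 * deg n \<omega> i = (\<Sum>k\<in>upper_pairs n. star_coeff i (\<lambda>_. 2) k * of_bool (\<omega> k))" if "i < n" for i \<omega>
      using sum_adj_row[OF that, of \<omega> "\<lambda>_. 2"] unfolding deg_def by (simp add: sum_distrib_left mult.commute)
    have "measure_pmf.expectation ?M (\<lambda>\<omega>. F i \<omega> * F j \<omega>) \<le> (1 + 64 * p) * (m i * m j)"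
      unfolding F_def m_def X[OF ij(1)] X[OF ij(2)]
    proof (rule expectation_star_pair[OF ij r1])
      fix k assume k: "k \<in> upper_pairs n"
      have "r k * (exp 2 - 1)^2 \<le> p * 8^2"
        using r[OF k] e2 p by (intro mult_mono power_mono) auto
      also have "\<dots> = 64 * p * 1^2" by simp
      also have "\<dots> \<le> 64 * p * (1 - r k + r k * exp 2)^2"
      proof (intro mult_left_mono power_mono)
        have "r k * 1 \<le> r k * exp 2" using r[OF k] by (intro mult_left_mono) auto
        then show "1 \<le> 1 - r k + r k * exp 2" by simp
      qed (use p in auto)
      finally show "r k * (exp 2 - 1)^2 \<le> 64 * p * (1 - r k + r k * exp 2)^2" .
    qed
    also have "\<dots> = m i * m j + 64 * p * (m i * m j)" by (simp add: algebra_simps)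
    also have "64 * p * (m i * m j) \<le> 64 * p * (exp (8 * d) * exp (8 * d))"
      using p m0 m ij by (intro mult_left_mono mult_mono) auto
    also have "exp (8 * d) * exp (8 * d) = exp (16 * d)" by (simp add: exp_add[symmetric])
    finally show ?thesis by simp
  qed
  have msum: "(\<Sum>i<n. m i) \<le> n * exp (8 * d)"
  proof -
    have "(\<Sum>i<n. m i) \<le> (\<Sum>i<n. exp (8 * d))" by (intro sum_mono m) auto
    then show ?thesis by simp
  qed
  show ?thesis
  proof (cases "d < sqrt (ln n)")
    case True
    have "measure_pmf.prob ?M {\<omega>. n * exp (9 * d) \<le> (\<Sum>i<n. F i \<omega>)} \<le> measure_pmf.prob ?M {\<omega>. (\<Sum>i<n. m i) + n \<le>
        (\<Sum>i<n. F i \<omega>)}"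
    proof (rule measure_pmf.finite_measure_mono)
      have "exp (8 * d) + 1 \<le> exp (8 * d) * 2" using d by simp
      also have "\<dots> \<le> exp (8 * d) * exp d"
      proof (rule mult_left_mono)
        show "2 \<le> exp d" using exp_ge_add_one_self[of d] d(2) by linarith
      qed simp
      also have "\<dots> = exp (9 * d)" by (simp add: exp_add[symmetric])
      finally have "n * (exp (8 * d) + 1) \<le> n * exp (9 * d)" by (intro mult_left_mono) auto
      then have "(\<Sum>i<n. m i) + n \<le> n * exp (9 * d)" using msum by (simp add: distrib_left)
      then show "{\<omega>. n * exp (9 * d) \<le> (\<Sum>i<n. F i \<omega>)} \<subseteq> {\<omega>. (\<Sum>i<n. m i) + n \<le> (\<Sum>i<n. F i \<omega>)}" by auto
    qed simp
    also have "\<dots> \<le> (real n * exp (80 * d) + (real n)^2 * (64 * p * exp (16 * d))) / (real n)^2"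
    proof (rule pmf_chebyshev_sum[OF fin])
      show "measure_pmf.expectation ?M (F i) = m i" for i by (simp add: m_def)
    qed (use p n sq cr in auto)
    also have "\<dots> = exp (80 * d) / n + 64 * d * exp (16 * d) / n"
      unfolding d(1) using n by (simp add: field_simps power2_eq_square)
    also have "\<dots> \<le> exp (80 * sqrt (ln n)) / n + 64 * sqrt (ln n) * exp (16 * sqrt (ln n)) / n"
      using True d n by (intro add_mono divide_right_mono mult_mono) auto
    finally show ?thesis using big unfolding F_def by linarith
  next
    case False
    have "measure_pmf.prob ?M {\<omega>. n * exp (9 * d) \<le> (\<Sum>i<n. F i \<omega>)} \<le> measure_pmf.expectation ?M (\<lambda>\<omega>. \<Sum>i<n. F i
        \<omega>) / (n * exp (9 * d))"
      using n by (intro prob_ge_Markov[OF fin] sum_nonneg) (auto simp: F_def)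
    also have "measure_pmf.expectation ?M (\<lambda>\<omega>. \<Sum>i<n. F i \<omega>) = (\<Sum>i<n. m i)"
      unfolding m_def by (subst Bochner_Integration.integral_sum) (auto intro!: integrable_bern_prod
          finite_upper_pairs)
    also have "(\<Sum>i<n. m i) / (n * exp (9 * d)) \<le> n * exp (8 * d) / (n * exp (9 * d))"
      using msum by (intro divide_right_mono) auto
    also have "\<dots> = exp (8 * d) / exp (9 * d)" using n by simp
    also have "\<dots> = exp (- d)" by (simp add: exp_diff[symmetric])
    also have "\<dots> \<le> exp (- sqrt (ln n))" using False by simp
    finally show ?thesis unfolding F_def .
  qed
qed

section \<open>Coupling and matrices\<close>

text \<open>Raising within-cluster edges and lowering cross-cluster edges only shrinks the set of
admissible matrices, so a monotone coupling reduces the heterogeneous model to the homogeneous one.\<close>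

lemma bernoulli_coupling:
  assumes "0 \<le> a" "a \<le> b" "b \<le> 1"
  shows "\<exists>J. map_pmf fst J = bernoulli_pmf a \<and> map_pmf snd J = bernoulli_pmf b \<and> (\<forall>z\<in>set_pmf J. fst z \<longrightarrow> snd z)"
proof -
  define c where "c = a / b"
  \<comment> \<open>If \<open>b = 0\<close>, then \<open>a = 0\<close> too, and the convention
    \<open>a / b = 0\<close> still gives \<open>b * c = a\<close>.\<close>
  have c: "0 \<le> c" "c \<le> 1" "b * c = a" using assms unfolding c_def by (auto simp: divide_le_eq_1)
  define J where "J = bind_pmf (bernoulli_pmf b) (\<lambda>y. map_pmf (\<lambda>z. (y \<and> z, y)) (bernoulli_pmf c))"
  have "pmf (map_pmf fst J) True = a"
  proof -
    have "map_pmf fst J = bind_pmf (bernoulli_pmf b) (\<lambda>y. bind_pmf (bernoulli_pmf c) (\<lambda>z. return_pmf (y \<and> z)))"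
      unfolding J_def by (simp add: map_bind_pmf map_pmf_comp map_pmf_def[of _ "bernoulli_pmf c"] bind_assoc_pmf
          bind_return_pmf)
    then show ?thesis using assms c by (simp add: pmf_bind indicator_def)
  qed
  then have 1: "map_pmf fst J = bernoulli_pmf a"
  proof -
    assume t: "pmf (map_pmf fst J) True = a"
    have "pmf (map_pmf fst J) False = 1 - pmf (map_pmf fst J) True" by (rule pmf_False_conv_True)
    then show ?thesis using t assms by (intro pmf_eqI) (case_tac i; simp)
  qed
  have 2: "map_pmf snd J = bernoulli_pmf b"
    unfolding J_def by (simp add: map_bind_pmf map_pmf_comp bind_return_pmf')
  have 3: "\<forall>z\<in>set_pmf J. fst z \<longrightarrow> snd z" unfolding J_def by auto
  show ?thesis using 1 2 3 by blast
qed

text \<open>The direction of the coupling may differ from coordinate to coordinate, and the events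
  on the two sides may differ: \<open>S\<close> only has to follow from \<open>S'\<close> along
  coupled configurations. Thus \<open>S'\<close> can be a nonmonotone good event and
  \<open>S\<close> its consequence.\<close>

lemma prob_bern_prod_coupling:
  fixes r r' :: "'a \<Rightarrow> real"
  assumes fin: "finite I" and r: "\<And>k. k \<in> I \<Longrightarrow> 0 \<le> r k \<and> r k \<le> 1" and r': "\<And>k. k \<in> I \<Longrightarrow> 0 \<le> r' k \<and> r' k \<le> 1"
    and up: "\<And>k. k \<in> I \<Longrightarrow> up k \<Longrightarrow> r' k \<le> r k" and down: "\<And>k. k \<in> I \<Longrightarrow> \<not> up k \<Longrightarrow> r k \<le> r' k"
    and mono: "\<And>\<omega> \<omega>'. (\<And>k. k \<in> I \<Longrightarrow> up k \<Longrightarrow> \<omega>' k \<Longrightarrow> \<omega> k) \<Longrightarrow> (\<And>k. k \<in> I \<Longrightarrow> \<not> up k \<Longrightarrow> \<omega> k \<Longrightarrow> \<omega>' k) \<Longrightarrow> \<omega>' \<in> S' \<Longrightarrow> \<omega> \<in> S"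
  shows "measure_pmf.prob (bern_prod I r') S' \<le> measure_pmf.prob (bern_prod I r) S"
proof -
  define R where "R k z \<longleftrightarrow> (if up k then snd z \<longrightarrow> fst z else fst z \<longrightarrow> snd z)" for k and z :: "bool \<times> bool"
  have "\<exists>J. map_pmf fst J = bernoulli_pmf (r k) \<and> map_pmf snd J = bernoulli_pmf (r' k) \<and> (\<forall>z\<in>set_pmf J. R k z)"
      if k: "k \<in> I" for k
  proof (cases "up k")
    case True
    obtain J where J: "map_pmf fst J = bernoulli_pmf (r' k)" "map_pmf snd J = bernoulli_pmf (r k)" "\<forall>z\<in>set_pmf
        J. fst z \<longrightarrow> snd z"
      using bernoulli_coupling[of "r' k" "r k"] r[OF k] r'[OF k] up[OF k True] by blast
    have "map_pmf fst (map_pmf prod.swap J) = bernoulli_pmf (r k)" "map_pmf snd (map_pmf prod.swap J) =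
        bernoulli_pmf (r' k)"
      using J by (simp_all add: map_pmf_comp o_def)
    moreover have "\<forall>z\<in>set_pmf (map_pmf prod.swap J). R k z" using J(3) True unfolding R_def by auto
    ultimately show ?thesis by blast
  next
    case False
    then show ?thesis using bernoulli_coupling[of "r k" "r' k"] r[OF k] r'[OF k] down[OF k False] unfolding
        R_def by auto
  qed
  then obtain J where J: "\<And>k. k \<in> I \<Longrightarrow> map_pmf fst (J k) = bernoulli_pmf (r k)"
    "\<And>k. k \<in> I \<Longrightarrow> map_pmf snd (J k) = bernoulli_pmf (r' k)" "\<And>k. k \<in> I \<Longrightarrow> \<forall>z\<in>set_pmf (J k). R k z"
    by metis
  let ?J = "Pi_pmf I (False, False) J"
  have "bern_prod I r = Pi_pmf I False (\<lambda>k. map_pmf fst (J k))"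
    unfolding bern_prod_def using J(1) by (intro Pi_pmf_cong) auto
  also have "\<dots> = map_pmf (\<lambda>h. fst \<circ> h) ?J" by (rule Pi_pmf_map[OF fin]) simp
  finally have b: "bern_prod I r = map_pmf (\<lambda>h. fst \<circ> h) ?J" .
  have "bern_prod I r' = Pi_pmf I False (\<lambda>k. map_pmf snd (J k))"
    unfolding bern_prod_def using J(2) by (intro Pi_pmf_cong) auto
  also have "\<dots> = map_pmf (\<lambda>h. snd \<circ> h) ?J" by (rule Pi_pmf_map[OF fin]) simp
  finally have b': "bern_prod I r' = map_pmf (\<lambda>h. snd \<circ> h) ?J" .
  have "measure_pmf.prob (bern_prod I r') S' = measure_pmf.prob ?J ((\<lambda>h. snd \<circ> h) -` S')"
    unfolding b' by (simp add: measure_map_pmf)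
  also have "\<dots> \<le> measure_pmf.prob ?J ((\<lambda>h. fst \<circ> h) -` S)"
  proof (rule measure_pmf.finite_measure_mono_AE)
    show "AE h in measure_pmf ?J. h \<in> (\<lambda>h. snd \<circ> h) -` S' \<longrightarrow> h \<in> (\<lambda>h. fst \<circ> h) -` S"
    proof (rule AE_pmfI, rule impI)
      fix h assume h: "h \<in> set_pmf ?J" "h \<in> (\<lambda>h. snd \<circ> h) -` S'"
      have RR: "R k (h k)" if "k \<in> I" for k
      proof -
        have "h k \<in> set_pmf (J k)" using h(1) that by (auto simp: set_Pi_pmf[OF fin] PiE_dflt_def)
        then show ?thesis using J(3)[OF that] by auto
      qed
      have "fst \<circ> h \<in> S"
      proof (rule mono[where \<omega> = "fst \<circ> h" and \<omega>' = "snd \<circ> h"])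
        show "snd \<circ> h \<in> S'" using h(2) by simp
        show "(fst \<circ> h) k" if "k \<in> I" "up k" "(snd \<circ> h) k" for k
          using RR[OF that(1)] that unfolding R_def by simp
        show "(snd \<circ> h) k" if "k \<in> I" "\<not> up k" "(fst \<circ> h) k" for k
          using RR[OF that(1)] that unfolding R_def by simp
      qed
      then show "h \<in> (\<lambda>h. fst \<circ> h) -` S" by simp
    qed
  qed simp
  also have "\<dots> = measure_pmf.prob (bern_prod I r) S"
    unfolding b by (simp add: measure_map_pmf)
  finally show ?thesis .
qed

section \<open>Translation between matrices and index functions\<close>

lemma mult_mat_vec_index:
  fixes Y :: "real mat"
  assumes "Y \<in> carrier_mat n n" "v \<in> carrier_vec n" "i < n"
  shows "(Y *\<^sub>v v) $ i = (\<Sum>j<n. Y $$ (i, j) * v $ j)"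
  using assms by (simp add: scalar_prod_def lessThan_atLeast0)

lemma sdp_form_feasible:
  assumes "Y \<in> sdp_feasible n"
  shows "sdp_form n (\<lambda>i j. Y $$ (i, j))"
proof -
  have Y: "Y \<in> carrier_mat n n" "transpose_mat Y = Y" "\<And>x. x \<in> carrier_vec n \<Longrightarrow> 0 \<le> scalar_prod x (Y *\<^sub>v x)"
    and dg: "\<And>i. i < n \<Longrightarrow> Y $$ (i, i) = 1" and sm: "(\<Sum>i<n. \<Sum>j<n. Y $$ (i, j)) = 0"
    using assms unfolding sdp_feasible_def psd_def by auto
  have sym: "Y $$ (i, j) = Y $$ (j, i)" if "i < n" "j < n" for i j
  proof -
    have "transpose_mat Y $$ (i, j) = Y $$ (j, i)" using Y(1) that by auto
    then show ?thesis using Y(2) by simp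
  qed
  have "0 \<le> bil n (\<lambda>i j. Y $$ (i, j)) x x" for x
  proof -
    have "0 \<le> scalar_prod (vec n x) (Y *\<^sub>v vec n x)" by (rule Y(3)) simp
    also have "scalar_prod (vec n x) (Y *\<^sub>v vec n x) = (\<Sum>i<n. x i * (Y *\<^sub>v vec n x) $ i)"
      using Y(1) by (simp add: scalar_prod_def lessThan_atLeast0)
    also have "\<dots> = (\<Sum>i<n. x i * (\<Sum>j<n. Y $$ (i, j) * x j))"
      by (intro sum.cong refl) (simp add: mult_mat_vec_index[OF Y(1)])
    also have "\<dots> = bil n (\<lambda>i j. Y $$ (i, j)) x x"
      unfolding bil_def sum_distrib_left by (intro sum.cong refl) simp
    finally show ?thesis .
  qed
  then show ?thesis unfolding sdp_form_def psd_form_def using sym dg sm by auto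
qed

lemma err_top_eigenvector_le:
  assumes n: "0 < n" and s: "balanced_labels n s" and Y: "Y \<in> sdp_feasible n" and v: "top_eigenvector Y v"
  shows "err n (sign_vec v) s \<le> 4 * (\<Sum>i<n. deflate n (\<lambda>i. s $ i) (\<lambda>i j. Y $$ (i, j)) i i) / n"
proof -
  define y where "y i j = Y $$ (i, j)" for i j
  define \<sigma> where "\<sigma> i = s $ i" for i
  have sc: "s \<in> carrier_vec n" and s1: "\<And>i. i < n \<Longrightarrow> \<sigma> i \<in> {-1, 1}" and s0: "(\<Sum>i<n. \<sigma> i) = 0"
    using s unfolding balanced_labels_def \<sigma>_def by auto
  have yf: "sdp_form n y" unfolding y_def by (rule sdp_form_feasible[OF Y])
  have Yc: "Y \<in> carrier_mat n n" using Y unfolding sdp_feasible_def psd_def by auto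
  obtain l where l: "eigenvector Y v l" "\<And>k. eigenvalue Y k \<Longrightarrow> k \<le> l" using v unfolding top_eigenvector_def by
      auto
  have vc: "v \<in> carrier_vec n" and v0: "v \<noteq> 0\<^sub>v n" and ve: "Y *\<^sub>v v = l \<cdot>\<^sub>v v"
    using l(1) Yc unfolding eigenvector_def by auto
  have eig: "(\<Sum>j<n. y i j * v $ j) = l * v $ i" if "i < n" for i
  proof -
    have "(Y *\<^sub>v v) $ i = l * v $ i" unfolding ve using vc that by simp
    then show ?thesis using mult_mat_vec_index[OF Yc vc that] unfolding y_def by simp
  qed
  have nz: "\<exists>i<n. v $ i \<noteq> 0"
  proof (rule ccontr)
    assume "\<not> (\<exists>i<n. v $ i \<noteq> 0)"
    then have "v = 0\<^sub>v n" using vc by (intro eq_vecI) auto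
    then show False using v0 by simp
  qed
  have ysym: "y i j = y j i" if "i < n" "j < n" for i j
    using yf psd_form_sym that unfolding sdp_form_def by blast
  \<comment> \<open>A maximizer of the Rayleigh quotient. Turning it into an eigenvector of the
    matrix shows \<open>m <= l\<close>, which gives the test of the form at the labels required by
    \<open>top_eigenvector_mismatch\<close>.\<close>
  obtain x m where x: "(\<Sum>i<n. (x i)^2) = 1" "\<And>i. i < n \<Longrightarrow> (\<Sum>j<n. y i j * x j) = m * x i"
    and ray: "\<And>z. bil n y z z \<le> m * (\<Sum>i<n. (z i)^2)"
    using rayleigh_max_exists[of n y, OF ysym n] by blast
  have "eigenvector Y (vec n x) m"
    unfolding eigenvector_def
  proof (intro conjI)
    show "vec n x \<in> carrier_vec (dim_row Y)" using Yc by simp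
    show "vec n x \<noteq> 0\<^sub>v (dim_row Y)"
    proof
      assume "vec n x = 0\<^sub>v (dim_row Y)"
      then have "x i = 0" if "i < n" for i
        using Yc that by (metis carrier_matD(1) index_vec index_zero_vec(1))
      then show False using x(1) by simp
    qed
    show "Y *\<^sub>v vec n x = m \<cdot>\<^sub>v vec n x"
    proof (rule eq_vecI)
      fix i assume "i < dim_vec (m \<cdot>\<^sub>v vec n x)"
      then have i: "i < n" by simp
      have "(Y *\<^sub>v vec n x) $ i = (\<Sum>j<n. Y $$ (i, j) * vec n x $ j)" by (rule mult_mat_vec_index[OF Yc _ i])
          simp
      also have "\<dots> = (\<Sum>j<n. y i j * x j)" unfolding y_def by (intro sum.cong) auto
      finally show "(Y *\<^sub>v vec n x) $ i = (m \<cdot>\<^sub>v vec n x) $ i" using x(2)[OF i] i by simp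
    qed (use Yc in simp)
  qed
  then have ml: "m \<le> l" using l(2) unfolding eigenvalue_def by blast
  have "bil n y \<sigma> \<sigma> \<le> m * (\<Sum>i<n. (\<sigma> i)^2)" by (rule ray)
  also have "\<dots> \<le> l * (\<Sum>i<n. (\<sigma> i)^2)" using ml by (intro mult_right_mono sum_nonneg) auto
  finally have "bil n y \<sigma> \<sigma> \<le> l * (\<Sum>i<n. (\<sigma> i)^2)" .
  from top_eigenvector_mismatch[OF n s1 s0 yf eig nz this]
  obtain g where g: "g \<in> {-1, 1}"
    "real (card {i. i < n \<and> g * (if 0 \<le> v $ i then 1 else -1) \<noteq> \<sigma> i}) \<le> 4 * (\<Sum>i<n. deflate n \<sigma> y i i)" by blast
  have "err n (sign_vec v) s \<le> (1 / real n) * (\<Sum>i<n. of_bool (g * sign_vec v $ i \<noteq> s $ i))"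
    unfolding err_def using g(1) by (intro Min_le) auto
  also have "(\<Sum>i<n. of_bool (g * sign_vec v $ i \<noteq> s $ i)) = real (card {i. i < n \<and> g * (if 0 \<le> v $ i then 1 else
      -1) \<noteq> \<sigma> i})"
  proof -
    have "(\<Sum>i<n. of_bool (g * sign_vec v $ i \<noteq> s $ i) :: real) = (\<Sum>i<n. of_bool (g * (if 0 \<le> v $ i then 1 else
        -1) \<noteq> \<sigma> i))"
      using vc unfolding sign_vec_def \<sigma>_def by (intro sum.cong refl) auto
    also have "\<dots> = real (card ({..<n} \<inter> {i. g * (if 0 \<le> v $ i then 1 else -1) \<noteq> \<sigma> i}))" by simp
    finally show ?thesis by (simp add: Int_def)
  qed
  also have "(1 / real n) * \<dots> \<le> (1 / real n) * (4 * (\<Sum>i<n. deflate n \<sigma> y i i))"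
    using g(2) by (intro mult_left_mono) auto
  finally show ?thesis unfolding y_def \<sigma>_def by simp
qed

lemma l1_deviation_feasible:
  assumes n: "0 < n" and s: "balanced_labels n s" and Y: "Y \<in> sdp_feasible n"
  shows "(1 / real n) * entry_l1_norm n (Y - cluster_mat n s) = (\<Sum>i<n. deflate n (\<lambda>i. s $ i) (\<lambda>i j. Y $$ (i, j))
      i i)"
proof -
  have s1: "\<And>i. i < n \<Longrightarrow> s $ i \<in> {-1, 1}" and s0: "(\<Sum>i<n. s $ i) = 0" using s unfolding balanced_labels_def by
      auto
  have Yc: "Y \<in> carrier_mat n n" using Y unfolding sdp_feasible_def psd_def by auto
  have "entry_l1_norm n (Y - cluster_mat n s) = (\<Sum>i<n. \<Sum>j<n. \<bar>Y $$ (i, j) - s $ i * s $ j\<bar>)"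
    unfolding entry_l1_norm_def cluster_mat_def using Yc by (intro sum.cong refl) auto
  also have "\<dots> = n * (\<Sum>i<n. deflate n (\<lambda>i. s $ i) (\<lambda>i j. Y $$ (i, j)) i i)"
    by (rule sdp_l1[OF n s1 s0 sdp_form_feasible[OF Y]])
  finally show ?thesis using n by simp
qed

text \<open>The difference \<open>Y i j - s i * s j\<close> is nonpositive inside a cluster and
  nonnegative across, because entries of \<open>Y\<close> are between -1 and 1. Removing inside
  edges and adding cross edges can therefore only increase the pairing. Diagonal differences are 0,
  so passing to the graph without loops changes nothing.\<close>

lemma sdp_set_monotone:
  assumes n: "0 < n" and s: "balanced_labels n s" and Y: "Y \<in> sdp_set n s (sym_adj n \<omega>)"
    and up: "\<And>k. k \<in> upper_pairs n \<Longrightarrow> s $ fst k * s $ snd k = 1 \<Longrightarrow> \<omega>' k \<Longrightarrow> \<omega> k"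
    and down: "\<And>k. k \<in> upper_pairs n \<Longrightarrow> s $ fst k * s $ snd k \<noteq> 1 \<Longrightarrow> \<omega> k \<Longrightarrow> \<omega>' k"
  shows "(\<Sum>i<n. \<Sum>j<n. adj \<omega>' i j * (s $ i * s $ j)) \<le> (\<Sum>i<n. \<Sum>j<n. adj \<omega>' i j * Y $$ (i, j))"
proof -
  have s1: "\<And>i. i < n \<Longrightarrow> s $ i \<in> {-1, 1}" and s0: "(\<Sum>i<n. s $ i) = 0" using s unfolding balanced_labels_def by
      auto
  have Yf: "Y \<in> sdp_feasible n" and opt: "frob_inner n (sym_adj n \<omega>) (cluster_mat n s) \<le> frob_inner n (sym_adj n
      \<omega>) Y"
    using Y unfolding sdp_set_def by auto
  note form = sdp_form_feasible[OF Yf]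
  define a where "a i j = sym_adj n \<omega> $$ (i, j)" for i j
  have "0 \<le> (\<Sum>i<n. \<Sum>j<n. a i j * (Y $$ (i, j) - s $ i * s $ j))"
    using opt unfolding frob_inner_def cluster_mat_def a_def by (simp add: right_diff_distrib sum_subtractf)
  also have "\<dots> \<le> (\<Sum>i<n. \<Sum>j<n. adj \<omega>' i j * (Y $$ (i, j) - s $ i * s $ j))"
  proof (intro sum_mono)
    fix i j assume ij: "i \<in> {..<n}" "j \<in> {..<n}"
    let ?k = "(min i j, max i j)"
    have k: "?k \<in> upper_pairs n" using ij by (auto simp: upper_pairs_def min_def max_def)
    have mm: "s $ fst ?k * s $ snd ?k = s $ i * s $ j" by (simp add: min_def max_def)
    have aa: "a i j = of_bool (\<omega> ?k)" unfolding a_def sym_adj_def using ij by simp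
    have ye: "\<bar>Y $$ (i, j)\<bar> \<le> 1" using sdp_entry[OF n s1 s0 form, of i j] ij by simp
    show "a i j * (Y $$ (i, j) - s $ i * s $ j) \<le> adj \<omega>' i j * (Y $$ (i, j) - s $ i * s $ j)"
    proof (cases "i = j")
      case True
      have "Y $$ (i, i) = 1" using Yf ij unfolding sdp_feasible_def by auto
      then show ?thesis using True s1[of i] ij by auto
    next
      case False
      consider (same) "s $ i * s $ j = 1" | (diff) "s $ i * s $ j = -1" using s1[of i] s1[of j] ij by auto
      then show ?thesis
      proof cases
        case same
        have "adj \<omega>' i j \<le> a i j" unfolding aa adj_def using up[OF k] mm same by auto
        then show ?thesis using ye same by (intro mult_right_mono_neg) auto
      next
        case diff
        have "a i j \<le> adj \<omega>' i j" unfolding aa adj_def using down[OF k] mm diff False by auto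
        then show ?thesis using ye diff by (intro mult_right_mono) auto
      qed
    qed
  qed
  finally show ?thesis by (simp add: right_diff_distrib sum_subtractf)
qed

section \<open>Error rates\<close>

definition tilt_const :: "real \<Rightarrow> real \<Rightarrow> real" where
  "tilt_const c0 c1 = (1 / c0 + 1 / c1) / 2"

text \<open>The factor in the bound of \<open>renyi_info\<close> by \<open>(p - q)^2 / p\<close>; in
  particular \<open>n I\<close> is at most this constant times \<open>n p\<close>.\<close>

definition info_const :: "real \<Rightarrow> real" where
  "info_const c1 = (1 + 1 / c1) / c1"

lemma info_const_ge_1:
  assumes "0 < c1" "c1 < 1"
  shows "1 \<le> info_const c1"
proof -
  have "1 \<le> 1 / c1" using assms by simp
  then have "1 * 1 \<le> (1 + 1 / c1) * (1 / c1)" using assms by (intro mult_mono) auto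
  then show ?thesis unfolding info_const_def by simp
qed

text \<open>The coefficient of \<open>sqrt (n I)\<close> lost in the exponent: the first term pays
  for moving the threshold to \<open>2 \<tau>\<close>, the 2 for the fluctuation of the exponential
  sum, and \<open>3 / c1\<close> absorbs a constant prefactor.\<close>

definition rate_const :: "real \<Rightarrow> real \<Rightarrow> real" where
  "rate_const c0 c1 = 4 * tilt_const c0 c1 * (2 * ks_const (9 + info_const c1)) + 2 + 3 / c1"

text \<open>Deterministic: \<open>weighted_threshold_bound\<close> with \<open>l\<close> the
  Chernoff exponent. Besides the size of \<open>Z\<close>, its vanishing alternative is kept for the
  floor. The truncation level \<open>K = 9 + U\<close> leaves \<open>exp (- U d)\<close> after the
  degree sum \<open>exp (9 d)\<close>, and \<open>n I <= U d\<close> makes this no larger than the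
  main term.\<close>

lemma error_on_good_event:
  fixes s :: "real Matrix.vec" and p q c0 c1 :: real
  assumes n: "0 < n" and s: "balanced_labels n s"
    and pq: "0 < c0" "0 < c1" "c0 * p \<le> q" "0 < q" "q < p" "p \<le> 1 - c1"
    and nI: "info_const c1 \<le> n * renyi_info p q"
    and disc: "\<omega> \<in> disc_event n p (2 * exp 2) 80" and light: "\<omega> \<in> light_event n (n * p) (block_prob (\<lambda>i. s $ i)
        p q)"
    and ZS: "(\<Sum>i<n. exp (- chernoff_tilt p q * signed_deg n (\<lambda>i. s $ i) \<omega> i))
       \<le> n * (2 / c1) * exp (2 * sqrt (n * renyi_info p q)) * exp (- (n / 2 * renyi_info p q))"
    and RS: "(\<Sum>i<n. exp (2 * deg n \<omega> i)) \<le> n * exp (9 * (n * p))"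
    and Y: "Y \<in> sdp_feasible n"
    and opt: "(\<Sum>i<n. \<Sum>j<n. adj \<omega> i j * (s $ i * s $ j)) \<le> (\<Sum>i<n. \<Sum>j<n. adj \<omega> i j * Y $$ (i, j))"
  shows "\<exists>Z. 0 \<le> Z \<and> Z \<le> n * exp (rate_const c0 c1 * sqrt (n * renyi_info p q) - n / 2 * renyi_info p q) \<and>
      (\<Sum>i<n. deflate n (\<lambda>i. s $ i) (\<lambda>i j. Y $$ (i, j)) i i) \<le> 16 * Z \<and>
      (Z < 1 \<longrightarrow> (\<Sum>i<n. deflate n (\<lambda>i. s $ i) (\<lambda>i j. Y $$ (i, j)) i i) = 0)"
proof -
  define U where "U = info_const c1"
  define K where "K = 9 + U"
  define L where "L = tilt_const c0 c1"
  define \<kappa> where "\<kappa> = 2 * ks_const K"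
  define d where "d = n * p"
  define \<tau> where "\<tau> = \<kappa> * sqrt d"
  define t where "t = chernoff_tilt p q"
  define I where "I = renyi_info p q"
  define x where "x = sqrt (n * I)"
  define \<sigma> where "\<sigma> = (\<lambda>i. s $ i)"
  define y where "y i j = Y $$ (i, j)" for i j
  define w where "w i = deflate n \<sigma> y i i" for i
  have p01: "0 < p" "p < 1" "c1 < 1" using pq by auto
  have s1: "\<And>i. i < n \<Longrightarrow> \<sigma> i \<in> {-1, 1}" and s0: "(\<Sum>i<n. \<sigma> i) = 0" using s unfolding balanced_labels_def \<sigma>_def by
      auto
  have yf: "sdp_form n y" unfolding y_def by (rule sdp_form_feasible[OF Y])
  have U1: "1 \<le> U" unfolding U_def using pq p01 by (intro info_const_ge_1) auto
  have L0: "0 < L" unfolding L_def tilt_const_def using pq by (simp add: add_pos_pos)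
  have K0: "1 \<le> K" "0 \<le> K" unfolding K_def using U1 by auto
  have kap: "2 \<le> \<kappa>" unfolding \<kappa>_def ks_const_def using K0 by (simp add: add_nonneg_nonneg)
  have nI1: "1 \<le> n * I" using nI U1 unfolding U_def I_def by linarith
  have x1: "1 \<le> x" unfolding x_def using nI1 by simp
  define \<delta> where "\<delta> = (p - q)^2 / p"
  have del: "\<delta> / 4 \<le> I" "I \<le> U * \<delta>"
    unfolding \<delta>_def I_def U_def info_const_def using renyi_info_bounds[OF pq(2,4,5,6)] by auto
  have "\<delta> \<le> p"
  proof -
    have "(p - q)^2 \<le> p^2" using pq by (intro power_mono) auto
    then show ?thesis unfolding \<delta>_def using p01 by (simp add: pos_divide_le_eq power2_eq_square)
  qed
  then have "n * I \<le> n * (U * p)"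
    using del U1 by (intro mult_left_mono order_trans[OF del(2)]) auto
  then have Ud: "n * I \<le> U * d" unfolding d_def by (simp add: ac_simps)
  have d1: "1 \<le> d"
  proof -
    have "U * 1 \<le> U * d" using Ud nI unfolding U_def I_def by linarith
    then show ?thesis using U1 by simp
  qed
  have ratio: "(p - q) / p * sqrt d = sqrt (n * \<delta>)"
  proof -
    have "(p - q) / p * sqrt d = sqrt (((p - q) / p)^2 * d)" using pq p01 by (simp add: real_sqrt_mult)
    also have "((p - q) / p)^2 * d = n * \<delta>" unfolding d_def \<delta>_def using p01 by (simp add: power2_eq_square)
    finally show ?thesis .
  qed
  note tb = chernoff_tilt_bounds[OF pq, folded t_def]
  have t0: "0 < t"
  proof -
    have "0 < (p - q) / (2 * p)" using pq p01 by simp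
    then show ?thesis using tb(1) by linarith
  qed
  have ttau: "2 * t * \<tau> \<le> 4 * L * \<kappa> * x"
  proof -
    have "t * \<tau> \<le> (L * ((p - q) / p)) * \<tau>"
      using tb(2) kap d1 unfolding L_def tilt_const_def \<tau>_def by (intro mult_right_mono) auto
    also have "\<dots> = L * \<kappa> * sqrt (n * \<delta>)" unfolding \<tau>_def ratio[symmetric] by simp
    also have "\<dots> \<le> L * \<kappa> * (2 * x)"
    proof (rule mult_left_mono)
      have "sqrt (n * \<delta>) \<le> sqrt (4 * (n * I))" using mult_left_mono[OF del(1), of "real n"] by (intro
          real_sqrt_le_mono) simp
      then show "sqrt (n * \<delta>) \<le> 2 * x" unfolding x_def by (simp add: real_sqrt_mult)
    qed (use L0 kap in auto)
    finally have "2 * (t * \<tau>) \<le> 2 * (L * \<kappa> * (2 * x))" by (rule mult_left_mono) simp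
    then show ?thesis by (simp add: mult.assoc)
  qed
  \<comment> \<open>The lower bound on \<open>n I\<close> is calibrated for this:
    \<open>n I >= U\<close> gives \<open>n \<delta> >= 1\<close>, and \<open>\<kappa> >= 2\<close>
    compensates the factor 1/2 in the lower bound for \<open>t\<close>.\<close>
  have ttau1: "1 \<le> t * \<tau>"
  proof -
    have "1 \<le> n * \<delta>"
    proof -
      have "U \<le> n * (U * \<delta>)" using nI mult_left_mono[OF del(2), of "real n"] unfolding U_def I_def by linarith
      then have "U * 1 \<le> U * (n * \<delta>)" by (simp add: ac_simps)
      then show ?thesis using U1 by simp
    qed
    then have "2 * 1 \<le> \<kappa> * sqrt (n * \<delta>)" using kap by (intro mult_mono) auto
    also have "\<dots> = 2 * (((p - q) / (2 * p)) * \<tau>)" unfolding \<tau>_def ratio[symmetric] by simp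
    also have "((p - q) / (2 * p)) * \<tau> \<le> t * \<tau>" using tb(1) kap d1 unfolding \<tau>_def by (intro mult_right_mono)
        auto
    finally show ?thesis by simp
  qed
  have pqb: "0 \<le> q" "q \<le> p" "0 \<le> p" using pq by auto
  have rb: "0 \<le> block_prob \<sigma> p q k \<and> block_prob \<sigma> p q k \<le> p" for k
    using pq unfolding block_prob_def by auto
  have tau1: "1 \<le> \<tau>" unfolding \<tau>_def using kap d1 mult_mono[of 1 \<kappa> 1 "sqrt d"] by simp
  have spec: "(\<Sum>i<n. w i * signed_deg n \<sigma> \<omega> i) \<le> \<tau> * (\<Sum>i<n. w i) + 16 * (\<Sum>i<n. if K * d < deg n \<omega> i then deg n \<omega>
      i else 0)"
    unfolding w_def
  proof (rule sdp_spectral_inequality[OF n s1 s0 yf pqb(1,2) d_def K0(1)])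
    show "0 \<le> \<tau>" using tau1 by simp
    show "(\<Sum>i<n. \<Sum>j<n. adj \<omega> i j * (\<sigma> i * \<sigma> j)) \<le> (\<Sum>i<n. \<Sum>j<n. adj \<omega> i j * y i j)"
      using opt unfolding \<sigma>_def y_def .
    fix z :: "nat \<Rightarrow> real" assume z: "\<And>i. i < n \<Longrightarrow> z i \<noteq> 0 \<Longrightarrow> deg n \<omega> i \<le> K * d"
    have "\<bar>\<Sum>i<n. \<Sum>j<n. (adj \<omega> i j - adj_mean (block_prob \<sigma> p q) i j) * (z i * z j)\<bar> \<le> 2 * (ks_const K * sqrt d)
        * (\<Sum>i<n. (z i)^2)"
      by (rule centered_adj_quad_bound[OF rb p01(1) n d_def d1 K0(2) disc])
        (use light z in \<open>auto simp: d_def \<sigma>_def deg_def\<close>)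
    then show "\<bar>\<Sum>i<n. \<Sum>j<n. (adj \<omega> i j - adj_mean (block_prob \<sigma> p q) i j) * (z i * z j)\<bar> \<le> \<tau> * (\<Sum>i<n. (z i)^2)"
      unfolding \<tau>_def \<kappa>_def by (simp add: ac_simps)
  qed
  have w04: "0 \<le> w i \<and> w i \<le> 4" if "i < n" for i
    unfolding w_def using psd_form_diag[OF deflate_psd[OF n s1 s0 yf] that] deflate_diag_le[OF n s1 s0 yf that]
        by auto
  define Z where "Z = exp (2 * t * \<tau>) * (\<Sum>i<n. exp (- t * signed_deg n \<sigma> \<omega> i)) + (\<Sum>i<n. exp (2 * deg n \<omega> i - K *
      d))"
  have Kd: "0 \<le> K * d" using K0 d1 by simp
  note Zb = weighted_threshold_bound[OF w04 t0 ttau1 tau1 Kd spec, folded Z_def]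
  have Z0: "0 \<le> Z" unfolding Z_def by (intro add_nonneg_nonneg mult_nonneg_nonneg sum_nonneg) auto
  define E where "E = exp (- (n / 2 * I))"
  define a where "a = 4 * L * \<kappa> + 2"
  have "exp (2 * t * \<tau>) * (\<Sum>i<n. exp (- t * signed_deg n \<sigma> \<omega> i)) \<le> exp (4 * L * \<kappa> * x) * (n * (2 / c1) * exp (2
      * x) * E)"
    using ttau ZS unfolding t_def \<sigma>_def x_def I_def E_def by (intro mult_mono sum_nonneg) auto
  also have "\<dots> = n * E * (2 / c1 * exp (a * x))"
    unfolding a_def by (simp add: exp_add[symmetric] algebra_simps)
  finally have b1: "exp (2 * t * \<tau>) * (\<Sum>i<n. exp (- t * signed_deg n \<sigma> \<omega> i)) \<le> n * E * (2 / c1 * exp (a * x))" .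
  have "(\<Sum>i<n. exp (2 * deg n \<omega> i - K * d)) = (\<Sum>i<n. exp (2 * deg n \<omega> i)) * exp (- (K * d))"
    unfolding sum_distrib_right by (simp add: exp_add[symmetric])
  also have "\<dots> \<le> n * exp (9 * d) * exp (- (K * d))" using RS unfolding d_def by (intro mult_right_mono) auto
  also have "\<dots> = n * exp (- (U * d))" unfolding K_def by (simp add: exp_add[symmetric] algebra_simps)
  \<comment> \<open>The excess degrees decay like \<open>exp (- n I)\<close>, while the main term
    allows \<open>exp (- n I / 2)\<close>.\<close>
  also have "\<dots> \<le> n * E * 1" unfolding E_def using Ud nI1 by (simp add: mult_left_mono)
  finally have b2: "(\<Sum>i<n. exp (2 * deg n \<omega> i - K * d)) \<le> n * E * 1" .
  have a0: "0 \<le> a * x" unfolding a_def using L0 kap x1 by simp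
  have "Z \<le> n * E * (2 / c1 * exp (a * x) + 1)" unfolding Z_def distrib_left by (rule add_mono[OF b1 b2])
  also have "\<dots> \<le> n * E * (3 / c1 * exp (a * x))"
  proof (rule mult_left_mono)
    have "1 \<le> 1 / c1" using pq p01 by simp
    then have "1 * 1 \<le> 1 / c1 * exp (a * x)" using a0 pq by (intro mult_mono) auto
    then show "2 / c1 * exp (a * x) + 1 \<le> 3 / c1 * exp (a * x)" by (simp add: field_simps)
  qed (simp add: E_def)
  \<comment> \<open>As \<open>x >= 1\<close>, the prefactor \<open>3 / c1\<close> can be hidden in
    \<open>exp (3 / c1 * x)\<close>.\<close>
  also have "\<dots> \<le> n * E * (exp (3 / c1 * x) * exp (a * x))"
  proof (intro mult_left_mono mult_right_mono)
    have "3 / c1 \<le> exp (3 / c1)" using exp_ge_add_one_self[of "3 / c1"] by linarith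
    also have "\<dots> \<le> exp (3 / c1 * x)" using x1 pq by (simp add: divide_right_mono)
    finally show "3 / c1 \<le> exp (3 / c1 * x)" .
  qed (simp_all add: E_def)
  also have "\<dots> = n * exp (rate_const c0 c1 * x - n / 2 * I)"
    unfolding E_def a_def rate_const_def L_def[symmetric] U_def[symmetric] K_def[symmetric] \<kappa>_def[symmetric]
    by (simp add: exp_add[symmetric] algebra_simps)
  finally have "Z \<le> n * exp (rate_const c0 c1 * x - n / 2 * I)" .
  then show ?thesis using Z0 Zb unfolding x_def I_def w_def \<sigma>_def y_def by blast
qed


text \<open>The constant 12 leaves a factor 64 of slack: either \<open>Z < 1\<close> and the error vanishes, or the
floor loses at most a factor 2.\<close>

lemma error_rates:
  fixes N Z I C :: real
  assumes n: "0 < n" and nI: "1 \<le> n * I" and C: "0 \<le> C"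
    and Z: "0 \<le> Z" "Z \<le> n * exp (C * sqrt (n * I) - n / 2 * I)" and N: "N \<le> 16 * Z" "Z < 1 \<longrightarrow> N = 0"
  shows "N \<le> of_int \<lfloor>real n * exp (- ((1 - (2 * C + 12) * sqrt (1 / (real n * I))) * (real n / 2) * I))\<rfloor>"
    and "4 * N / n \<le> exp (- ((1 - (2 * C + 12) * sqrt (1 / (real n * I))) * (real n / 2) * I))"
proof -
  define x where "x = sqrt (n * I)"
  have x: "1 \<le> x" "x * x = n * I" unfolding x_def using nI by auto
  define B where "B = exp (- ((1 - (2 * C + 12) * sqrt (1 / (real n * I))) * (real n / 2) * I))"
  have "sqrt (1 / (n * I)) = 1 / x" unfolding x_def by (simp add: real_sqrt_divide)
  then have "- ((1 - (2 * C + 12) * sqrt (1 / (real n * I))) * (real n / 2) * I) = - ((1 - (2 * C + 12) * (1 /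
      x)) * (n * I)) / 2"
    by simp
  also have "\<dots> = 6 * x + (C * x - n / 2 * I)"
    unfolding x(2)[symmetric] using x(1) by (simp add: field_simps) (simp add: x(2))
  finally have Beq: "B = exp (6 * x) * exp (C * x - n / 2 * I)" unfolding B_def by (simp only: exp_add)
  have "64 \<le> exp (6 * x)"
  proof -
    have "2 \<le> exp (1::real)" using exp_ge_add_one_self[of 1] by simp
    then have "2^6 \<le> exp (1::real)^6" by (intro power_mono) auto
    also have "\<dots> = exp (6 * 1)" by (simp add: exp_of_nat_mult[symmetric])
    also have "\<dots> \<le> exp (6 * x)" using x by simp
    finally show ?thesis by simp
  qed
  then have "64 * exp (C * x - n / 2 * I) \<le> B" unfolding Beq by (intro mult_right_mono) auto
  then have "n * (64 * exp (C * x - n / 2 * I)) \<le> n * B" by (intro mult_left_mono) auto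
  then have BZ: "64 * Z \<le> n * B" using Z(2) unfolding x_def by linarith
  have B0: "0 \<le> n * B" unfolding B_def by simp
  show "N \<le> of_int \<lfloor>real n * exp (- ((1 - (2 * C + 12) * sqrt (1 / (real n * I))) * (real n / 2) * I))\<rfloor>"
    unfolding B_def[symmetric]
  proof (cases "Z < 1")
    case True
    then show "N \<le> of_int \<lfloor>n * B\<rfloor>" using N B0 by simp
  next
    case False
    \<comment> \<open>Here \<open>Z >= 1\<close>, so \<open>n * B >= 64\<close>, while
      \<open>N <= 16 Z <= n * B / 4\<close>: the unit lost by the floor is covered.\<close>
    have "n * B - 1 \<le> of_int \<lfloor>n * B\<rfloor>" by linarith
    then show "N \<le> of_int \<lfloor>n * B\<rfloor>" using False N BZ by linarith
  qed
  have "4 * N \<le> B * n" using N BZ by (simp add: mult.commute)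
  then show "4 * N / n \<le> exp (- ((1 - (2 * C + 12) * sqrt (1 / (real n * I))) * (real n / 2) * I))"
    unfolding B_def[symmetric] using n by (simp add: pos_divide_le_eq)
qed

lemma eventually_tail_bounds:
  fixes c A :: real
  assumes "0 < c" "0 < A"
  shows "eventually (\<lambda>n::nat. 1 / (c * sqrt n) + A * (ln n / n) \<le> exp (- sqrt (ln n))
    \<and> exp (80 * sqrt (ln n)) / n + 64 * sqrt (ln n) * exp (16 * sqrt (ln n)) / n \<le> exp (- sqrt (ln n))
    \<and> 3 / n \<le> 8 * exp (- sqrt (ln n))) sequentially"
proof (intro eventually_conj)
  show "eventually (\<lambda>n::nat. 1 / (c * sqrt n) + A * (ln n / n) \<le> exp (- sqrt (ln n))) sequentially"
    using assms by real_asymp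
  show "eventually (\<lambda>n::nat. exp (80 * sqrt (ln n)) / n + 64 * sqrt (ln n) * exp (16 * sqrt (ln n)) / n \<le> exp (-
      sqrt (ln n))) sequentially"
    by real_asymp
  show "eventually (\<lambda>n::nat. 3 / n \<le> 8 * exp (- sqrt (ln n))) sequentially"
    by real_asymp
qed


text \<open>The two noise events fail with probability at most
  \<open>3 / n <= 8 * exp (- sqrt (ln n))\<close>, and each exponential sum contributes
  \<open>exp (- sqrt (ln n))\<close>; this is the origin of the constant 10.\<close>

lemma prob_good_event:
  fixes \<sigma> :: "nat \<Rightarrow> real" and p q c0 c1 :: real
  assumes n: "0 < n" and s: "\<And>i. i < n \<Longrightarrow> \<sigma> i \<in> {-1, 1}" "(\<Sum>i<n. \<sigma> i) = 0"
    and pq: "0 < c0" "0 < c1" "c0 * p \<le> q" "0 < q" "q < p" "p \<le> 1 - c1" and d1: "1 \<le> n * p"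
    and ev: "1 / (c1 * sqrt n) + 2 * (tilt_const c0 c1)^2 / c1^2 * (ln n / n) \<le> exp (- sqrt (ln n))"
      "exp (80 * sqrt (ln n)) / n + 64 * sqrt (ln n) * exp (16 * sqrt (ln n)) / n \<le> exp (- sqrt (ln n))"
      "3 / n \<le> 8 * exp (- sqrt (ln n))"
  shows "1 - 10 * exp (- sqrt (ln n)) \<le> measure_pmf.prob (bern_prod (upper_pairs n) (block_prob \<sigma> p q))
    (disc_event n p (2 * exp 2) 80 \<inter> light_event n (n * p) (block_prob \<sigma> p q)
     \<inter> {\<omega>. (\<Sum>i<n. exp (- chernoff_tilt p q * signed_deg n \<sigma> \<omega> i))
       \<le> n * (2 / c1) * exp (2 * sqrt (n * renyi_info p q)) * exp (- (n / 2 * renyi_info p q))}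
     \<inter> {\<omega>. (\<Sum>i<n. exp (2 * deg n \<omega> i)) \<le> n * exp (9 * (n * p))})"
    (is "_ \<le> measure_pmf.prob ?M (?D \<inter> ?L \<inter> {\<omega>. ?F \<omega> \<le> ?f} \<inter> {\<omega>. ?G \<omega> \<le> ?g})")
proof -
  have p01: "0 < p" "p \<le> 1" "0 \<le> p" using pq by auto
  have rb: "0 \<le> block_prob \<sigma> p q k \<and> block_prob \<sigma> p q k \<le> p" for k
    using pq unfolding block_prob_def by auto
  let ?E = "?D \<inter> ?L \<inter> {\<omega>. ?F \<omega> \<le> ?f} \<inter> {\<omega>. ?G \<omega> \<le> ?g}"
  have "- ?E \<subseteq> (- ?D \<union> - ?L) \<union> ({\<omega>. ?f \<le> ?F \<omega>} \<union> {\<omega>. ?g \<le> ?G \<omega>})" by auto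
  then have "measure_pmf.prob ?M (- ?E) \<le> measure_pmf.prob ?M ((- ?D \<union> - ?L) \<union> ({\<omega>. ?f \<le> ?F \<omega>} \<union> {\<omega>. ?g \<le> ?G
      \<omega>}))"
    by (rule measure_pmf.finite_measure_mono) simp
  also have "\<dots> \<le> (measure_pmf.prob ?M (- ?D) + measure_pmf.prob ?M (- ?L)) + (measure_pmf.prob ?M {\<omega>. ?f \<le> ?F \<omega>}
      + measure_pmf.prob ?M {\<omega>. ?g \<le> ?G \<omega>})"
    by (intro order_trans[OF measure_Un_le] add_mono measure_Un_le) auto
  also have "\<dots> \<le> (1 / n + 2 / n) + (exp (- sqrt (ln n)) + exp (- sqrt (ln n)))"
  proof (intro add_mono)
    show "measure_pmf.prob ?M (- ?D) \<le> 1 / n" by (rule prob_disc_event[OF rb p01(1,2) n])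
    show "measure_pmf.prob ?M (- ?L) \<le> 2 / n" by (rule prob_light_event[OF rb p01(1,2) n refl])
    show "measure_pmf.prob ?M {\<omega>. ?f \<le> ?F \<omega>} \<le> exp (- sqrt (ln n))"
      by (rule prob_signed_deg_sum[OF n s pq ev(1)[unfolded tilt_const_def]])
    show "measure_pmf.prob ?M {\<omega>. ?g \<le> ?G \<omega>} \<le> exp (- sqrt (ln n))"
      by (rule prob_exp_deg_sum[OF n rb p01(3,2) refl d1 ev(2)])
  qed
  also have "\<dots> \<le> 10 * exp (- sqrt (ln n))" using ev(3) by simp
  finally have "measure_pmf.prob ?M (- ?E) \<le> 10 * exp (- sqrt (ln n))" .
  moreover have "measure_pmf.prob ?M (- ?E) = 1 - measure_pmf.prob ?M ?E"
    using measure_pmf.prob_compl[of ?E ?M] by (simp add: Compl_eq_Diff_UNIV)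
  ultimately show ?thesis by linarith
qed

section \<open>Assembly of the finite and the asymptotic statement\<close>

definition rates_hold :: "nat \<Rightarrow> real Matrix.vec \<Rightarrow> real \<Rightarrow> real \<Rightarrow> real \<Rightarrow> real \<Rightarrow> real mat set" where
  "rates_hold n s p q e e' = {A. \<forall>Y \<in> sdp_set n s A.
     (1 / real n) * entry_l1_norm n (Y - cluster_mat n s)
       \<le> of_int \<lfloor>real n * exp (- ((1 - e) * (real n / 2) * renyi_info p q))\<rfloor> \<and>
     (\<forall>v. top_eigenvector Y v \<longrightarrow> err n (sign_vec v) s \<le> exp (- ((1 - e') * (real n / 2) * renyi_info p q)))}"

lemma sdp_rates_with_high_probability:
  fixes c0 c1 :: real
  assumes c: "0 < c0" "c0 < 1" "0 < c1" "c1 < 1"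
  shows "\<exists>C_I C_e :: real. 0 < C_I \<and> 0 < C_e \<and>
       (\<forall>(n :: nat) (s :: real Matrix.vec) (p :: real) (q :: real) P Q.
          hsbm_params n s p q P Q \<and>
          0 < c0 * p \<and> c0 * p \<le> q \<and> q < p \<and> p \<le> 1 - c1 \<and>
          C_I \<le> real n * renyi_info p q \<longrightarrow>
          measure_pmf.prob (hsbm n s P Q)
            (rates_hold n s p q (C_e * sqrt (1 / (real n * renyi_info p q))) (C_e * sqrt (1 / (real n *
                renyi_info p q))))
          \<ge> 1 - 10 * exp (- sqrt (ln (real n))))"
proof -
  have T0: "0 < tilt_const c0 c1" unfolding tilt_const_def using c by (simp add: add_pos_pos)
  have "0 < 2 * (tilt_const c0 c1)^2 / c1^2" using T0 c by simp
  from eventually_tail_bounds[OF c(3) this] obtain n0 :: nat where n0: "\<And>n::nat. n0 \<le> n \<Longrightarrow>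
     1 / (c1 * sqrt n) + 2 * (tilt_const c0 c1)^2 / c1^2 * (ln n / n) \<le> exp (- sqrt (ln n))
    \<and> exp (80 * sqrt (ln n)) / n + 64 * sqrt (ln n) * exp (16 * sqrt (ln n)) / n \<le> exp (- sqrt (ln n))
    \<and> 3 / n \<le> 8 * exp (- sqrt (ln n))"
    unfolding eventually_sequentially by blast
  define C where "C = rate_const c0 c1"
  define U where "U = info_const c1"
  have U1: "1 \<le> U" unfolding U_def using c by (intro info_const_ge_1) auto
  have C0: "0 \<le> C"
    unfolding C_def rate_const_def ks_const_def U_def[symmetric] using T0 U1 c by (intro add_nonneg_nonneg
        mult_nonneg_nonneg) auto
  \<comment> \<open>An absolute upper bound for the divergence, since the Bhattacharyya coefficient
    is at least \<open>c1\<close>. Requiring \<open>n I >= n0 * J\<close> thus forces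
    \<open>n >= n0\<close>, which turns the asymptotic tail estimates into a condition on
    \<open>n I\<close> alone.\<close>
  define J where "J = 1 - 2 * ln c1"
  have J1: "1 \<le> J" unfolding J_def using c by simp
  define CI where "CI = U + n0 * J"
  have CI0: "0 < CI" unfolding CI_def using U1 J1 by (simp add: add_pos_nonneg)
  show ?thesis
  proof (rule exI[of _ CI], rule exI[of _ "2 * C + 12"], intro conjI allI impI)
    show "0 < CI" by fact
    show "0 < 2 * C + 12" using C0 by simp
    fix n s p q P Q
    assume h: "hsbm_params n s p q P Q \<and> 0 < c0 * p \<and> c0 * p \<le> q \<and> q < p \<and> p \<le> 1 - c1 \<and> CI \<le> real n * renyi_info
        p q"
    have s: "balanced_labels n s" using h unfolding hsbm_params_def by auto
    have p0: "0 < p" using h c by (simp add: zero_less_mult_iff)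
    have pq: "0 < c0" "0 < c1" "c0 * p \<le> q" "0 < q" "q < p" "p \<le> 1 - c1" using h c by auto
    have CI: "CI \<le> real n * renyi_info p q" using h by auto
    have n: "0 < n" using CI CI0 by (cases n) auto
    have I: "renyi_info p q \<le> J"
    proof -
      have p1: "p < 1" using pq by simp
      define S where "S = sqrt (p * q) + sqrt ((1 - p) * (1 - q))"
      have "c1 \<le> S" unfolding S_def using bhattacharyya_bounds(2)[OF pq(4,5) p1] pq by linarith
      then have "ln c1 \<le> ln S" using c by simp
      then show ?thesis unfolding renyi_info_def S_def[symmetric] J_def by simp
    qed
    have "n0 * J \<le> real n * renyi_info p q" using CI U1 unfolding CI_def by linarith
    also have "\<dots> \<le> real n * J" using I by (intro mult_left_mono) auto
    finally have "n0 \<le> n" using J1 by (simp add: mult_le_cancel_right)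
    note ev = n0[OF this]
    have UI: "U \<le> real n * renyi_info p q"
    proof -
      have "0 \<le> n0 * J" using J1 by simp
      then show ?thesis using CI unfolding CI_def by linarith
    qed
    have nI1: "1 \<le> real n * renyi_info p q" using UI U1 by linarith
    have d1: "1 \<le> n * p"
    proof -
      have "renyi_info p q \<le> U * ((p - q)^2 / p)" unfolding U_def info_const_def by (rule
          renyi_info_bounds(2)[OF pq(2,4,5,6)])
      also have "\<dots> \<le> U * p"
      proof (rule mult_left_mono)
        have "(p - q)^2 \<le> p^2" using pq by (intro power_mono) auto
        then show "(p - q)^2 / p \<le> p" using p0 by (simp add: pos_divide_le_eq power2_eq_square)
      qed (use U1 in simp)
      finally have "n * renyi_info p q \<le> n * (U * p)" by (intro mult_left_mono) auto
      then have "U * 1 \<le> U * (n * p)" using UI by (simp add: ac_simps)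
      then show ?thesis using U1 by simp
    qed
    define \<epsilon> where "\<epsilon> = (2 * C + 12) * sqrt (1 / (real n * renyi_info p q))"
    define \<sigma> where "\<sigma> = (\<lambda>i. s $ i)"
    have s1: "\<And>i. i < n \<Longrightarrow> \<sigma> i \<in> {-1, 1}" "(\<Sum>i<n. \<sigma> i) = 0" using s unfolding balanced_labels_def \<sigma>_def by auto
    define Good where "Good = disc_event n p (2 * exp 2) 80 \<inter> light_event n (n * p) (block_prob \<sigma> p q)
     \<inter> {\<omega>. (\<Sum>i<n. exp (- chernoff_tilt p q * signed_deg n \<sigma> \<omega> i))
       \<le> n * (2 / c1) * exp (2 * sqrt (n * renyi_info p q)) * exp (- (n / 2 * renyi_info p q))}
     \<inter> {\<omega>. (\<Sum>i<n. exp (2 * deg n \<omega> i)) \<le> n * exp (9 * (n * p))}"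
    have "1 - 10 * exp (- sqrt (ln n)) \<le> measure_pmf.prob (bern_prod (upper_pairs n) (block_prob \<sigma> p q)) Good"
      unfolding Good_def using ev by (intro prob_good_event[OF n s1 pq d1]) auto
    also have "\<dots> \<le> measure_pmf.prob (bern_prod (upper_pairs n) (edge_prob s P Q))
      (sym_adj n -` rates_hold n s p q \<epsilon> \<epsilon>)"
    proof (rule prob_bern_prod_coupling[OF finite_upper_pairs, where up = "\<lambda>k. s $ fst k * s $ snd k = 1"])
      fix k assume k: "k \<in> upper_pairs n"
      have par: "0 \<le> Q (fst k) (snd k)" "Q (fst k) (snd k) \<le> q" "p \<le> P (fst k) (snd k)" "P (fst k) (snd k) \<le> 1"
        using h k unfolding hsbm_params_def upper_pairs_def by auto
      have e: "edge_prob s P Q k = (if s $ fst k * s $ snd k = 1 then P (fst k) (snd k) else Q (fst k) (snd k))"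
        unfolding edge_prob_def by (simp add: case_prod_beta)
      show "0 \<le> edge_prob s P Q k \<and> edge_prob s P Q k \<le> 1" unfolding e using par p0 pq by auto
      show "0 \<le> block_prob \<sigma> p q k \<and> block_prob \<sigma> p q k \<le> 1" unfolding block_prob_def using p0 pq by auto
      show "block_prob \<sigma> p q k \<le> edge_prob s P Q k" if "s $ fst k * s $ snd k = 1"
        unfolding e block_prob_def \<sigma>_def using that par by simp
      show "edge_prob s P Q k \<le> block_prob \<sigma> p q k" if "s $ fst k * s $ snd k \<noteq> 1"
        unfolding e block_prob_def \<sigma>_def using that par by simp
    next
      fix \<omega> \<omega>'
      assume up: "\<And>k. k \<in> upper_pairs n \<Longrightarrow> s $ fst k * s $ snd k = 1 \<Longrightarrow> \<omega>' k \<Longrightarrow> \<omega> k"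
        and down: "\<And>k. k \<in> upper_pairs n \<Longrightarrow> s $ fst k * s $ snd k \<noteq> 1 \<Longrightarrow> \<omega> k \<Longrightarrow> \<omega>' k"
        and good: "\<omega>' \<in> Good"
      have "sym_adj n \<omega> \<in> rates_hold n s p q \<epsilon> \<epsilon>"
        unfolding rates_hold_def
      proof (intro CollectI ballI)
        fix Y assume Y: "Y \<in> sdp_set n s (sym_adj n \<omega>)"
        then have Yf: "Y \<in> sdp_feasible n" unfolding sdp_set_def by auto
        have opt: "(\<Sum>i<n. \<Sum>j<n. adj \<omega>' i j * (s $ i * s $ j)) \<le> (\<Sum>i<n. \<Sum>j<n. adj \<omega>' i j * Y $$ (i, j))"
          by (rule sdp_set_monotone[OF n s Y up down])
        define N where "N = (\<Sum>i<n. deflate n (\<lambda>i. s $ i) (\<lambda>i j. Y $$ (i, j)) i i)"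
        have "\<exists>Z. 0 \<le> Z \<and> Z \<le> n * exp (C * sqrt (n * renyi_info p q) - n / 2 * renyi_info p q) \<and> N \<le> 16 * Z \<and> (Z
            < 1 \<longrightarrow> N = 0)"
          unfolding N_def C_def
          by (rule error_on_good_event[OF n s pq UI[unfolded U_def] _ _ _ _ Yf opt])
            (use good in \<open>auto simp: Good_def \<sigma>_def\<close>)
        then obtain Z where Z: "0 \<le> Z" "Z \<le> n * exp (C * sqrt (n * renyi_info p q) - n / 2 * renyi_info p q)" "N
            \<le> 16 * Z" "Z < 1 \<longrightarrow> N = 0"
          by blast
        note R = error_rates[OF n nI1 C0 Z, folded \<epsilon>_def]
        show "(1 / real n) * entry_l1_norm n (Y - cluster_mat n s)
          \<le> of_int \<lfloor>real n * exp (- ((1 - \<epsilon>) * (real n / 2) * renyi_info p q))\<rfloor> \<and>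
          (\<forall>v. top_eigenvector Y v \<longrightarrow> err n (sign_vec v) s \<le> exp (- ((1 - \<epsilon>) * (real n / 2) * renyi_info p q)))"
        proof (intro conjI allI impI)
          show "(1 / real n) * entry_l1_norm n (Y - cluster_mat n s)
            \<le> of_int \<lfloor>real n * exp (- ((1 - \<epsilon>) * (real n / 2) * renyi_info p q))\<rfloor>"
            unfolding l1_deviation_feasible[OF n s Yf] N_def[symmetric] by (rule R(1))
          fix v assume v: "top_eigenvector Y v"
          have "err n (sign_vec v) s \<le> 4 * N / n" unfolding N_def by (rule err_top_eigenvector_le[OF n s Yf v])
          then show "err n (sign_vec v) s \<le> exp (- ((1 - \<epsilon>) * (real n / 2) * renyi_info p q))"
            using R(2) by linarith
        qed
      qed
      then show "\<omega> \<in> sym_adj n -` rates_hold n s p q \<epsilon> \<epsilon>"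
        by simp
    qed
    also have "\<dots> = measure_pmf.prob (hsbm n s P Q)
      (rates_hold n s p q \<epsilon> \<epsilon>)"
      unfolding hsbm_def bern_prod_def by (simp add: measure_map_pmf)
    finally show "1 - 10 * exp (- sqrt (ln (real n))) \<le> measure_pmf.prob (hsbm n s P Q)
      (rates_hold n s p q ((2 * C + 12) * sqrt (1 / (real n * renyi_info p q))) ((2 * C + 12) * sqrt (1 / (real
          n * renyi_info p q))))"
      unfolding \<epsilon>_def .
  qed
qed

text \<open>Balanced labels exist only for even \<open>n\<close>, so the divergence of
  \<open>n I\<close> is known along even \<open>n\<close>, whereas the error sequences must tend to
  0 along all \<open>n\<close>. They are set to 0 at odd indices.\<close>

lemma vanishing_on_even:
  fixes f :: "nat \<Rightarrow> real" and g :: "real \<Rightarrow> real"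
  assumes f: "filterlim f at_top (inf sequentially (principal {n. even n}))" and g: "(g \<longlongrightarrow> 0) at_top"
    and h: "\<And>n. odd n \<Longrightarrow> h n = 0" "\<And>n. even n \<Longrightarrow> C \<le> f n \<Longrightarrow> h n = g (f n)"
  shows "h \<longlonglongrightarrow> 0"
proof (rule tendstoI)
  fix \<epsilon> :: real assume eps: "0 < \<epsilon>"
  have "((\<lambda>n. g (f n)) \<longlongrightarrow> 0) (inf sequentially (principal {n. even n}))"
    by (rule filterlim_compose[OF g f])
  then have "eventually (\<lambda>n. dist (g (f n)) 0 < \<epsilon>) (inf sequentially (principal {n. even n}))"
    using eps by (rule tendstoD)
  moreover have "eventually (\<lambda>n. C \<le> f n) (inf sequentially (principal {n. even n}))"
    using f unfolding filterlim_at_top by blast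
  ultimately have "eventually (\<lambda>n. dist (h n) 0 < \<epsilon>) (inf sequentially (principal {n. even n}))"
    unfolding eventually_inf_principal by eventually_elim (auto simp: h)
  then show "eventually (\<lambda>n. dist (h n) 0 < \<epsilon>) sequentially"
    unfolding eventually_inf_principal
  proof eventually_elim
    case (elim n)
    then show ?case using h(1)[of n] eps by (cases "even n") auto
  qed
qed

text \<open>The finite bound is applied at each even \<open>n\<close> with \<open>n I >= CI\<close>,
  giving \<open>e n\<close> of order \<open>1 / sqrt (n I)\<close>. At the other even indices
  \<open>d n = 1\<close> makes the claim trivial; these stop occurring eventually.\<close>

lemma sdp_rates_asymptotic:
  fixes c0 c1 :: real and s :: "nat \<Rightarrow> real Matrix.vec" and p q :: "nat \<Rightarrow> real" and P Q :: "nat \<Rightarrow> nat \<Rightarrow> nat \<Rightarrow>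
      real"
  assumes c: "0 < c0" "c0 < 1" "0 < c1" "c1 < 1"
    and par: "\<And>n. 0 < n \<Longrightarrow> even n \<Longrightarrow> hsbm_params n (s n) (p n) (q n) (P n) (Q n) \<and>
           0 < c0 * p n \<and> c0 * p n \<le> q n \<and> q n < p n \<and> p n \<le> 1 - c1"
    and lim: "filterlim (\<lambda>n. real n * renyi_info (p n) (q n)) at_top (inf sequentially (principal {n. even n}))"
  shows "\<exists>d e :: nat \<Rightarrow> real. d \<longlonglongrightarrow> 0 \<and> e \<longlonglongrightarrow> 0 \<and> (\<forall>n. 0 < n \<and> even n \<longrightarrow>
    1 - d n \<le> measure_pmf.prob (hsbm n (s n) (P n) (Q n)) (rates_hold n (s n) (p n) (q n) (e n) (e n)))"
proof -
  obtain CI Ce where "0 < CI" "0 < Ce" and *: "\<forall>(n :: nat) (s :: real Matrix.vec) (p :: real) (q :: real) P Q.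
          hsbm_params n s p q P Q \<and> 0 < c0 * p \<and> c0 * p \<le> q \<and> q < p \<and> p \<le> 1 - c1 \<and> CI \<le> real n * renyi_info p q
              \<longrightarrow>
          measure_pmf.prob (hsbm n s P Q)
            (rates_hold n s p q (Ce * sqrt (1 / (real n * renyi_info p q))) (Ce * sqrt (1 / (real n * renyi_info
                p q))))
          \<ge> 1 - 10 * exp (- sqrt (ln (real n)))"
    using sdp_rates_with_high_probability[OF c] by blast
  define f where "f n = real n * renyi_info (p n) (q n)" for n
  define e where "e n = (if even n \<and> CI \<le> f n then Ce * sqrt (1 / f n) else 0)" for n
  define d where "d n = (if odd n then 0 else if CI \<le> f n then 10 * exp (- sqrt (ln (real n))) else 1)" for n
  have e_lim: "e \<longlonglongrightarrow> 0"
  proof (rule vanishing_on_even[OF lim[folded f_def], where g = "\<lambda>x. Ce * sqrt (1 / x)" and C = CI])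
    show "((\<lambda>x. Ce * sqrt (1 / x)) \<longlongrightarrow> 0) at_top" by real_asymp
  qed (auto simp: e_def)
  have d_lim: "d \<longlonglongrightarrow> 0"
  proof (rule tendstoI)
    fix \<epsilon> :: real assume eps: "0 < \<epsilon>"
    have "(\<lambda>n::nat. 10 * exp (- sqrt (ln (real n)))) \<longlonglongrightarrow> 0" by real_asymp
    from tendstoD[OF this eps] have "eventually (\<lambda>n. dist (10 * exp (- sqrt (ln (real n)))) 0 < \<epsilon>) sequentially"
        .
    moreover have "eventually (\<lambda>n. even n \<longrightarrow> CI \<le> f n) sequentially"
      using lim unfolding filterlim_at_top f_def[symmetric] eventually_inf_principal by auto
    ultimately show "eventually (\<lambda>n. dist (d n) 0 < \<epsilon>) sequentially"
      by eventually_elim (use eps in \<open>auto simp: d_def\<close>)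
  qed
  have "1 - d n \<le> measure_pmf.prob (hsbm n (s n) (P n) (Q n)) (rates_hold n (s n) (p n) (q n) (e n) (e n))"
    if n: "0 < n" "even n" for n
  proof (cases "CI \<le> f n")
    case True
    then show ?thesis using *[rule_format, of n "s n" "p n" "q n" "P n" "Q n"] par[OF n] n
      unfolding d_def e_def f_def by simp
  next
    case False
    then show ?thesis using n unfolding d_def by simp
  qed
  with d_lim e_lim show ?thesis by blast
qed

theorem corollary2:
  shows
  "(\<forall>c0 c1 :: real. 0 < c0 \<and> c0 < 1 \<and> 0 < c1 \<and> c1 < 1 \<longrightarrow>
     (\<exists>C_I C_e C_e' :: real. 0 < C_I \<and> 0 < C_e \<and> 0 < C_e' \<and>
       (\<forall>(n :: nat) (s :: real Matrix.vec) (p :: real) (q :: real) P Q.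
          hsbm_params n s p q P Q \<and>
          0 < c0 * p \<and> c0 * p \<le> q \<and> q < p \<and> p \<le> 1 - c1 \<and>
          C_I \<le> real n * renyi_info p q \<longrightarrow>
          measure_pmf.prob (hsbm n s P Q)
            {A. \<forall>Y \<in> sdp_set n s A.
               (1 / real n) * entry_l1_norm n (Y - cluster_mat n s)
                 \<le> of_int \<lfloor>real n * exp (- ((1 - C_e * sqrt (1 / (real n * renyi_info p q)))
                              * (real n / 2) * renyi_info p q))\<rfloor> \<and>
               (\<forall>v. top_eigenvector Y v \<longrightarrow>
                  err n (sign_vec v) s
                    \<le> exp (- ((1 - C_e' * sqrt (1 / (real n * renyi_info p q)))
                              * (real n / 2) * renyi_info p q)))}
          \<ge> 1 - 10 * exp (- sqrt (ln (real n))))))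
   \<and>
   (\<forall>c0 c1 :: real. 0 < c0 \<and> c0 < 1 \<and> 0 < c1 \<and> c1 < 1 \<longrightarrow>
     (\<forall>(s :: nat \<Rightarrow> real Matrix.vec) (p :: nat \<Rightarrow> real) (q :: nat \<Rightarrow> real)
        (P :: nat \<Rightarrow> nat \<Rightarrow> nat \<Rightarrow> real) (Q :: nat \<Rightarrow> nat \<Rightarrow> nat \<Rightarrow> real).
        (\<forall>n. 0 < n \<and> even n \<longrightarrow>
           hsbm_params n (s n) (p n) (q n) (P n) (Q n) \<and>
           0 < c0 * p n \<and> c0 * p n \<le> q n \<and> q n < p n \<and> p n \<le> 1 - c1) \<and>
        filterlim (\<lambda>n. real n * renyi_info (p n) (q n)) at_top
          (inf sequentially (principal {n. even n})) \<longrightarrow>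
        (\<exists>d e e' :: nat \<Rightarrow> real. d \<longlonglongrightarrow> 0 \<and> e \<longlonglongrightarrow> 0 \<and> e' \<longlonglongrightarrow> 0 \<and>
          (\<forall>n. 0 < n \<and> even n \<longrightarrow>
            measure_pmf.prob (hsbm n (s n) (P n) (Q n))
              {A. \<forall>Y \<in> sdp_set n (s n) A.
                 (1 / real n) * entry_l1_norm n (Y - cluster_mat n (s n))
                   \<le> of_int \<lfloor>real n * exp (- ((1 - e n) * (real n / 2)
                                * renyi_info (p n) (q n)))\<rfloor> \<and>
                 (\<forall>v. top_eigenvector Y v \<longrightarrow>
                    err n (sign_vec v) (s n)
                      \<le> exp (- ((1 - e' n) * (real n / 2) * renyi_info (p n) (q n))))}
            \<ge> 1 - d n))))"
proof (intro conjI allI impI, goal_cases)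
  case (1 c0 c1)
  then obtain CI Ce where "0 < CI" "0 < Ce" and *: "\<forall>(n :: nat) s p q P Q.
    hsbm_params n s p q P Q \<and> 0 < c0 * p \<and> c0 * p \<le> q \<and> q < p \<and> p \<le> 1 - c1 \<and> CI \<le> real n * renyi_info p q \<longrightarrow>
    1 - 10 * exp (- sqrt (ln (real n))) \<le> measure_pmf.prob (hsbm n s P Q)
      (rates_hold n s p q (Ce * sqrt (1 / (real n * renyi_info p q))) (Ce * sqrt (1 / (real n * renyi_info p
          q))))"
    using sdp_rates_with_high_probability[of c0 c1] by blast
  show ?case
  proof (rule exI[of _ CI], rule exI[of _ Ce], rule exI[of _ Ce], intro conjI)
    show "0 < CI" "0 < Ce" "0 < Ce" by fact+
  qed (rule *[unfolded rates_hold_def])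
next
  case (2 c0 c1 s p q P Q)
  then have "\<exists>d e :: nat \<Rightarrow> real. d \<longlonglongrightarrow> 0 \<and> e \<longlonglongrightarrow> 0 \<and> (\<forall>n. 0 < n \<and> even n \<longrightarrow>
    1 - d n \<le> measure_pmf.prob (hsbm n (s n) (P n) (Q n)) (rates_hold n (s n) (p n) (q n) (e n) (e n)))"
    by (intro sdp_rates_asymptotic[of c0 c1]) auto
  then obtain d e :: "nat \<Rightarrow> real" where "d \<longlonglongrightarrow> 0" "e \<longlonglongrightarrow> 0" and *: "\<forall>n. 0 < n \<and> even n \<longrightarrow>
    1 - d n \<le> measure_pmf.prob (hsbm n (s n) (P n) (Q n)) (rates_hold n (s n) (p n) (q n) (e n) (e n))"
    by blast
  show ?case
  proof (rule exI[of _ d], rule exI[of _ e], rule exI[of _ e], intro conjI)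
    show "d \<longlonglongrightarrow> 0" "e \<longlonglongrightarrow> 0" "e \<longlonglongrightarrow> 0" by fact+
  qed (rule *[unfolded rates_hold_def])
qed

end
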